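(* Let $A,B,c\in\mathcal O=\mathbb Z[\omega_8]$ with $c\equiv 1\pmod 4$, $(AB,c)=1$, and $A,B$ squares. Then $$\sum_{x(c)}e\!\left(\frac{Ax^4+Bx^2}{c}\right)=\left(\frac{AB}{c}\right)_2 e\!\left(\frac{-B^2\,\overline{8A}}{c}\right)S_4\!\left(\overline{4^2A}\,B^2,\ \overline{4^2A}\,B^2,\ c\right)+\sum_{x(c)}e\!\left(\frac{Ax^2+Bx}{c}\right)+\mathcal X(c),$$ where the cross terms $\mathcal X(c)$ are the sum, over all decompositions $c=nm$ with $n,m\in\mathcal O$, $(n,m)=1$ and neither factor equal to $c$ (up to units), of $$\left[\sum_{x(n)}e\!\left(\frac{\overline m(Ax^2+Bx)}{n}\right)\right]\left[\left(\frac{AB}{m}\right)_2e\!\left(\frac{-B^2\,\overline{8An}}{m}\right)S_4\!\left(B^2\,\overline{n4^2A},\ B^2\,\overline{n4^2A},\ m\right)\right].$$ Decompositions are ordered pairs $(n,m)$, with $(n,m)$ and $(\varepsilon n,\varepsilon^{-1}m)$ identified for units $\varepsilon\in\mathcal O^*$.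
   Context: $\mathbf F=\mathbb Q[\omega_8]$ with $\omega_8$ a primitive 8th root of unity, ring of integers $\mathcal O=\mathbb Z[\omega_8]$. $\delta$ is a fixed generator of the different ideal of $\mathbf F$ and $e(z)=\exp(2\pi i\,\mathrm{Tr}_{\mathbf F/\mathbb Q}(z/\delta))$. $\sum_{x(c)}$ is a sum over residue classes of $\mathcal O/(c)$ and $\sum_{x(c)^*}$ over invertible residue classes. $\left(\frac{\cdot}{c}\right)_2$ and $\left(\frac{\cdot}{c}\right)_4$ are the quadratic and quartic power residue symbols of $\mathbf F$, extended multiplicatively in $c$. In an expression with denominator $c$ inside $e(\cdot)$ or as an argument of $S_4(\cdot,\cdot,c)$, $\overline{y}$ denotes the multiplicative inverse of $y$ modulo $c$ (so $\overline m$ is an inverse modulo $n$ in the first bracket, and inverses in the second bracket are modulo $m$). The Kloosterman sum is $S_4(a,b,c)=\sum_{x(c)^*}\left(\frac xc\right)_4e\!\left(\frac{ax+b\overline x}{c}\right)$.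
   Formalization: The formal theorem assumes in addition that c is not a unit; for a unit c (e.g. c = 1) the identity as printed fails, since the left side is 1, each of the two main terms is 1 and there are no cross terms. *)

theory Defs
  imports Complex_Main "HOL-Computational_Algebra.Computational_Algebra"
begin

definition omega8 :: complex where
  "omega8 = cis (2 * pi / 8)"

definition F8 :: "complex set" where
  "F8 = {poly p omega8 | p. \<forall>i. coeff p i \<in> \<rat>}"

definition O8 :: "complex set" where
  "O8 = {poly p omega8 | p. \<forall>i. coeff p i \<in> \<int>}"

lemma O8_of_int: "of_int k \<in> O8"
  unfolding O8_def
  by (rule CollectI, rule exI[of _ "[:of_int k:]"]) (auto simp: coeff_pCons split: nat.splits)

lemma O8_0: "0 \<in> O8" and O8_1: "1 \<in> O8"
  using O8_of_int[of 0] O8_of_int[of 1] by simp_all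

lemma O8_add: "x \<in> O8 \<Longrightarrow> y \<in> O8 \<Longrightarrow> x + y \<in> O8"
proof -
  assume "x \<in> O8" "y \<in> O8"
  then obtain p q where pq: "x = poly p omega8" "\<forall>i. coeff p i \<in> \<int>"
    "y = poly q omega8" "\<forall>i. coeff q i \<in> \<int>"
    unfolding O8_def by blast
  then show ?thesis
    unfolding O8_def by (intro CollectI exI[of _ "p + q"]) auto
qed

lemma O8_mult: "x \<in> O8 \<Longrightarrow> y \<in> O8 \<Longrightarrow> x * y \<in> O8"
proof -
  assume "x \<in> O8" "y \<in> O8"
  then obtain p q where pq: "x = poly p omega8" "\<forall>i. coeff p i \<in> \<int>"
    "y = poly q omega8" "\<forall>i. coeff q i \<in> \<int>"
    unfolding O8_def by blast
  then show ?thesis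
    unfolding O8_def
    by (intro CollectI exI[of _ "p * q"]) (auto simp: coeff_mult intro!: Ints_sum Ints_mult)
qed

lemma O8_uminus: "x \<in> O8 \<Longrightarrow> - x \<in> O8"
  using O8_mult[OF O8_of_int[of "-1"], of x] by simp

lemma O8_minus: "x \<in> O8 \<Longrightarrow> y \<in> O8 \<Longrightarrow> x - y \<in> O8"
  using O8_add[of x "- y"] O8_uminus[of y] by simp

text \<open>The ring of integers is made a type, so that divisibility, coprimality and prime
  elements are those of the algebraic type classes.\<close>

typedef zeta8 = O8 morphisms to_complex Abs_zeta8
  using O8_0 by blast

setup_lifting type_definition_zeta8

instantiation zeta8 :: comm_ring_1
begin

lift_definition zero_zeta8 :: zeta8 is 0 by (rule O8_0)
lift_definition one_zeta8 :: zeta8 is 1 by (rule O8_1)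
lift_definition plus_zeta8 :: "zeta8 \<Rightarrow> zeta8 \<Rightarrow> zeta8" is "(+)" by (rule O8_add)
lift_definition minus_zeta8 :: "zeta8 \<Rightarrow> zeta8 \<Rightarrow> zeta8" is "(-)" by (rule O8_minus)
lift_definition uminus_zeta8 :: "zeta8 \<Rightarrow> zeta8" is uminus by (rule O8_uminus)
lift_definition times_zeta8 :: "zeta8 \<Rightarrow> zeta8 \<Rightarrow> zeta8" is "(*)" by (rule O8_mult)

instance by standard (transfer; simp add: algebra_simps)+

end

instance zeta8 :: idom
  by standard (transfer; simp)

instantiation zeta8 :: idom_divide
begin

text \<open>Exact division; it is \<open>0\<close> if the quotient is not integral.\<close>

lift_definition divide_zeta8 :: "zeta8 \<Rightarrow> zeta8 \<Rightarrow> zeta8" is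
  "\<lambda>x y. if x / y \<in> O8 then x / y else 0"
  by (auto intro: O8_0)

instance by standard (transfer; simp)+

end

instance zeta8 :: algebraic_semidom ..

text \<open>The trace of \<open>z \<in> F8\<close> is the trace of the \<open>\<rat>\<close>-linear map \<open>w \<mapsto> z * w\<close>,
  computed in the basis \<open>1, omega8, omega8\<^sup>2, omega8\<^sup>3\<close>.\<close>

definition coord8 :: "complex \<Rightarrow> nat \<Rightarrow> rat" where
  "coord8 z = (THE q. z = (\<Sum>j<4. of_rat (q j) * omega8 ^ j) \<and> (\<forall>j\<ge>4. q j = 0))"

definition trace8 :: "complex \<Rightarrow> rat" where
  "trace8 z = (\<Sum>j<4. coord8 (z * omega8 ^ j) j)"

definition codifferent8 :: "complex set" where
  "codifferent8 = {x \<in> F8. \<forall>y \<in> O8. trace8 (x * y) \<in> \<int>}"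

definition different8 :: "complex set" where
  "different8 = {y \<in> F8. \<forall>x \<in> codifferent8. x * y \<in> O8}"

definition generates_different :: "complex \<Rightarrow> bool" where
  "generates_different \<delta> \<longleftrightarrow> different8 = (\<lambda>y. \<delta> * y) ` O8"

definition e8 :: "complex \<Rightarrow> complex \<Rightarrow> complex" where
  "e8 \<delta> z = exp (2 * of_real pi * \<i> * of_rat (trace8 (z / \<delta>)))"

definition efrac :: "complex \<Rightarrow> zeta8 \<Rightarrow> zeta8 \<Rightarrow> complex" where
  "efrac \<delta> a c = e8 \<delta> (to_complex a / to_complex c)"

definition cong8 :: "zeta8 \<Rightarrow> zeta8 \<Rightarrow> zeta8 \<Rightarrow> bool" where
  "cong8 c x y \<longleftrightarrow> c dvd x - y"

definition residue_classes :: "zeta8 \<Rightarrow> zeta8 set set" where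
  "residue_classes c = UNIV // {(x, y). cong8 c x y}"

definition invertible_classes :: "zeta8 \<Rightarrow> zeta8 set set" where
  "invertible_classes c = {X \<in> residue_classes c. \<exists>x\<in>X. \<exists>y. cong8 c (x * y) 1}"

text \<open>Summands are evaluated at an arbitrary representative of each class; the summands
  used below depend only on the class.\<close>

definition sum_mod :: "zeta8 \<Rightarrow> (zeta8 \<Rightarrow> complex) \<Rightarrow> complex" where
  "sum_mod c f = (\<Sum>X\<in>residue_classes c. f (SOME x. x \<in> X))"

definition sum_mod_inv :: "zeta8 \<Rightarrow> (zeta8 \<Rightarrow> complex) \<Rightarrow> complex" where
  "sum_mod_inv c f = (\<Sum>X\<in>invertible_classes c. f (SOME x. x \<in> X))"

definition inv_mod :: "zeta8 \<Rightarrow> zeta8 \<Rightarrow> zeta8" where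
  "inv_mod c y = (SOME z. cong8 c (y * z) 1)"

definition absnorm8 :: "zeta8 \<Rightarrow> nat" where
  "absnorm8 c = card (residue_classes c)"

text \<open>The \<open>k\<close>-th power residue symbol at a prime \<open>p\<close> not dividing \<open>k\<close>, for \<open>k\<close> dividing 8.\<close>

definition residue_symbol_prime :: "nat \<Rightarrow> zeta8 \<Rightarrow> zeta8 \<Rightarrow> zeta8" where
  "residue_symbol_prime k x p =
     (if p dvd x then 0
      else (THE \<zeta>. \<zeta> ^ k = 1 \<and> cong8 p \<zeta> (x ^ ((absnorm8 p - 1) div k))))"

text \<open>The extension to composite \<open>c \<noteq> 0\<close> uses a prime factorisation of \<open>c\<close> up to a unit;
  the choice is immaterial, since the symbol at \<open>p\<close> depends only on the ideal of \<open>p\<close>.\<close>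

definition prime_factors8 :: "zeta8 \<Rightarrow> zeta8 multiset" where
  "prime_factors8 c =
     (SOME M. (\<forall>p\<in>#M. prime_elem p) \<and> (\<exists>u. is_unit u \<and> c = u * prod_mset M))"

definition residue_symbol :: "nat \<Rightarrow> zeta8 \<Rightarrow> zeta8 \<Rightarrow> complex" where
  "residue_symbol k x c =
     to_complex (\<Prod>p\<in>#prime_factors8 c. residue_symbol_prime k x p)"

definition S4 :: "complex \<Rightarrow> zeta8 \<Rightarrow> zeta8 \<Rightarrow> zeta8 \<Rightarrow> complex" where
  "S4 \<delta> a b c =
     sum_mod_inv c (\<lambda>x. residue_symbol 4 x c * efrac \<delta> (a * x + b * inv_mod c x) c)"

definition decompositions :: "zeta8 \<Rightarrow> (zeta8 \<times> zeta8) set" where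
  "decompositions c = {(n, m). c = n * m \<and> coprime n m \<and>
     \<not> (\<exists>\<epsilon>. is_unit \<epsilon> \<and> n = \<epsilon> * c) \<and> \<not> (\<exists>\<epsilon>. is_unit \<epsilon> \<and> m = \<epsilon> * c)}"

definition unit_equiv :: "((zeta8 \<times> zeta8) \<times> (zeta8 \<times> zeta8)) set" where
  "unit_equiv = {((n, m), (n', m')). \<exists>\<epsilon> \<epsilon>'. \<epsilon> * \<epsilon>' = 1 \<and> n' = \<epsilon> * n \<and> m' = \<epsilon>' * m}"

definition cross_term ::
    "complex \<Rightarrow> zeta8 \<Rightarrow> zeta8 \<Rightarrow> zeta8 \<Rightarrow> zeta8 \<Rightarrow> complex" where
  "cross_term \<delta> A B n m =
     sum_mod n (\<lambda>x. efrac \<delta> (inv_mod n m * (A * x ^ 2 + B * x)) n) *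
     (residue_symbol 2 (A * B) m *
      efrac \<delta> (- (B ^ 2) * inv_mod m (8 * A * n)) m *
      S4 \<delta> (B ^ 2 * inv_mod m (n * 4 ^ 2 * A)) (B ^ 2 * inv_mod m (n * 4 ^ 2 * A)) m)"

definition cross_terms :: "complex \<Rightarrow> zeta8 \<Rightarrow> zeta8 \<Rightarrow> zeta8 \<Rightarrow> complex" where
  "cross_terms \<delta> A B c =
     (\<Sum>D\<in>decompositions c // unit_equiv.
        case (SOME d. d \<in> D) of (n, m) \<Rightarrow> cross_term \<delta> A B n m)"

end

theory Submission
  imports Defs
begin

text \<open>
Put \<open>D = B\<^sup>2 / (16 A)\<close> modulo \<open>c\<close> and let \<open>AB = s\<^sup>2\<close>. The substitutions \<open>z = 2sx/B\<close> and
\<open>z = 2 + 4Ax/B\<close> turn the quartic and the quadratic sum into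

  \<open>L(D, c) = \<Sum> e(D (z\<^sup>4 + 4 z\<^sup>2) / c)\<close> and \<open>Q(D, c) = \<Sum> e(D (z\<^sup>2 - 4) / c)\<close>;

since \<open>(AB / c)\<^sub>2 = 1\<close> and \<open>x + 1/x - 2 = (x - 1)\<^sup>2 / x\<close>, the Kloosterman term is

  \<open>E(D, c) = \<Sum> (x / c)\<^sub>4 e(D (x - 1)\<^sup>2 x\<^sup>-\<^sup>1 / c)\<close>, summed over the units \<open>x\<close>.

All three satisfy the same twisted multiplicativity
\<open>M(D, nm) = M(D/m, n) M(D/n, m)\<close> for coprime \<open>n, m\<close>, so \<open>M(D, c)\<close> is a product over the prime
powers dividing \<open>c\<close>. If \<open>L = Q + E\<close> holds for prime powers, expanding the product of the \<open>Q + E\<close>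
gives one term for each set of prime powers dividing \<open>c\<close>, that is, for each coprime decomposition
\<open>c = nm\<close> up to units: the two trivial ones give \<open>Q(D, c)\<close> and \<open>E(D, c)\<close>, the others the
cross terms (\<open>quartic_sum_decomposition\<close>). This needs unique factorisation in \<open>\<int>[\<omega>]\<close>, which holds
because the ring is Euclidean for the norm.

For a prime \<open>p\<close> the identity \<open>L = Q + E\<close> (\<open>prime_sum_identity\<close>) is elementary. Counting square roots by
\<open>1 + \<psi>\<close>, with \<open>\<psi>\<close> the quadratic character, \<open>L - Q\<close> is \<open>K = \<Sum> \<psi>(y) e(D (y\<^sup>2 + 4y) / p)\<close>. On the other side the
nonsquares \<open>x\<close> cancel in pairs \<open>x, 1/x\<close>, as \<open>(x / p)\<^sub>4\<close> is purely imaginary there; for a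
square \<open>x = u\<^sup>2\<close> the symbol is \<open>\<psi>(u)\<close>, and \<open>y = (u - 1)\<^sup>2 / u\<close> satisfies
\<open>(u\<^sup>2 - 1)\<^sup>2 / u\<^sup>2 = y\<^sup>2 + 4y\<close>, which leads back to \<open>K\<close>.

For \<open>p\<^sup>k\<close> with \<open>k \<ge> 2\<close> (\<open>quartic_sum_prime_power\<close>) only the residues near the critical points
modulo \<open>p\<close> contribute: \<open>z = 0\<close> and \<open>z\<^sup>2 = -2\<close> for \<open>L\<close>, \<open>z = 0\<close> for \<open>Q\<close>, \<open>x = 1\<close> and \<open>x = -1\<close>
for \<open>E\<close>. No Gauss sum has to be evaluated, because the local pieces match by substitution with \<open>y\<close> near \<open>1\<close>:
\<open>z = y - 1/y\<close> and \<open>x = y\<^sup>4\<close> identify \<open>z = 0\<close> in \<open>L\<close> with \<open>x = 1\<close> in \<open>E\<close>; \<open>w = z\<^sup>2 + 2\<close>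
identifies each of the two pieces \<open>z\<^sup>2 = -2\<close> in \<open>L\<close> with \<open>Q\<close>; and \<open>x = - y\<^sup>2\<close>,
\<open>w = i (y - 1/y)\<close> identify \<open>x = -1\<close> in \<open>E\<close> with \<open>Q\<close>. The ring contains \<open>i\<close>, a square root of
\<open>-2\<close> and a fourth root of \<open>-1\<close>; they give the last two substitutions, the points \<open>z\<^sup>2 = -2\<close> and
\<open>(-1 / p)\<^sub>4 = 1\<close>.
\<close>

section \<open>The ring and its coordinates\<close>

lemma to_complex_simps [simp]:
  "to_complex 0 = 0" "to_complex 1 = 1" "to_complex (x + y) = to_complex x + to_complex y"
  "to_complex (x - y) = to_complex x - to_complex y" "to_complex (- x) = - to_complex x"
  "to_complex (x * y) = to_complex x * to_complex y"
  by (simp_all add: zero_zeta8.rep_eq one_zeta8.rep_eq plus_zeta8.rep_eq minus_zeta8.rep_eq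
      uminus_zeta8.rep_eq times_zeta8.rep_eq)

lemma to_complex_power [simp]: "to_complex (x ^ n) = to_complex x ^ n"
  by (induction n) auto

lemma to_complex_of_nat [simp]: "to_complex (of_nat n) = of_nat n"
  by (induction n) auto

lemma to_complex_of_int [simp]: "to_complex (of_int n) = of_int n"
  by (cases n rule: int_cases2) auto

lemma to_complex_inject_iff [simp]: "to_complex x = to_complex y \<longleftrightarrow> x = y"
  by (rule to_complex_inject)

lemma to_complex_eq_0 [simp]: "to_complex x = 0 \<longleftrightarrow> x = 0"
  using to_complex_inject[of x 0] by simp

lift_definition w8 :: zeta8 is omega8
  unfolding O8_def by (rule CollectI, rule exI[of _ "[:0, 1:]"]) (auto simp: coeff_pCons split: nat.splits)

lemma omega8_eq: "omega8 = Complex (sqrt 2 / 2) (sqrt 2 / 2)"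
  by (simp add: omega8_def complex_eq_iff cos_45 sin_45)

lemma omega8_2: "omega8 ^ 2 = \<i>"
  by (simp add: omega8_eq complex_eq_iff power2_eq_square)

lemma omega8_3: "omega8 ^ 3 = Complex (- (sqrt 2 / 2)) (sqrt 2 / 2)"
proof -
  have "omega8 ^ 3 = omega8 ^ 2 * omega8" by (simp add: power3_eq_cube power2_eq_square)
  then show ?thesis by (simp add: omega8_2, simp add: omega8_eq complex_eq_iff)
qed

lemma omega8_4: "omega8 ^ 4 = -1"
proof -
  have "omega8 ^ 4 = (omega8 ^ 2) ^ 2" by (simp flip: power_mult)
  then show ?thesis by (simp add: omega8_2)
qed

lemma w8_4: "w8 ^ 4 = -1"
  using to_complex_inject[of "w8 ^ 4" "-1"] by (simp add: w8.rep_eq omega8_4)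


text \<open>The parameter \<open>t\<close> is kept free so that the same computations serve \<open>omega8\<close> in the complex numbers
and \<open>w8\<close> in the ring.\<close>
definition lin8 :: "'a::comm_ring_1 \<Rightarrow> 'a \<Rightarrow> 'a \<Rightarrow> 'a \<Rightarrow> 'a \<Rightarrow> 'a" where
  "lin8 t a b c d = a + b * t + c * t ^ 2 + d * t ^ 3"

lemma lin8_add: "lin8 t a b c d + lin8 t a' b' c' d' = lin8 t (a + a') (b + b') (c + c') (d + d')"
  by (simp add: lin8_def algebra_simps)

lemma lin8_mult:
  assumes "t ^ 4 = (-1 :: 'a :: idom)"
  shows "lin8 t a b c d * lin8 t a' b' c' d' =
    lin8 t (a*a' - b*d' - c*c' - d*b') (a*b' + b*a' - c*d' - d*c')
      (a*c' + b*b' + c*a' - d*d') (a*d' + b*c' + c*b' + d*a')"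
proof -
  have "lin8 t a b c d * lin8 t a' b' c' d' -
    lin8 t (a*a' - b*d' - c*c' - d*b') (a*b' + b*a' - c*d' - d*c')
      (a*c' + b*b' + c*a' - d*d') (a*d' + b*c' + c*b' + d*a') =
     (t ^ 4 + 1) * ((b*d' + c*c' + d*b') + (c*d' + d*c') * t + d*d' * t^2)"
    unfolding lin8_def by algebra
  then show ?thesis using assms by simp
qed

text \<open>Reducing by \<open>omega8\<^sup>4 = -1\<close> uses only sums and negatives of coefficients, so \<open>K\<close> may be
the integers or the rationals.\<close>
lemma poly_omega8_lin8:
  assumes "\<And>i. coeff p i \<in> K" "0 \<in> K" "\<And>x. x \<in> K \<Longrightarrow> - x \<in> K" "\<And>x y. x \<in> K \<Longrightarrow> y \<in> K \<Longrightarrow> x + y \<in> K"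
  shows "\<exists>a\<in>K. \<exists>b\<in>K. \<exists>c\<in>K. \<exists>d\<in>K. poly p omega8 = lin8 omega8 a b c d"
  using assms(1)
proof (induction p)
  case 0
  then show ?case using assms(2) by (intro bexI[of _ 0]) (auto simp: lin8_def)
next
  case (pCons x p)
  have "coeff p i \<in> K" for i using pCons.prems[of "Suc i"] by simp
  then obtain a b c d where h: "a \<in> K" "b \<in> K" "c \<in> K" "d \<in> K" "poly p omega8 = lin8 omega8 a b c d"
    using pCons.IH by blast
  have "x \<in> K" using pCons.prems[of 0] by simp
  then have "x + - d \<in> K" using assms h by blast
  moreover have "poly (pCons x p) omega8 = lin8 omega8 (x + - d) a b c"
  proof -
    have "poly (pCons x p) omega8 = lin8 omega8 (x + - d) a b c + d * (omega8 ^ 4 + 1)"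
      unfolding poly_pCons h(5) lin8_def by algebra
    then show ?thesis by (simp add: omega8_4)
  qed
  ultimately show ?case using h by blast
qed

text \<open>Infinite descent: both sides are even, and halving \<open>S\<close> and \<open>T\<close> gives a smaller solution.\<close>
lemma int_sq_eq_two_sq: "(S::int)^2 = 2 * T^2 \<Longrightarrow> S = 0"
proof (induction "nat \<bar>S\<bar>" arbitrary: S T rule: less_induct)
  case less
  have "even (S^2)" using less.prems by simp
  then obtain S' where S: "S = 2 * S'" by auto
  have T: "T ^ 2 = 2 * S' ^ 2" using less.prems S by (simp add: power2_eq_square)
  then have "even (T ^ 2)" by simp
  then obtain T' where T': "T = 2 * T'" by auto
  have "S' ^ 2 = 2 * T' ^ 2" using T T' by (simp add: power2_eq_square)
  show ?case
  proof (rule ccontr)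
    assume "S \<noteq> 0"
    then have "nat \<bar>S'\<bar> < nat \<bar>S\<bar>" using S by auto
    from less.hyps[OF this \<open>S' ^ 2 = 2 * T' ^ 2\<close>] \<open>S \<noteq> 0\<close> S show False by simp
  qed
qed

lemma rat_sq_eq_two_sq: 
  assumes "(x::rat)^2 = 2 * y^2" shows "x = 0"
proof -
  obtain p q where x: "x = of_int p / of_int q" "q > 0"
    by (metis quotient_of_div quotient_of_denom_pos surj_pair)
  obtain r s where y: "y = of_int r / of_int s" "s > 0"
    by (metis quotient_of_div quotient_of_denom_pos surj_pair)
  have "of_int ((p * s)^2) = (of_int (2 * (r * q)^2) :: rat)"
    using assms x y by (simp add: field_simps)
  then have "(p * s)^2 = 2 * (r * q)^2" by (simp only: of_int_eq_iff)
  then have "p * s = 0" by (rule int_sq_eq_two_sq)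
  then show ?thesis using x y by simp
qed

lemma rat_sqrt2_indep:
  assumes "of_rat x + of_rat y * sqrt 2 = 0" shows "x = 0 \<and> y = 0"
proof -
  have "of_rat (x ^ 2) = (of_rat x) ^ 2" by (simp add: of_rat_power)
  also have "of_rat x = - (of_rat y * sqrt 2)" using assms by simp
  also have "(- (of_rat y * sqrt 2)) ^ 2 = of_rat (2 * y ^ 2)"
    by (simp add: power_mult_distrib of_rat_mult of_rat_power)
  finally have "x ^ 2 = 2 * y ^ 2" by (simp only: of_rat_eq_iff)
  then have "x = 0" by (rule rat_sq_eq_two_sq)
  then show ?thesis using assms by simp
qed

text \<open>Real and imaginary parts are rational combinations of \<open>1\<close> and \<open>sqrt 2\<close>, so the irrationality of
\<open>sqrt 2\<close> gives linear independence of the powers of \<open>omega8\<close>.\<close>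
lemma lin8_omega8_eq_0:
  assumes "lin8 omega8 (of_rat a) (of_rat b) (of_rat c) (of_rat d) = 0"
  shows "a = 0 \<and> b = 0 \<and> c = 0 \<and> d = 0"
proof -
  have R: "of_rat r = complex_of_real (of_rat r)" for r
    by (cases r) (simp add: of_rat_rat)
  have "Re (lin8 omega8 (of_rat a) (of_rat b) (of_rat c) (of_rat d)) = of_rat a + of_rat ((b - d) / 2) * sqrt 2"
       "Im (lin8 omega8 (of_rat a) (of_rat b) (of_rat c) (of_rat d)) = of_rat c + of_rat ((b + d) / 2) * sqrt 2"
    unfolding lin8_def omega8_2 omega8_3 R
    by (simp_all add: omega8_eq of_rat_divide of_rat_add of_rat_diff left_diff_distrib' distrib_right add_divide_distrib diff_divide_distrib)
  with assms rat_sqrt2_indep have "a = 0 \<and> (b - d) / 2 = 0" "c = 0 \<and> (b + d) / 2 = 0"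
    by (metis zero_complex.sel)+
  then show ?thesis by auto
qed

lemma coord8_unique:
  assumes "z = lin8 omega8 (of_rat a) (of_rat b) (of_rat c) (of_rat d)"
  shows "coord8 z 0 = a" "coord8 z 1 = b" "coord8 z 2 = c" "coord8 z 3 = d"
proof -
  define q :: "nat \<Rightarrow> rat" where "q = (\<lambda>j. if j = 0 then a else if j = 1 then b else if j = 2 then c else if j = 3 then d else 0)"
  have sum4: "(\<Sum>j<4. f j) = f 0 + f 1 + f 2 + f (3::nat)" for f :: "nat \<Rightarrow> complex"
    by (simp add: eval_nat_numeral)
  have "coord8 z = q"
    unfolding coord8_def
  proof (rule the_equality)
    show "z = (\<Sum>j<4. of_rat (q j) * omega8 ^ j) \<and> (\<forall>j\<ge>4. q j = 0)"
      using assms by (auto simp: sum4 q_def lin8_def)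
  next
    fix q' assume q': "z = (\<Sum>j<4. of_rat (q' j) * omega8 ^ j) \<and> (\<forall>j\<ge>4. q' j = 0)"
    have "lin8 omega8 (of_rat (q' 0 - a)) (of_rat (q' 1 - b)) (of_rat (q' 2 - c)) (of_rat (q' 3 - d)) = 0"
      using q' assms by (simp add: sum4 lin8_def of_rat_diff algebra_simps)
    from lin8_omega8_eq_0[OF this] have "q' 0 = a" "q' 1 = b" "q' 2 = c" "q' 3 = d" by auto
    show "q' = q"
    proof
      fix j :: nat
      consider "j = 0" | "j = 1" | "j = 2" | "j = 3" | "j \<ge> 4" by linarith
      then show "q' j = q j"
        using q' \<open>q' 0 = a\<close> \<open>q' 1 = b\<close> \<open>q' 2 = c\<close> \<open>q' 3 = d\<close>
        by cases (auto simp: q_def)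
    qed
  qed
  then show "coord8 z 0 = a" "coord8 z 1 = b" "coord8 z 2 = c" "coord8 z 3 = d"
    by (simp_all add: q_def)
qed

lemma F8_lin8: 
  assumes "z \<in> F8" 
  shows "z = lin8 omega8 (of_rat (coord8 z 0)) (of_rat (coord8 z 1)) (of_rat (coord8 z 2)) (of_rat (coord8 z 3))"
proof -
  from assms obtain p where p: "z = poly p omega8" "\<And>i. coeff p i \<in> \<rat>" unfolding F8_def by blast
  obtain a b c d where "a \<in> \<rat>" "b \<in> \<rat>" "c \<in> \<rat>" "d \<in> \<rat>" and z: "z = lin8 omega8 a b c d"
    using poly_omega8_lin8[of p \<rat>] p by auto
  then obtain a' b' c' d' where "a = of_rat a'" "b = of_rat b'" "c = of_rat c'" "d = of_rat d'"
    unfolding Rats_def by blast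
  with z have z: "z = lin8 omega8 (of_rat a') (of_rat b') (of_rat c') (of_rat d')" by simp
  show ?thesis using coord8_unique[OF z] z by simp
qed

lemma F8_lin8I: "lin8 omega8 (of_rat a) (of_rat b) (of_rat c) (of_rat d) \<in> F8"
  unfolding F8_def lin8_def
  by (rule CollectI, rule exI[of _ "[:of_rat a, of_rat b, of_rat c, of_rat d:]"])
     (auto simp: coeff_pCons algebra_simps power2_eq_square power3_eq_cube split: nat.splits)

lemma F8_mult: "x \<in> F8 \<Longrightarrow> y \<in> F8 \<Longrightarrow> x * y \<in> F8"
proof -
  assume "x \<in> F8" "y \<in> F8"
  then obtain p q where pq: "x = poly p omega8" "\<forall>i. coeff p i \<in> \<rat>"
    "y = poly q omega8" "\<forall>i. coeff q i \<in> \<rat>"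
    unfolding F8_def by blast
  then show ?thesis
    unfolding F8_def
    by (intro CollectI exI[of _ "p * q"]) (auto simp: coeff_mult intro!: Rats_sum Rats_mult)
qed

lemma O8_subset_F8: "O8 \<subseteq> F8"
proof -
  have "(\<int> :: complex set) \<subseteq> \<rat>" by (auto simp: Ints_def)
  then show ?thesis unfolding O8_def F8_def by blast
qed

lemma to_complex_in_F8: "to_complex x \<in> F8"
  using to_complex[of x] O8_subset_F8 by blast

definition mk8 :: "int \<Rightarrow> int \<Rightarrow> int \<Rightarrow> int \<Rightarrow> zeta8" where
  "mk8 a b c d = lin8 w8 (of_int a) (of_int b) (of_int c) (of_int d)"

lemma to_complex_mk8: "to_complex (mk8 a b c d) = lin8 omega8 (of_int a) (of_int b) (of_int c) (of_int d)"
  by (simp add: mk8_def lin8_def w8.rep_eq)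

lemma mk8_exists: "\<exists>a b c d. x = mk8 a b c d"
proof -
  from to_complex[of x] obtain p where p: "to_complex x = poly p omega8" "\<And>i. coeff p i \<in> \<int>"
    unfolding O8_def by blast
  obtain a b c d where "a \<in> \<int>" "b \<in> \<int>" "c \<in> \<int>" "d \<in> \<int>" and z: "to_complex x = lin8 omega8 a b c d"
    using poly_omega8_lin8[of p \<int>] p by auto
  then obtain a' b' c' d' where "a = of_int a'" "b = of_int b'" "c = of_int c'" "d = of_int d'"
    by (meson Ints_cases)
  with z have "to_complex x = to_complex (mk8 a' b' c' d')" by (simp add: to_complex_mk8)
  then show ?thesis by auto
qed

text \<open>The coordinates of a ring element are integers, so the floor is only a change of type.\<close>
definition co8 :: "zeta8 \<Rightarrow> nat \<Rightarrow> int" where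
  "co8 x j = \<lfloor>coord8 (to_complex x) j\<rfloor>"

lemma co8_mk8 [simp]: 
  "co8 (mk8 a b c d) 0 = a" "co8 (mk8 a b c d) 1 = b"
  "co8 (mk8 a b c d) 2 = c" "co8 (mk8 a b c d) 3 = d"
proof -
  have "to_complex (mk8 a b c d) = lin8 omega8 (of_rat (of_int a)) (of_rat (of_int b)) (of_rat (of_int c)) (of_rat (of_int d))"
    by (simp add: to_complex_mk8)
  note coord8_unique[OF this]
  then show "co8 (mk8 a b c d) 0 = a" "co8 (mk8 a b c d) 1 = b"
    "co8 (mk8 a b c d) 2 = c" "co8 (mk8 a b c d) 3 = d" by (simp_all add: co8_def)
qed

lemma mk8_inject: "mk8 a b c d = mk8 a' b' c' d' \<longleftrightarrow> a = a' \<and> b = b' \<and> c = c' \<and> d = d'"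
  by (metis co8_mk8)

lemma mk8_mult: "mk8 a b c d * mk8 a' b' c' d' =
    mk8 (a*a' - b*d' - c*c' - d*b') (a*b' + b*a' - c*d' - d*c')
      (a*c' + b*b' + c*a' - d*d') (a*d' + b*c' + c*b' + d*a')"
  unfolding mk8_def by (subst lin8_mult[OF w8_4]) simp

lemma mk8_of_int: "of_int n = mk8 n 0 0 0" by (simp add: mk8_def lin8_def)
lemma mk8_diff: "mk8 a b c d - mk8 a' b' c' d' = mk8 (a - a') (b - b') (c - c') (d - d')"
  by (simp add: mk8_def lin8_def algebra_simps)

instance zeta8 :: ring_char_0
proof
  have "inj (\<lambda>n. to_complex (of_nat n))" by (simp add: inj_def)
  then show "inj (of_nat :: nat \<Rightarrow> zeta8)" unfolding inj_def by (metis)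
qed


section \<open>The norm and unique factorisation\<close>

text \<open>For \<open>z = a + b\<omega> + c\<omega>\<^sup>2 + d\<omega>\<^sup>3\<close> one has \<open>\<bar>z\<bar>\<^sup>2 = nS + nT sqrt 2\<close>, and the image of \<open>z\<close> under \<open>\<omega> \<mapsto> \<omega>\<^sup>3\<close> has
absolute value squared \<open>nS - nT sqrt 2\<close>; hence the norm is \<open>nS\<^sup>2 - 2 nT\<^sup>2\<close>.\<close>
definition nS :: "int \<Rightarrow> int \<Rightarrow> int \<Rightarrow> int \<Rightarrow> int" where "nS a b c d = a^2 + b^2 + c^2 + d^2"
definition nT :: "int \<Rightarrow> int \<Rightarrow> int \<Rightarrow> int \<Rightarrow> int" where "nT a b c d = a*b + b*c + c*d - a*d"

definition nrm8 :: "zeta8 \<Rightarrow> int" where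
  "nrm8 x = (nS (co8 x 0) (co8 x 1) (co8 x 2) (co8 x 3))^2 - 2 * (nT (co8 x 0) (co8 x 1) (co8 x 2) (co8 x 3))^2"

lemma nrm8_mk8: "nrm8 (mk8 a b c d) = (nS a b c d)^2 - 2 * (nT a b c d)^2"
  unfolding nrm8_def co8_mk8 ..

lemma nrm8_mult: "nrm8 (x * y) = nrm8 x * nrm8 y"
proof -
  obtain a b c d a' b' c' d' where x: "x = mk8 a b c d" and y: "y = mk8 a' b' c' d'"
    using mk8_exists by metis
  have S: "nS (a*a' - b*d' - c*c' - d*b') (a*b' + b*a' - c*d' - d*c')
      (a*c' + b*b' + c*a' - d*d') (a*d' + b*c' + c*b' + d*a') = nS a b c d * nS a' b' c' d' + 2 * nT a b c d * nT a' b' c' d'"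
    unfolding nS_def nT_def by algebra
  have T: "nT (a*a' - b*d' - c*c' - d*b') (a*b' + b*a' - c*d' - d*c')
      (a*c' + b*b' + c*a' - d*d') (a*d' + b*c' + c*b' + d*a') = nS a b c d * nT a' b' c' d' + nT a b c d * nS a' b' c' d'"
    unfolding nS_def nT_def by algebra
  show ?thesis unfolding x y mk8_mult nrm8_mk8 S T by algebra
qed

text \<open>The right-hand side is the relative norm to \<open>\<rat>(sqrt (-2))\<close> followed by its norm form; it shows that the
norm is nonnegative.\<close>
lemma nS_nT: "(nS a b c d)^2 - 2 * (nT a b c d)^2 = (a^2 - b^2 + c^2 - d^2)^2 + 2 * (b * (c - a) - d * (a + c))^2"
  unfolding nS_def nT_def by algebra

lemma nrm8_nonneg: "nrm8 x \<ge> 0"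
  unfolding nrm8_def nS_nT by simp

lemma nS_eq_0: "nS a b c d = 0 \<longleftrightarrow> a = 0 \<and> b = 0 \<and> c = 0 \<and> d = 0"
proof
  assume "nS a b c d = 0"
  moreover have "a^2 \<ge> 0" "b^2 \<ge> 0" "c^2 \<ge> 0" "d^2 \<ge> 0" by simp_all
  ultimately have "a^2 = 0" "b^2 = 0" "c^2 = 0" "d^2 = 0" unfolding nS_def by linarith+
  then show "a = 0 \<and> b = 0 \<and> c = 0 \<and> d = 0" by simp
qed (simp add: nS_def)

lemma nrm8_eq_0: "nrm8 x = 0 \<longleftrightarrow> x = 0"
proof -
  obtain a b c d where x: "x = mk8 a b c d" using mk8_exists by metis
  have "nrm8 x = 0 \<Longrightarrow> nS a b c d = 0"
    unfolding x nrm8_mk8 by (rule int_sq_eq_two_sq[of _ "nT a b c d"]) simp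
  moreover have "mk8 0 0 0 0 = 0" by (simp add: mk8_def lin8_def)
  then have "x = 0 \<longleftrightarrow> nS a b c d = 0" unfolding nS_eq_0 x by (metis mk8_inject)
  moreover have "nrm8 x = 0" if "nS a b c d = 0"
    using that unfolding x nrm8_mk8 nS_eq_0 by (simp add: nS_def nT_def)
  ultimately show ?thesis by blast
qed

lemma nrm8_1: "nrm8 1 = 1"
  using mk8_of_int[of 1] nrm8_mk8[of 1 0 0 0] by (simp add: nS_def nT_def)

lemma nrm8_of_int: "nrm8 (of_int n) = n ^ 4"
  unfolding mk8_of_int nrm8_mk8 by (simp add: nS_def nT_def)

lemma dvd_nrm8: "x dvd of_int (nrm8 x)"
proof -
  obtain a b c d where x: "x = mk8 a b c d" using mk8_exists by metis
  have "of_int (nrm8 x) = x * (mk8 a (-d) (-c) (-b) * mk8 (nS a b c d) (- nT a b c d) 0 (nT a b c d))"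
    unfolding x nrm8_mk8 mk8_mult mk8_of_int mk8_inject nS_def nT_def by algebra
  then show ?thesis by simp
qed

lemma is_unit_iff_nrm8: "is_unit x \<longleftrightarrow> nrm8 x = 1"
proof
  assume "is_unit x"
  then obtain y where "1 = x * y" by auto
  then have "nrm8 x * nrm8 y = 1" using nrm8_mult[of x y] nrm8_1 by simp
  then show "nrm8 x = 1" using nrm8_nonneg[of x] by (auto simp: zmult_eq_1_iff)
next
  assume "nrm8 x = 1" then show "is_unit x" using dvd_nrm8[of x] by simp
qed

text \<open>The sharp case of the Euclidean property. As \<open>nS \<le> n\<^sup>2\<close>, the norm is at most \<open>n\<^sup>4\<close>; equality would
need all four coordinates to be \<open>\<plusminus> n/2\<close>, but then the four summands \<open>\<plusminus> n\<^sup>2/4\<close> of \<open>nT\<close>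
have negative product and cannot cancel.\<close>
lemma nrm8_lt:
  assumes "n > 0" "2 * \<bar>a\<bar> \<le> n" "2 * \<bar>b\<bar> \<le> n" "2 * \<bar>c\<bar> \<le> n" "2 * \<bar>d\<bar> \<le> n"
  shows "nrm8 (mk8 a b c d) < n ^ 4"
proof -
  have sq: "4 * x^2 \<le> n^2" if "2 * \<bar>x\<bar> \<le> n" for x :: int
    using power_mono[of "2 * \<bar>x\<bar>" n 2] that by (simp add: power_mult_distrib)
  have 4: "4 * a^2 \<le> n^2" "4 * b^2 \<le> n^2" "4 * c^2 \<le> n^2" "4 * d^2 \<le> n^2" using assms sq by auto
  have S: "nS a b c d \<le> n^2" "nS a b c d \<ge> 0" unfolding nS_def using 4 by auto
  have n4: "n ^ 4 = (n^2)^2" by simp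
  show ?thesis
  proof (cases "nS a b c d = n^2")
    case False
    then have "(nS a b c d)^2 < (n^2)^2" using S by (intro power_strict_mono) auto
    then show ?thesis unfolding nrm8_mk8 n4 by (smt (verit) zero_le_power2)
  next
    case True
    then have eq: "4 * a^2 = n^2" "4 * b^2 = n^2" "4 * c^2 = n^2" "4 * d^2 = n^2" unfolding nS_def using 4 by linarith+
    then have "a \<noteq> 0" using assms(1) by auto
    have "b^2 = a^2" "c^2 = a^2" "d^2 = a^2" using eq by linarith+
    then have "b = a \<or> b = -a" "c = a \<or> c = -a" "d = a \<or> d = -a" by (simp_all add: power2_eq_iff)
    then have "nT a b c d = 2 * a^2 \<or> nT a b c d = - 2 * a^2" unfolding nT_def by (auto simp: power2_eq_square)
    then have "nT a b c d \<noteq> 0" using \<open>a \<noteq> 0\<close> by auto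
    then have "(nT a b c d)^2 > 0" by simp
    then show ?thesis unfolding nrm8_mk8 n4 True by linarith
  qed
qed

lemma int_nearest: 
  assumes "(n::int) > 0" shows "\<exists>q. 2 * \<bar>t - n * q\<bar> \<le> n"
proof -
  let ?q = "(2 * t + n) div (2 * n)"
  have "(2 * n) * ?q + (2 * t + n) mod (2 * n) = 2 * t + n" by simp
  moreover have "0 \<le> (2 * t + n) mod (2 * n)" "(2 * t + n) mod (2 * n) < 2 * n" using assms by auto
  ultimately have "2 * \<bar>t - n * ?q\<bar> \<le> n" by (simp add: algebra_simps abs_if)
  then show ?thesis ..
qed

text \<open>Division by \<open>y\<close> is division of \<open>x z\<close> by the integer \<open>n = y z\<close>, where each coordinate can be
rounded to a nearest multiple of \<open>n\<close>.\<close>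
lemma euclid8:
  assumes "y \<noteq> 0" shows "\<exists>q. nrm8 (x - q * y) < nrm8 y"
proof -
  define n where "n = nrm8 y"
  have n: "n > 0" using nrm8_nonneg[of y] nrm8_eq_0[of y] assms unfolding n_def by linarith
  obtain z where z: "of_int n = y * z" using dvd_nrm8[of y] unfolding n_def by auto
  obtain a b c d where t: "x * z = mk8 a b c d" using mk8_exists by metis
  obtain a' b' c' d' where q: "2 * \<bar>a - n * a'\<bar> \<le> n" "2 * \<bar>b - n * b'\<bar> \<le> n" "2 * \<bar>c - n * c'\<bar> \<le> n" "2 * \<bar>d - n * d'\<bar> \<le> n"
    using int_nearest[OF n] by metis
  define q where "q = mk8 a' b' c' d'"
  have "(x - q * y) * z = x * z - of_int n * q" using z by (simp add: algebra_simps)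
  also have "\<dots> = mk8 (a - n * a') (b - n * b') (c - n * c') (d - n * d')"
    unfolding t q_def mk8_of_int mk8_mult mk8_diff by simp
  finally have "nrm8 (x - q * y) * nrm8 z < n ^ 4" using nrm8_lt[OF n q] by (metis nrm8_mult)
  moreover have "n * nrm8 z = n ^ 4" using z nrm8_mult[of y z] nrm8_of_int[of n] n_def by simp
  ultimately have "nrm8 (x - q * y) * nrm8 z < n * nrm8 z" by simp
  then have "nrm8 (x - q * y) < n" using nrm8_nonneg[of z] by (simp add: mult_less_cancel_right)
  then show ?thesis unfolding n_def by blast
qed

lemma bezout8_ideal: "\<exists>d x y. d = a * x + b * y \<and> d dvd a \<and> d dvd (b::zeta8)"
proof (induction "nat (nrm8 b)" arbitrary: a b rule: less_induct)
  case less
  show ?case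
  proof (cases "b = 0")
    case True
    then show ?thesis by (intro exI[of _ a] exI[of _ 1] exI[of _ 0]) auto
  next
    case False
    then obtain q where q: "nrm8 (a - q * b) < nrm8 b" using euclid8 by blast
    then have "nat (nrm8 (a - q * b)) < nat (nrm8 b)" using nrm8_nonneg[of "a - q * b"] by linarith
    from less[OF this, of b] obtain d x y where d: "d = b * x + (a - q * b) * y" "d dvd b" "d dvd a - q * b" by blast
    then have "d dvd (a - q * b) + q * b" by (intro dvd_add) auto
    moreover have "d = a * y + b * (x - q * y)" using d(1) by (simp add: algebra_simps)
    ultimately show ?thesis using d by (metis diff_add_cancel)
  qed
qed

lemma bezout8: "coprime a b \<longleftrightarrow> (\<exists>x y. a * x + b * y = (1::zeta8))"
proof
  assume "coprime a b"
  obtain d x y where d: "d = a * x + b * y" "d dvd a" "d dvd b" using bezout8_ideal by blast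
  then have "is_unit d" using \<open>coprime a b\<close> by (auto intro: coprime_common_divisor)
  then obtain u where "1 = d * u" by auto
  then have "a * (x * u) + b * (y * u) = 1" using d by (simp add: algebra_simps)
  then show "\<exists>x y. a * x + b * y = 1" by blast
next
  assume "\<exists>x y. a * x + b * y = 1"
  then show "coprime a b" by (metis coprimeI dvd_add dvd_mult2)
qed

lemma irreducible_imp_prime8:
  assumes "irreducible (p::zeta8)" shows "prime_elem p"
proof (rule prime_elemI)
  show "p \<noteq> 0" "\<not> is_unit p" using assms by (auto simp: irreducible_def)
  fix a b assume ab: "p dvd a * b"
  show "p dvd a \<or> p dvd b"
  proof (rule disjCI)
    assume "\<not> p dvd b"
    then have "coprime p b"
      using assms by (metis coprimeI dvd_trans irreducible_altdef)
    then obtain x y where "p * x + b * y = 1" unfolding bezout8 by blast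
    then have "a = p * (a * x) + (a * b) * y" by (metis distrib_left mult.assoc mult.commute mult_1)
    then show "p dvd a" using ab by (metis dvd_add dvd_triv_left dvd_mult2)
  qed
qed

text \<open>Irreducible elements are prime by Bezout; the norm decreases along proper factors.\<close>
lemma prime_factors8_exist:
  assumes "(x::zeta8) \<noteq> 0" shows "\<exists>A. (\<forall>p\<in>#A. prime_elem p) \<and> x dvd prod_mset A \<and> prod_mset A dvd x"
  using assms
proof (induction "nat (nrm8 x)" arbitrary: x rule: less_induct)
  case less
  show ?case
  proof (cases "is_unit x \<or> irreducible x")
    case True
    then show ?thesis
    proof
      assume "is_unit x" then show ?thesis by (intro exI[of _ "{#}"]) auto
    next
      assume "irreducible x" then show ?thesis by (intro exI[of _ "{#x#}"]) (auto intro: irreducible_imp_prime8)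
    qed
  next
    case False
    then obtain a b where ab: "x = a * b" "\<not> is_unit a" "\<not> is_unit b" using less.prems unfolding irreducible_def by blast
    have nz: "a \<noteq> 0" "b \<noteq> 0" using ab less.prems by auto
    have *: "nrm8 a \<ge> 2" "nrm8 b \<ge> 2" using nrm8_nonneg[of a] nrm8_nonneg[of b] nrm8_eq_0 ab nz is_unit_iff_nrm8
      by (smt (verit))+
    have "nrm8 x = nrm8 a * nrm8 b" using ab nrm8_mult by simp
    moreover have "nrm8 a * 1 < nrm8 a * nrm8 b" "1 * nrm8 b < nrm8 a * nrm8 b" using *
      by (intro mult_strict_left_mono mult_strict_right_mono; linarith)+
    ultimately have "nat (nrm8 a) < nat (nrm8 x)" "nat (nrm8 b) < nat (nrm8 x)" using * by auto
    with less.hyps nz obtain A B where "\<forall>p\<in>#A. prime_elem p" "a dvd prod_mset A" "prod_mset A dvd a"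
      "\<forall>p\<in>#B. prime_elem p" "b dvd prod_mset B" "prod_mset B dvd b" by metis
    then show ?thesis using ab by (intro exI[of _ "A + B"]) (auto intro: mult_dvd_mono)
  qed
qed

text \<open>The class hierarchy for unique factorisation asks for a canonical representative of each class of associates. An
arbitrary choice suffices, except that \<open>1\<close> must represent the units.\<close>
instantiation zeta8 :: normalization_semidom
begin

definition normalize_zeta8 :: "zeta8 \<Rightarrow> zeta8" where
  "normalize_zeta8 x = (if is_unit x then 1 else SOME y. x dvd y \<and> y dvd x)"

definition unit_factor_zeta8 :: "zeta8 \<Rightarrow> zeta8" where
  "unit_factor_zeta8 x = x div normalize x"

instance
proof
  have assoc: "x dvd normalize x \<and> normalize x dvd x" for x :: zeta8
  proof (cases "is_unit x")
    case False
    have "x dvd x \<and> x dvd x" by simp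
    then have "x dvd (SOME y. x dvd y \<and> y dvd x) \<and> (SOME y. x dvd y \<and> y dvd x) dvd x" by (rule someI)
    then show ?thesis using False by (simp add: normalize_zeta8_def)
  qed (simp add: normalize_zeta8_def)
  fix a b :: zeta8
  show norm0: "normalize (0 :: zeta8) = 0" using assoc[of 0] by simp
  show "unit_factor (0 :: zeta8) = 0" by (simp add: unit_factor_zeta8_def norm0)
  show mult: "unit_factor a * normalize a = a"
    using assoc[of a] by (simp add: unit_factor_zeta8_def)
  show "a dvd 1 \<Longrightarrow> unit_factor a = a"
    by (simp add: unit_factor_zeta8_def normalize_zeta8_def)
  show "is_unit (unit_factor a)" if "a \<noteq> 0"
  proof -
    obtain k where "normalize a = a * k" using assoc[of a] by (auto elim: dvdE)
    with mult have "a * (unit_factor a * k) = a * 1" by (simp add: algebra_simps)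
    then have "unit_factor a * k = 1" using that by (simp only: mult_cancel_left) simp
    then show ?thesis by (metis dvd_triv_left)
  qed
  show "unit_factor (a * b) = a * unit_factor b" if "a dvd 1"
  proof -
    have "(\<lambda>y. a * b dvd y \<and> y dvd a * b) = (\<lambda>y. b dvd y \<and> y dvd b)"
      using that by (simp add: fun_eq_iff mult_unit_dvd_iff' dvd_mult_unit_iff')
    moreover have "is_unit (a * b) \<longleftrightarrow> is_unit b" using that by (simp add: is_unit_mult_iff)
    ultimately have "normalize (a * b) = normalize b" by (simp add: normalize_zeta8_def)
    then show ?thesis using assoc[of b] by (simp add: unit_factor_zeta8_def div_mult_swap)
  qed
qed

end

instance zeta8 :: factorial_semiring
proof
  fix x :: zeta8 assume "x \<noteq> 0"
  then show "\<exists>A. (\<forall>x. x \<in># A \<longrightarrow> prime_elem x) \<and> normalize (prod_mset A) = normalize x"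
    using prime_factors8_exist[of x] by (metis associatedI)
qed

instantiation zeta8 :: factorial_ring_gcd
begin

definition gcd_zeta8 :: "zeta8 \<Rightarrow> zeta8 \<Rightarrow> zeta8" where "gcd_zeta8 = gcd_factorial"
definition lcm_zeta8 :: "zeta8 \<Rightarrow> zeta8 \<Rightarrow> zeta8" where "lcm_zeta8 = lcm_factorial"
definition Gcd_zeta8 :: "zeta8 set \<Rightarrow> zeta8" where "Gcd_zeta8 = Gcd_factorial"
definition Lcm_zeta8 :: "zeta8 set \<Rightarrow> zeta8" where "Lcm_zeta8 = Lcm_factorial"

instance by standard (simp_all add: gcd_zeta8_def lcm_zeta8_def Gcd_zeta8_def Lcm_zeta8_def)

end

section \<open>The additive character of fractions\<close>

text \<open>What the proof uses of \<open>e(a / c)\<close>. Nontriviality says that \<open>e\<close> is trivial on no fractional ideal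
larger than the ring, which gives the orthogonality relation \<open>ef_sum_prime\<close>.\<close>
locale fraction_character =
  fixes ef :: "zeta8 \<Rightarrow> zeta8 \<Rightarrow> complex"
  assumes ef_add: "ef (a + b) c = ef a c * ef b c"
    and ef_integral: "c \<noteq> 0 \<Longrightarrow> c dvd a \<Longrightarrow> ef a c = 1"
    and ef_cancel: "b \<noteq> 0 \<Longrightarrow> ef (a * b) (c * b) = ef a c"
    and ef_nontrivial: "c \<noteq> 0 \<Longrightarrow> \<not> is_unit c \<Longrightarrow> \<exists>u. ef u c \<noteq> 1"

lemma F8_cases:
  assumes "z \<in> F8"
  obtains a b c d where "z = lin8 omega8 (of_rat a) (of_rat b) (of_rat c) (of_rat d)"
  using F8_lin8[OF assms] by blast

lemma coord8_0_add: 
  assumes "z \<in> F8" "w \<in> F8" shows "coord8 (z + w) 0 = coord8 z 0 + coord8 w 0"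
proof -
  from assms obtain a b c d a' b' c' d' where 
    z: "z = lin8 omega8 (of_rat a) (of_rat b) (of_rat c) (of_rat d)" and
    w: "w = lin8 omega8 (of_rat a') (of_rat b') (of_rat c') (of_rat d')" by (metis F8_cases)
  have "z + w = lin8 omega8 (of_rat (a + a')) (of_rat (b + b')) (of_rat (c + c')) (of_rat (d + d'))"
    unfolding z w lin8_add of_rat_add ..
  from coord8_unique(1)[OF this] coord8_unique(1)[OF z] coord8_unique(1)[OF w] show ?thesis by simp
qed

lemma lin8_scale: "of_rat r * lin8 t (of_rat a) (of_rat b) (of_rat c) (of_rat d) = 
    lin8 t (of_rat (r * a)) (of_rat (r * b)) (of_rat (r * c)) (of_rat (r * d))"
  by (simp add: lin8_def of_rat_mult algebra_simps)

lemma coord8_0_scale: 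
  assumes "z \<in> F8" shows "coord8 (of_rat r * z) 0 = r * coord8 z 0"
proof -
  from assms obtain a b c d where z: "z = lin8 omega8 (of_rat a) (of_rat b) (of_rat c) (of_rat d)"
    by (metis F8_cases)
  show ?thesis using coord8_unique(1)[OF z] coord8_unique(1)[OF lin8_scale[of r omega8 a b c d]] z by simp
qed

lemma lin8_times_omega8: 
  "lin8 omega8 (of_rat a) (of_rat b) (of_rat c) (of_rat d) * omega8 = lin8 omega8 (of_rat (-d)) (of_rat a) (of_rat b) (of_rat c)"
proof -
  have "lin8 omega8 (of_rat a) (of_rat b) (of_rat c) (of_rat d) * omega8 = 
    lin8 omega8 (of_rat (-d)) (of_rat a) (of_rat b) (of_rat c) + of_rat d * (omega8 ^ 4 + 1)"
    unfolding lin8_def of_rat_minus by algebra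
  then show ?thesis by (simp add: omega8_4)
qed

lemma coord8_times_omega8_power:
  assumes z: "z = lin8 omega8 (of_rat a) (of_rat b) (of_rat c) (of_rat d)"
  shows "z * omega8 = lin8 omega8 (of_rat (-d)) (of_rat a) (of_rat b) (of_rat c)"
    "z * omega8 ^ 2 = lin8 omega8 (of_rat (-c)) (of_rat (-d)) (of_rat a) (of_rat b)"
    "z * omega8 ^ 3 = lin8 omega8 (of_rat (-b)) (of_rat (-c)) (of_rat (-d)) (of_rat a)"
proof -
  show 1: "z * omega8 = lin8 omega8 (of_rat (-d)) (of_rat a) (of_rat b) (of_rat c)"
    unfolding z by (rule lin8_times_omega8)
  have "z * omega8 ^ 2 = (z * omega8) * omega8" by (simp add: power2_eq_square)
  then show 2: "z * omega8 ^ 2 = lin8 omega8 (of_rat (-c)) (of_rat (-d)) (of_rat a) (of_rat b)"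
    unfolding 1 lin8_times_omega8 .
  have "z * omega8 ^ 3 = (z * omega8 ^ 2) * omega8" by (simp add: power3_eq_cube power2_eq_square)
  then show 3: "z * omega8 ^ 3 = lin8 omega8 (of_rat (-b)) (of_rat (-c)) (of_rat (-d)) (of_rat a)"
    unfolding 2 lin8_times_omega8 .
qed

text \<open>Multiplication by \<open>omega8\<close> only shifts the coordinates cyclically, up to sign, so every diagonal entry equals the
constant coordinate.\<close>
lemma trace8_eq: 
  assumes "z \<in> F8" shows "trace8 z = 4 * coord8 z 0"
proof -
  obtain a b c d where z: "z = lin8 omega8 (of_rat a) (of_rat b) (of_rat c) (of_rat d)"
    using F8_cases[OF assms] .
  note zz = coord8_times_omega8_power[OF z]
  have "trace8 z = coord8 z 0 + coord8 (z * omega8) 1 + coord8 (z * omega8 ^ 2) 2 + coord8 (z * omega8 ^ 3) 3"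
    unfolding trace8_def by (simp add: eval_nat_numeral)
  also have "\<dots> = 4 * a"
    using coord8_unique(1)[OF z] coord8_unique(2)[OF zz(1)] coord8_unique(3)[OF zz(2)] coord8_unique(4)[OF zz(3)] by simp
  finally show ?thesis using coord8_unique(1)[OF z] by simp
qed

lemma O8_iff: "z \<in> O8 \<longleftrightarrow> (\<exists>x. z = to_complex x)"
  using to_complex Abs_zeta8_inverse by metis

lemma coord8_0_O8: "z \<in> O8 \<Longrightarrow> coord8 z 0 \<in> \<int>"
proof -
  assume "z \<in> O8"
  then obtain a b c d where z: "z = to_complex (mk8 a b c d)" by (metis O8_iff mk8_exists)
  have "z = lin8 omega8 (of_rat (of_int a)) (of_rat (of_int b)) (of_rat (of_int c)) (of_rat (of_int d))"
    unfolding z to_complex_mk8 by simp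
  from coord8_unique(1)[OF this] show ?thesis by simp
qed

lemma F8_of_rat: "of_rat r \<in> F8"
  using F8_lin8I[of r 0 0 0] by (simp add: lin8_def)

text \<open>The traces of \<open>x omega8\<^sup>n\<close> for \<open>n < 4\<close> are, up to sign, four times the coordinates of \<open>x\<close>.\<close>
lemma codifferent8_iff: "x \<in> codifferent8 \<longleftrightarrow> x \<in> F8 \<and> 4 * x \<in> O8"
proof safe
  assume x: "x \<in> codifferent8"
  then show "x \<in> F8" by (simp add: codifferent8_def)
  then obtain a b c d where z: "x = lin8 omega8 (of_rat a) (of_rat b) (of_rat c) (of_rat d)"
    by (metis F8_cases)
  note zz = coord8_times_omega8_power[OF z]
  have w: "omega8 ^ n \<in> O8" for n
    unfolding O8_iff by (rule exI[of _ "w8 ^ n"]) (simp add: w8.rep_eq)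
  have tr: "4 * coord8 (x * omega8 ^ n) 0 \<in> \<int>" for n
  proof -
    have "x * omega8 ^ n \<in> F8" using \<open>x \<in> F8\<close> w O8_subset_F8 by (intro F8_mult) auto
    then show ?thesis using x w[of n] trace8_eq unfolding codifferent8_def by fastforce
  qed
  have "4 * a \<in> \<int>" using tr[of 0] coord8_unique(1)[OF z] by simp
  then obtain a' where a: "4 * a = of_int a'" by (auto elim: Ints_cases)
  have "4 * d \<in> \<int>" using tr[of 1] coord8_unique(1)[OF zz(1)] by simp
  then obtain d' where d: "4 * d = of_int d'" by (auto elim: Ints_cases)
  have "4 * c \<in> \<int>" using tr[of 2] coord8_unique(1)[OF zz(2)] by simp
  then obtain c' where c: "4 * c = of_int c'" by (auto elim: Ints_cases)
  have "4 * b \<in> \<int>" using tr[of 3] coord8_unique(1)[OF zz(3)] by simp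
  then obtain b' where b: "4 * b = of_int b'" by (auto elim: Ints_cases)
  have "4 * x = to_complex (mk8 a' b' c' d')"
    using lin8_scale[of 4 omega8 a b c d] unfolding to_complex_mk8 z a b c d by simp
  then show "4 * x \<in> O8" using O8_iff by blast
next
  assume x: "x \<in> F8" "4 * x \<in> O8"
  show "x \<in> codifferent8"
    unfolding codifferent8_def
  proof safe
    fix y assume y: "y \<in> O8"
    then have F: "x * y \<in> F8" using x O8_subset_F8 by (intro F8_mult) auto
    have "4 * x * y \<in> O8" using O8_mult[OF x(2) y] .
    then have "coord8 (of_rat 4 * (x * y)) 0 \<in> \<int>" using coord8_0_O8 by (simp add: mult.assoc)
    then show "trace8 (x * y) \<in> \<int>" unfolding trace8_eq[OF F] coord8_0_scale[OF F] .
  qed (rule x)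
qed

lemma different8_iff: "y \<in> different8 \<longleftrightarrow> (\<exists>v. y = 4 * to_complex v)"
proof
  assume "y \<in> different8"
  moreover have "1/4 \<in> codifferent8"
    unfolding codifferent8_iff using F8_of_rat[of "1/4"] O8_1 by (simp add: of_rat_divide)
  ultimately have "1/4 * y \<in> O8" unfolding different8_def by auto
  then obtain v where "1/4 * y = to_complex v" unfolding O8_iff ..
  then have "y = 4 * to_complex v" by (simp add: field_simps)
  then show "\<exists>v. y = 4 * to_complex v" ..
next
  assume "\<exists>v. y = 4 * to_complex v"
  then obtain v where y: "y = 4 * to_complex v" ..
  have "y \<in> F8" unfolding y using F8_of_rat[of 4] to_complex_in_F8 by (intro F8_mult) simp_all
  moreover have "x * y \<in> O8" if "x \<in> codifferent8" for x
  proof -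
    have "4 * x * to_complex v \<in> O8" using that to_complex[of v] O8_mult unfolding codifferent8_iff by blast
    then show ?thesis unfolding y by (simp add: mult_ac)
  qed
  ultimately show "y \<in> different8" unfolding different8_def by blast
qed

text \<open>The different is generated by \<open>4\<close>, so \<open>\<delta>\<close> divides \<open>4\<close>.\<close>
lemma generates_different_cofactor:
  assumes "generates_different \<delta>" shows "\<exists>v. 4 = \<delta> * to_complex v"
proof -
  have "4 \<in> different8" unfolding different8_iff by (rule exI[of _ 1]) simp
  then have "4 \<in> (\<lambda>y. \<delta> * y) ` O8" using assms unfolding generates_different_def by blast
  then obtain y where "y \<in> O8" "4 = \<delta> * y" by blast
  then show ?thesis unfolding O8_iff by blast
qed

lemma F8_fraction: "to_complex a / to_complex c \<in> F8"
proof (cases "c = 0")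
  case True
  then show ?thesis using F8_of_rat[of 0] by simp
next
  case False
  obtain k where k: "of_int (nrm8 c) = c * k" using dvd_nrm8[of c] by auto
  have n0: "nrm8 c \<noteq> 0" using False by (simp add: nrm8_eq_0)
  have "complex_of_int (nrm8 c) = to_complex c * to_complex k"
    using arg_cong[OF k, of to_complex] by simp
  moreover have "to_complex k \<noteq> 0"
  proof
    assume "to_complex k = 0"
    then show False using k n0 by simp
  qed
  ultimately have "to_complex a / to_complex c = to_complex (a * k) * of_rat (1 / of_int (nrm8 c))"
    by (simp add: of_rat_divide)
  then show ?thesis using F8_of_rat to_complex_in_F8 F8_mult by metis
qed

lemma exp_rat_eq_1: "exp (2 * of_real pi * \<i> * of_rat r) = 1 \<longleftrightarrow> r \<in> \<int>"
proof -
  have R: "of_rat r = complex_of_real (of_rat r)"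
    by (cases r) (simp add: of_rat_rat)
  have e: "exp (2 * of_real pi * \<i> * of_rat r) = cis (2 * pi * of_rat r)"
    unfolding cis_conv_exp R by (simp add: mult_ac)
  show ?thesis
  proof
    assume "exp (2 * of_real pi * \<i> * of_rat r) = 1"
    then have "cos (2 * pi * of_rat r) = 1" unfolding e by (simp add: complex_eq_iff)
    then obtain n :: int where "2 * pi * of_rat r = of_int n * 2 * pi" unfolding cos_one_2pi_int by blast
    then have "(of_rat r :: real) = of_rat (of_int n)" by simp
    then show "r \<in> \<int>" by (simp only: of_rat_eq_iff) auto
  next
    assume "r \<in> \<int>"
    then obtain n where "r = of_int n" by (auto elim: Ints_cases)
    then show "exp (2 * of_real pi * \<i> * of_rat r) = 1" unfolding e
      using cis_multiple_2pi[of "of_int n"] by simp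
  qed
qed

text \<open>Triviality on the ring holds because \<open>1/\<delta>\<close> is an integral multiple of \<open>1/4\<close>. If the character were trivial on the
multiples of \<open>1/c\<close>, then \<open>1/(c\<delta>)\<close> would lie in the codifferent, and multiplying by \<open>\<delta>\<close> in the different
would make \<open>1/c\<close> integral.\<close>
lemma fraction_character_efrac:
  assumes "generates_different \<delta>" shows "fraction_character (efrac \<delta>)"
proof -
  obtain v where v: "4 = \<delta> * to_complex v" using generates_different_cofactor[OF assms] ..
  then have "\<delta> \<noteq> 0" by auto
  have dinv: "1 / \<delta> = of_rat (1/4) * to_complex v"
    using v \<open>\<delta> \<noteq> 0\<close> by (simp add: of_rat_divide field_simps)
  have inF: "to_complex a / to_complex c / \<delta> \<in> F8" for a c
    using F8_mult[OF F8_fraction F8_mult[OF F8_of_rat to_complex_in_F8], of a c "1/4" v] by (simp flip: dinv)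
  have eq1: "efrac \<delta> a c = 1 \<longleftrightarrow> trace8 (to_complex a / to_complex c / \<delta>) \<in> \<int>" for a c
    unfolding efrac_def e8_def exp_rat_eq_1 ..
  have "\<delta> \<in> different8"
    using assms O8_1 unfolding generates_different_def by force
  show ?thesis
  proof
    fix a b c :: zeta8
    have "trace8 (to_complex (a + b) / to_complex c / \<delta>) = trace8 (to_complex a / to_complex c / \<delta>) + trace8 (to_complex b / to_complex c / \<delta>)"
      using coord8_0_add[OF inF inF, of a c b c] inF[of a c] inF[of b c] inF[of "a + b" c]
      by (simp add: trace8_eq add_divide_distrib)
    then show "efrac \<delta> (a + b) c = efrac \<delta> a c * efrac \<delta> b c"
      unfolding efrac_def e8_def by (simp add: of_rat_add algebra_simps exp_add)
    show "efrac \<delta> a c = 1" if "c \<noteq> 0" "c dvd a"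
    proof -
      from that obtain k where k: "a = c * k" by auto
      have "4 * coord8 (of_rat (1/4) * to_complex (k * v)) 0 = coord8 (to_complex (k * v)) 0"
        unfolding coord8_0_scale[OF to_complex_in_F8] by simp
      moreover have "to_complex a / to_complex c / \<delta> = of_rat (1/4) * to_complex (k * v)"
      proof -
        have "to_complex a / to_complex c / \<delta> = to_complex k * (1 / \<delta>)" using that unfolding k by simp
        then show ?thesis unfolding dinv by (simp add: mult_ac)
      qed
      ultimately have "trace8 (to_complex a / to_complex c / \<delta>) = coord8 (to_complex (k * v)) 0"
        using trace8_eq[OF inF] by metis
      then show ?thesis unfolding eq1 by (simp only: coord8_0_O8[OF to_complex])
    qed
    show "efrac \<delta> (a * b) (c * b) = efrac \<delta> a c" if "b \<noteq> 0"
      unfolding efrac_def using that by simp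
    show "\<exists>u. efrac \<delta> u c \<noteq> 1" if c: "c \<noteq> 0" "\<not> is_unit c"
    proof (rule ccontr)
      assume "\<not> (\<exists>u. efrac \<delta> u c \<noteq> 1)"
      then have "trace8 (to_complex u / to_complex c / \<delta>) \<in> \<int>" for u unfolding eq1 by blast
      moreover have "to_complex 1 / to_complex c / \<delta> \<in> F8" by (rule inF)
      ultimately have "to_complex 1 / to_complex c / \<delta> \<in> codifferent8"
        unfolding codifferent8_def by (auto simp: O8_iff)
      with \<open>\<delta> \<in> different8\<close> have "to_complex 1 / to_complex c / \<delta> * \<delta> \<in> O8" unfolding different8_def by blast
      then obtain k where "1 / to_complex c = to_complex k" using \<open>\<delta> \<noteq> 0\<close> by (auto simp: O8_iff)
      then have "to_complex (c * k) = to_complex 1" using c by (simp add: field_simps)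
      then have "c * k = 1" by (simp only: to_complex_inject_iff)
      then show False using c by (metis dvd_triv_left)
    qed
  qed
qed

section \<open>Residue systems and sums over them\<close>
lemma cong8_refl [simp]: "cong8 c x x" by (simp add: cong8_def)
lemma cong8_sym: "cong8 c x y \<Longrightarrow> cong8 c y x"
  unfolding cong8_def by (metis dvd_minus_iff minus_diff_eq)
lemma cong8_trans [trans]: "cong8 c x y \<Longrightarrow> cong8 c y z \<Longrightarrow> cong8 c x z"
  unfolding cong8_def using dvd_add[of c "x - y" "y - z"] by simp
lemma cong8I: "x - y = z \<Longrightarrow> c dvd z \<Longrightarrow> cong8 c x y" by (simp add: cong8_def)
lemma cong8_add: "cong8 c x y \<Longrightarrow> cong8 c x' y' \<Longrightarrow> cong8 c (x + x') (y + y')"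
  unfolding cong8_def using dvd_add[of c "x - y" "x' - y'"] by (simp add: algebra_simps)
lemma cong8_minus: "cong8 c x y \<Longrightarrow> cong8 c (- x) (- y)"
  unfolding cong8_def by (metis dvd_minus_iff minus_diff_minus)
lemma cong8_diff: "cong8 c x y \<Longrightarrow> cong8 c x' y' \<Longrightarrow> cong8 c (x - x') (y - y')"
  using cong8_add[of c x y "- x'" "- y'"] cong8_minus[of c x' y'] by simp
lemma cong8_mult: "cong8 c x y \<Longrightarrow> cong8 c x' y' \<Longrightarrow> cong8 c (x * x') (y * y')"
proof -
  assume "cong8 c x y" "cong8 c x' y'"
  then have "c dvd (x - y) * x' + y * (x' - y')" unfolding cong8_def by (intro dvd_add dvd_mult dvd_mult2)
  then show ?thesis unfolding cong8_def by (simp add: algebra_simps)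
qed
lemma cong8_power: "cong8 c x y \<Longrightarrow> cong8 c (x ^ n) (y ^ n)"
  by (induction n) (auto intro: cong8_mult)
lemma cong8_dvd_mod: "cong8 c x y \<Longrightarrow> d dvd c \<Longrightarrow> cong8 d x y"
  unfolding cong8_def by (rule dvd_trans)
lemma cong8_dvd_iff: "cong8 c x y \<Longrightarrow> d dvd c \<Longrightarrow> d dvd x \<longleftrightarrow> d dvd y"
  unfolding cong8_def by (metis dvd_trans dvd_diff_right_iff dvd_diff_left_iff diff_add_cancel dvd_add_left_iff dvd_add_right_iff)
lemma cong8_coprime: assumes "cong8 c x y" "coprime x c" shows "coprime y c"
proof (rule coprimeI)
  fix d assume "d dvd y" "d dvd c"
  then have "d dvd x" using cong8_dvd_iff[OF assms(1)] by blast
  then show "is_unit d" using assms(2) \<open>d dvd c\<close> coprime_common_divisor by blast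
qed
lemma cong8_cancel:
  assumes "cong8 c (k * x) (k * y)" "coprime k c" shows "cong8 c x y"
proof -
  have "c dvd k * (x - y)" using assms(1) by (simp add: cong8_def right_diff_distrib)
  then show ?thesis using assms(2) unfolding cong8_def by (metis coprime_commute coprime_dvd_mult_right_iff)
qed
lemma cong8_mult_left_iff: "coprime k c \<Longrightarrow> cong8 c (k * x) (k * y) \<longleftrightarrow> cong8 c x y"
  using cong8_cancel cong8_mult[of c k k x y] by auto

lemma inv_mod: 
  assumes "coprime y c" shows "cong8 c (y * inv_mod c y) 1"
proof -
  obtain a b where "y * a + c * b = 1" using assms unfolding bezout8 by blast
  then have "1 - y * a = c * b" by (simp add: algebra_simps)
  then have "cong8 c 1 (y * a)" unfolding cong8_def by simp
  then have "\<exists>z. cong8 c (y * z) 1" using cong8_sym by blast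
  then show ?thesis unfolding inv_mod_def by (rule someI_ex)
qed

lemma coprime_of_cong8_1: "cong8 c (y * z) 1 \<Longrightarrow> coprime y c"
  using cong8_coprime[of c 1 "y * z"] cong8_sym by auto

lemma inv_mod_coprime: "coprime y c \<Longrightarrow> coprime (inv_mod c y) c"
  using coprime_of_cong8_1[of c "inv_mod c y" y] inv_mod[of y c] by (simp add: mult.commute)

lemma inv_mod_unique:
  assumes "cong8 c (y * z) 1" shows "cong8 c (inv_mod c y) z"
proof -
  have "coprime y c" by (rule coprime_of_cong8_1[OF assms])
  then show ?thesis using cong8_trans[OF inv_mod cong8_sym[OF assms]] cong8_cancel by blast
qed

lemma inv_mod_cong:
  assumes "cong8 c x y" "coprime x c" shows "cong8 c (inv_mod c x) (inv_mod c y)"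
proof (rule inv_mod_unique)
  have "cong8 c (x * inv_mod c y) (y * inv_mod c y)" using assms by (intro cong8_mult) auto
  also have "cong8 c \<dots> 1" using assms cong8_coprime inv_mod by blast
  finally show "cong8 c (x * inv_mod c y) 1" .
qed

text \<open>A transversal of the residue classes allows sums over classes to be handled as sums over a finite set of ring
elements. The representative is the one at which the sums over classes evaluate their summand.\<close>
definition rep8 :: "zeta8 \<Rightarrow> zeta8 \<Rightarrow> zeta8" where
  "rep8 c x = (SOME y. cong8 c x y)"

definition reps8 :: "zeta8 \<Rightarrow> zeta8 set" where
  "reps8 c = range (rep8 c)"

lemma cong8_rep8: "cong8 c x (rep8 c x)"
  unfolding rep8_def by (rule someI[of _ x]) simp

lemma rep8_eq_iff: "rep8 c x = rep8 c y \<longleftrightarrow> cong8 c x y"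
proof
  assume "rep8 c x = rep8 c y"
  then show "cong8 c x y" using cong8_rep8 cong8_sym cong8_trans by metis
next
  assume "cong8 c x y"
  then have "cong8 c x = cong8 c y" using cong8_sym cong8_trans by blast
  then show "rep8 c x = rep8 c y" by (simp add: rep8_def)
qed

lemma rep8_in: "rep8 c x \<in> reps8 c" by (simp add: reps8_def)

lemma rep8_id: "x \<in> reps8 c \<Longrightarrow> rep8 c x = x"
  unfolding reps8_def using cong8_rep8 cong8_sym rep8_eq_iff by fastforce

lemma rep8_eq_rep_iff: "y \<in> reps8 c \<Longrightarrow> rep8 c x = y \<longleftrightarrow> cong8 c x y"
  using rep8_id[of y c] rep8_eq_iff[of c x y] by simp

lemma reps8_eqI: "x \<in> reps8 c \<Longrightarrow> y \<in> reps8 c \<Longrightarrow> cong8 c x y \<Longrightarrow> x = y"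
  using rep8_id rep8_eq_iff by metis

text \<open>Every class modulo \<open>c\<close> meets the box of coordinates modulo the norm of \<open>c\<close>, as \<open>c\<close> divides its norm.\<close>
lemma finite_reps8: assumes "c \<noteq> 0" shows "finite (reps8 c)"
proof -
  define n where "n = nrm8 c"
  have n: "n > 0" using nrm8_nonneg[of c] nrm8_eq_0[of c] assms unfolding n_def by linarith
  define B where "B = (\<lambda>(a, b, e, f). mk8 a b e f) ` ({0..<n} \<times> {0..<n} \<times> {0..<n} \<times> {0..<n})"
  have "reps8 c \<subseteq> rep8 c ` B"
  proof
    fix r assume "r \<in> reps8 c"
    obtain a b e f where r: "r = mk8 a b e f" using mk8_exists by metis
    let ?s = "mk8 (a mod n) (b mod n) (e mod n) (f mod n)"
    have "r - ?s = of_int n * mk8 (a div n) (b div n) (e div n) (f div n)"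
      unfolding r mk8_diff mk8_of_int mk8_mult mk8_inject by (simp add: minus_mod_eq_mult_div)
    then have "c dvd r - ?s" using dvd_nrm8[of c] unfolding n_def by (metis dvd_mult2)
    then have "rep8 c ?s = r" using rep8_id[OF \<open>r \<in> reps8 c\<close>] rep8_eq_iff unfolding cong8_def by metis
    moreover have "?s \<in> B"
      unfolding B_def by (rule image_eqI[of _ _ "(a mod n, b mod n, e mod n, f mod n)"]) (use n in auto)
    ultimately show "r \<in> rep8 c ` B" by force
  qed
  moreover have "finite B" unfolding B_def by (intro finite_imageI finite_cartesian_product) auto
  ultimately show ?thesis by (meson finite_imageI finite_subset)
qed

lemma residue_classes_eq: "residue_classes c = (\<lambda>r. {y. cong8 c r y}) ` reps8 c"
proof -
  have "{(x, y). cong8 c x y} `` {x} = {y. cong8 c (rep8 c x) y}" for x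
    using cong8_rep8[of c x] by (auto dest: cong8_trans cong8_sym)
  then show ?thesis unfolding residue_classes_def quotient_def reps8_def by auto
qed

lemma class_inj: "inj_on (\<lambda>r. {y. cong8 c r y}) (reps8 c)"
  by (rule inj_onI) (metis (mono_tags, lifting) cong8_refl mem_Collect_eq reps8_eqI cong8_sym)

lemma some_class: "r \<in> reps8 c \<Longrightarrow> (SOME x. x \<in> {y. cong8 c r y}) = r"
  using rep8_id[of r c] by (simp add: rep8_def)

lemma sum_mod_eq: "sum_mod c f = (\<Sum>r\<in>reps8 c. f r)"
  unfolding sum_mod_def residue_classes_eq sum.reindex[OF class_inj]
  by (intro sum.cong) (auto simp: some_class simp del: mem_Collect_eq)

lemma absnorm8_eq: "absnorm8 c = card (reps8 c)"
  unfolding absnorm8_def residue_classes_eq by (rule card_image[OF class_inj])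

lemma invertible_classes_eq: "invertible_classes c = (\<lambda>r. {y. cong8 c r y}) ` {r \<in> reps8 c. coprime r c}"
proof -
  have "(\<exists>x\<in>{y. cong8 c r y}. \<exists>y. cong8 c (x * y) 1) \<longleftrightarrow> coprime r c" for r
  proof
    assume "\<exists>x\<in>{y. cong8 c r y}. \<exists>y. cong8 c (x * y) 1"
    then show "coprime r c" using coprime_of_cong8_1 cong8_coprime cong8_sym by blast
  next
    assume "coprime r c"
    then show "\<exists>x\<in>{y. cong8 c r y}. \<exists>y. cong8 c (x * y) 1" using inv_mod[of r c] cong8_refl by blast
  qed
  then show ?thesis unfolding invertible_classes_def residue_classes_eq by auto
qed

lemma sum_mod_inv_eq: "sum_mod_inv c f = (\<Sum>r | r \<in> reps8 c \<and> coprime r c. f r)"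
proof -
  have "inj_on (\<lambda>r. {y. cong8 c r y}) {r \<in> reps8 c. coprime r c}"
    by (rule inj_on_subset[OF class_inj]) auto
  then show ?thesis
    unfolding sum_mod_inv_def invertible_classes_eq
    by (subst sum.reindex) (auto simp: some_class simp del: mem_Collect_eq intro!: sum.cong)
qed

text \<open>The change of variables \<open>y = g(x)\<close> between residue classes modulo \<open>c\<close> and \<open>d\<close>, restricted to classes
satisfying \<open>P\<close> and \<open>Q\<close>. Most substitutions below are instances.\<close>
lemma bij_betw_reps8:
  assumes P: "\<And>x y. P x \<Longrightarrow> cong8 c x y \<Longrightarrow> P y" and Q: "\<And>x y. Q x \<Longrightarrow> cong8 d x y \<Longrightarrow> Q y"
    and g: "\<And>x. P x \<Longrightarrow> Q (g x)"
    and g_cong: "\<And>x y. P x \<Longrightarrow> P y \<Longrightarrow> cong8 d (g x) (g y) \<longleftrightarrow> cong8 c x y"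
    and surj: "\<And>y. Q y \<Longrightarrow> \<exists>x. P x \<and> cong8 d (g x) y"
  shows "bij_betw (\<lambda>x. rep8 d (g x)) {x \<in> reps8 c. P x} {y \<in> reps8 d. Q y}"
proof (rule bij_betw_imageI)
  show "inj_on (\<lambda>x. rep8 d (g x)) {x \<in> reps8 c. P x}"
    by (rule inj_onI) (auto simp: rep8_eq_iff g_cong intro: reps8_eqI)
  show "(\<lambda>x. rep8 d (g x)) ` {x \<in> reps8 c. P x} = {y \<in> reps8 d. Q y}"
  proof (intro subset_antisym subsetI)
    fix y assume "y \<in> (\<lambda>x. rep8 d (g x)) ` {x \<in> reps8 c. P x}"
    then show "y \<in> {y \<in> reps8 d. Q y}" using g Q cong8_rep8 rep8_in by blast
  next
    fix y assume y: "y \<in> {y \<in> reps8 d. Q y}"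
    then obtain x where x: "P x" "cong8 d (g x) y" using surj by blast
    have r: "P (rep8 c x)" using P[OF x(1) cong8_rep8] .
    have "cong8 d (g (rep8 c x)) (g x)" using g_cong[OF r x(1)] cong8_sym[OF cong8_rep8] by blast
    then have "cong8 d (g (rep8 c x)) y" using x(2) by (rule cong8_trans)
    then have "rep8 d (g (rep8 c x)) = y" using rep8_id[of y d] y rep8_eq_iff[of d "g (rep8 c x)" y] by simp
    then show "y \<in> (\<lambda>x. rep8 d (g x)) ` {x \<in> reps8 c. P x}" using r rep8_in by blast
  qed
qed

lemma sum_reps8_reindex:
  assumes "\<And>x y. P x \<Longrightarrow> cong8 c x y \<Longrightarrow> P y" and "\<And>x y. Q x \<Longrightarrow> cong8 d x y \<Longrightarrow> Q y"
    and "\<And>x. P x \<Longrightarrow> Q (g x)"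
    and "\<And>x y. P x \<Longrightarrow> P y \<Longrightarrow> cong8 d (g x) (g y) \<longleftrightarrow> cong8 c x y"
    and "\<And>y. Q y \<Longrightarrow> \<exists>x. P x \<and> cong8 d (g x) y"
    and f: "\<And>x y. Q x \<Longrightarrow> cong8 d x y \<Longrightarrow> f x = f y"
  shows "(\<Sum>y | y \<in> reps8 d \<and> Q y. f y) = (\<Sum>x | x \<in> reps8 c \<and> P x. f (g x))"
proof -
  have "(\<Sum>y | y \<in> reps8 d \<and> Q y. f y) = (\<Sum>x | x \<in> reps8 c \<and> P x. f (rep8 d (g x)))"
    using sum.reindex_bij_betw[OF bij_betw_reps8[where P=P and c=c and Q=Q and d=d and g=g, OF assms(1-5)], where g=f] by simp
  also have "\<dots> = (\<Sum>x | x \<in> reps8 c \<and> P x. f (g x))"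
    using assms(3) f[OF _ cong8_rep8] by (intro sum.cong) auto
  finally show ?thesis .
qed

lemma sum_reps8_reindex_all:
  assumes "\<And>x y. cong8 d (g x) (g y) \<longleftrightarrow> cong8 c x y" and "\<And>y. \<exists>x. cong8 d (g x) y"
    and "\<And>x y. cong8 d x y \<Longrightarrow> f x = f y"
  shows "(\<Sum>y\<in>reps8 d. f y) = (\<Sum>x\<in>reps8 c. f (g x))"
  using sum_reps8_reindex[where P="\<lambda>_. True" and c=c and Q="\<lambda>_. True" and d=d and g=g and f=f] assms by simp

lemma sum_reps8_shift:
  assumes "\<And>x y. cong8 c x y \<Longrightarrow> f x = f y"
  shows "(\<Sum>x\<in>reps8 c. f (x + t)) = (\<Sum>x\<in>reps8 c. f x)"
proof (rule sum_reps8_reindex_all[symmetric])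
  show "\<exists>x. cong8 c (x + t) y" for y by (rule exI[of _ "y - t"]) simp
qed (simp add: cong8_def, rule assms)

lemma sum_reps8_affine:
  assumes "coprime k c" "\<And>x y. cong8 c x y \<Longrightarrow> f x = f y"
  shows "(\<Sum>x\<in>reps8 c. f (k * x + t)) = (\<Sum>x\<in>reps8 c. f x)"
proof (rule sum_reps8_reindex_all[symmetric])
  show "cong8 c (k * x + t) (k * y + t) \<longleftrightarrow> cong8 c x y" for x y
    using cong8_mult_left_iff[OF assms(1), of x y] by (simp add: cong8_def)
  show "\<exists>x. cong8 c (k * x + t) y" for y
  proof
    have "cong8 c ((k * inv_mod c k) * (y - t) + t) (1 * (y - t) + t)"
      by (intro cong8_add cong8_mult inv_mod assms) auto
    then show "cong8 c (k * (inv_mod c k * (y - t)) + t) y" by (simp add: mult.assoc)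
  qed
qed (rule assms)

lemma coprime_cong8_cong: "cong8 c x y \<Longrightarrow> coprime x c \<longleftrightarrow> coprime y c"
  using cong8_coprime cong8_sym by blast

lemma sum_reps8_inverse:
  assumes "\<And>x y. coprime x c \<Longrightarrow> cong8 c x y \<Longrightarrow> f x = f y"
  shows "(\<Sum>x | x \<in> reps8 c \<and> coprime x c. f (inv_mod c x)) = (\<Sum>x | x \<in> reps8 c \<and> coprime x c. f x)"
proof (rule sum_reps8_reindex[symmetric, where Q="\<lambda>x. coprime x c"])
  have ii: "cong8 c (inv_mod c (inv_mod c x)) x" if "coprime x c" for x
    using inv_mod_unique[of c "inv_mod c x" x] inv_mod[OF that] by (simp add: mult.commute)
  show "cong8 c (inv_mod c x) (inv_mod c y) \<longleftrightarrow> cong8 c x y" if "coprime x c" "coprime y c" for x y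
    using that ii inv_mod_cong inv_mod_coprime by (meson cong8_sym cong8_trans)
  show "\<exists>x. coprime x c \<and> cong8 c (inv_mod c x) y" if "coprime y c" for y
    using ii[OF that] inv_mod_coprime[OF that] by blast
qed (auto intro: cong8_coprime inv_mod_coprime assms)

text \<open>The Chinese remainder theorem, for summands that split into a part periodic modulo \<open>n\<close> and one periodic modulo \<open>m\<close>.\<close>
lemma sum_reps8_mult:
  fixes G H :: "zeta8 \<Rightarrow> 'a::comm_semiring_0"
  assumes "coprime n m" "\<And>x y. cong8 n x y \<Longrightarrow> G x = G y" "\<And>x y. cong8 m x y \<Longrightarrow> H x = H y"
  shows "(\<Sum>x\<in>reps8 (n * m). G x * H x) = (\<Sum>x\<in>reps8 n. G x) * (\<Sum>x\<in>reps8 m. H x)"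
proof -
  have "bij_betw (\<lambda>x. (rep8 n x, rep8 m x)) (reps8 (n * m)) (reps8 n \<times> reps8 m)"
  proof (rule bij_betw_imageI)
    show "inj_on (\<lambda>x. (rep8 n x, rep8 m x)) (reps8 (n * m))"
      using assms(1) divides_mult by (auto intro!: inj_onI reps8_eqI simp: rep8_eq_iff cong8_def)
    show "(\<lambda>x. (rep8 n x, rep8 m x)) ` reps8 (n * m) = reps8 n \<times> reps8 m"
    proof (intro subset_antisym subsetI)
      fix z assume "z \<in> reps8 n \<times> reps8 m"
      then obtain x y where z: "z = (x, y)" "x \<in> reps8 n" "y \<in> reps8 m" by auto
      obtain a b where ab: "n * a + m * b = 1" using assms(1) unfolding bezout8 by blast
      define w where "w = rep8 (n * m) (x * (m * b) + y * (n * a))"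
      have w: "cong8 (n * m) w (x * (m * b) + y * (n * a))" unfolding w_def by (rule cong8_sym[OF cong8_rep8])
      have e: "(x * (m * b) + y * (n * a)) - x = n * (a * (y - x))" "(x * (m * b) + y * (n * a)) - y = m * (b * (x - y))"
        using ab by algebra+
      have "cong8 n w x" "cong8 m w y"
        using cong8_dvd_mod[OF w, of n] cong8_dvd_mod[OF w, of m] e
        by (metis cong8_def cong8_trans dvd_triv_left dvd_triv_right)+
      then have "z = (rep8 n w, rep8 m w)" using z rep8_id rep8_eq_iff by metis
      then show "z \<in> (\<lambda>x. (rep8 n x, rep8 m x)) ` reps8 (n * m)" using rep8_in w_def by blast
    qed (auto simp: rep8_in)
  qed
  from sum.reindex_bij_betw[OF this, of "\<lambda>(x, y). G x * H y"]
  have "(\<Sum>x\<in>reps8 (n * m). G (rep8 n x) * H (rep8 m x)) = (\<Sum>(x, y)\<in>reps8 n \<times> reps8 m. G x * H y)" by simp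
  moreover have "G (rep8 n x) = G x" "H (rep8 m x) = H x" for x using assms cong8_rep8 by metis+
  ultimately show ?thesis by (simp add: sum_product sum.cartesian_product)
qed

context fraction_character
begin

lemma ef_cong: assumes "c \<noteq> 0" "cong8 c a b" shows "ef a c = ef b c"
  using ef_add[of b "a - b" c] ef_integral[of c "a - b"] assms by (simp add: cong8_def)

text \<open>Unless \<open>p\<close> divides \<open>a\<close>, some shift of \<open>u\<close> multiplies the sum by a value of the character different from \<open>1\<close>.\<close>
lemma ef_sum_prime:
  assumes p: "prime_elem p" 
  shows "(\<Sum>u\<in>reps8 p. ef (a * u) p) = (if p dvd a then of_nat (card (reps8 p)) else 0)"
proof -
  have p0: "p \<noteq> 0" "\<not> is_unit p" using p by (auto simp: prime_elem_def)
  show ?thesis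
  proof (cases "p dvd a")
    case True
    then have "ef (a * u) p = 1" for u using ef_integral p0 by simp
    with True show ?thesis by simp
  next
    case False
    then have cop: "coprime a p" using p by (metis coprime_commute prime_elem_imp_coprime)
    obtain v where v: "ef v p \<noteq> 1" using ef_nontrivial p0 by blast
    define t where "t = inv_mod p a * v"
    have "cong8 p ((a * inv_mod p a) * v) (1 * v)" by (intro cong8_mult inv_mod cop) auto
    then have "ef (a * t) p = ef v p" unfolding t_def using p0 by (intro ef_cong) (simp_all add: mult.assoc)
    moreover have "(\<Sum>u\<in>reps8 p. ef (a * (u + t)) p) = (\<Sum>u\<in>reps8 p. ef (a * u) p)"
      using p0 by (intro sum_reps8_shift[of p "\<lambda>u. ef (a * u) p" t] ef_cong cong8_mult) simp_all
    then have "(\<Sum>u\<in>reps8 p. ef (a * u) p) * ef (a * t) p = (\<Sum>u\<in>reps8 p. ef (a * u) p)"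
      by (simp add: distrib_left ef_add sum_distrib_right)
    ultimately have "(\<Sum>u\<in>reps8 p. ef (a * u) p) = 0" using v by (metis mult_cancel_left1 mult.commute)
    then show ?thesis using False by simp
  qed
qed

end

section \<open>The quartic residue symbol\<close>
definition i8 :: zeta8 where "i8 = w8 ^ 2"

lemma i8_2: "i8 ^ 2 = -1" using w8_4 unfolding i8_def by (simp flip: power_mult)

lemma fourth_root_cases:
  assumes "(z::zeta8) ^ 4 = 1" shows "z = 1 \<or> z = -1 \<or> z = i8 \<or> z = - i8"
proof -
  have "(z - 1) * (z + 1) * ((z - i8) * (z + i8)) = z ^ 4 - 1 - (i8 ^ 2 + 1) * (z ^ 2 - 1)" by algebra
  then have "(z - 1) * (z + 1) * ((z - i8) * (z + i8)) = 0" using assms i8_2 by simp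
  then show ?thesis by (auto simp: eq_neg_iff_add_eq_0)
qed

lemma cong8_prod: "(\<And>u. u \<in> A \<Longrightarrow> cong8 c (f u) (g u)) \<Longrightarrow> cong8 c (prod f A) (prod g A)"
  by (induction A rule: infinite_finite_induct) (auto intro: cong8_mult)

text \<open>A polynomial has at most as many roots in the residue field as its degree: dividing off a root by synthetic division
leaves the leading coefficient unchanged.\<close>
lemma card_poly_roots_mod_prime:
  fixes P :: "zeta8 poly"
  assumes p: "prime_elem p" and "\<not> p dvd lead_coeff P"
  shows "card {x \<in> reps8 p. p dvd poly P x} \<le> degree P"
  using assms(2)
proof (induction "degree P" arbitrary: P)
  case 0
  then obtain a where "P = [:a:]" by (metis degree_eq_zeroE)
  then have "{x \<in> reps8 p. p dvd poly P x} = {}" using 0 by auto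
  then show ?case by (simp only: card.empty)
next
  case (Suc n)
  have fin: "finite (reps8 p)" using p by (intro finite_reps8) auto
  show ?case
  proof (cases "{x \<in> reps8 p. p dvd poly P x} = {}")
    case True show ?thesis unfolding True by (simp only: card.empty)
  next
    case False
    then obtain a where a: "a \<in> reps8 p" "p dvd poly P a" by blast
    define S where "S = synthetic_div P a"
    have dS: "degree S = n" unfolding S_def degree_synthetic_div using Suc.hyps(2) by simp
    have "coeff (P + smult a S) (Suc n) = coeff (pCons (poly P a) S) (Suc n)"
      unfolding S_def synthetic_div_correct ..
    then have "lead_coeff S = lead_coeff P" using dS Suc.hyps(2)[symmetric] by (simp add: coeff_eq_0)
    then have IH: "card {x \<in> reps8 p. p dvd poly S x} \<le> n" using Suc dS by metis
    have "{x \<in> reps8 p. p dvd poly P x} \<subseteq> insert a {x \<in> reps8 p. p dvd poly S x}"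
    proof
      fix x assume "x \<in> {x \<in> reps8 p. p dvd poly P x}"
      then have x: "x \<in> reps8 p" "p dvd poly P x" by auto
      have "poly P x = (x - a) * poly S x + poly P a"
        using arg_cong[OF synthetic_div_correct'[of a P], of "\<lambda>Q. poly Q x"] unfolding S_def by (simp add: algebra_simps)
      then have "p dvd (x - a) * poly S x" using x a by (metis dvd_add_left_iff)
      then have "p dvd x - a \<or> p dvd poly S x" using p prime_elem_dvd_mult_iff by blast
      then show "x \<in> insert a {x \<in> reps8 p. p dvd poly S x}"
        using x a reps8_eqI[of x p a] by (auto simp: cong8_def)
    qed
    then have "card {x \<in> reps8 p. p dvd poly P x} \<le> card (insert a {x \<in> reps8 p. p dvd poly S x})"
      using fin by (intro card_mono) auto
    also have "\<dots> \<le> Suc (card {x \<in> reps8 p. p dvd poly S x})" using fin by (simp add: card_insert_if)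
    finally show ?thesis using IH Suc.hyps(2) by linarith
  qed
qed

locale odd_prime8 =
  fixes p :: zeta8
  assumes prime: "prime_elem p" and odd: "\<not> p dvd 2"
begin

lemma p_nz: "p \<noteq> 0" and p_nonunit: "\<not> is_unit p" using prime by (auto simp: prime_elem_def)

lemma coprime_iff: "coprime x p \<longleftrightarrow> \<not> p dvd x"
  using prime p_nonunit by (metis coprime_commute prime_elem_imp_coprime coprime_absorb_left)

lemma dvd_mult_iff: "p dvd a * b \<longleftrightarrow> p dvd a \<or> p dvd b"
  using prime by (rule prime_elem_dvd_mult_iff)

lemma dvd_cong: "cong8 p x y \<Longrightarrow> p dvd x \<longleftrightarrow> p dvd y"
  by (erule cong8_dvd_iff) simp

lemma dvd_power_iff: "n > 0 \<Longrightarrow> p dvd x ^ n \<longleftrightarrow> p dvd x"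
  using prime by (metis dvd_power dvd_trans prime_elem_dvd_power)

lemma finite_reps [simp]: "finite (reps8 p)" by (rule finite_reps8[OF p_nz])

lemma card_units: "card {x \<in> reps8 p. \<not> p dvd x} = absnorm8 p - 1"
proof -
  have "{x \<in> reps8 p. p dvd x} = {rep8 p 0}"
    using cong8_rep8[of p 0] reps8_eqI[of _ p "rep8 p 0"] rep8_in
    by (auto simp: cong8_def dest: dvd_diff intro!: )
  then have "card {x \<in> reps8 p. p dvd x} = 1" by simp
  moreover have "reps8 p = {x \<in> reps8 p. \<not> p dvd x} \<union> {x \<in> reps8 p. p dvd x}" by auto
  then have "card (reps8 p) = card {x \<in> reps8 p. \<not> p dvd x} + card {x \<in> reps8 p. p dvd x}"
    by (metis (no_types, lifting) card_Un_disjoint disjoint_iff finite_reps finite_Un mem_Collect_eq)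
  ultimately show ?thesis by (simp add: absnorm8_eq)
qed

text \<open>Multiplication by \<open>x\<close> permutes the units modulo \<open>p\<close>.\<close>
lemma fermat: assumes "\<not> p dvd x" shows "cong8 p (x ^ (absnorm8 p - 1)) 1"
proof -
  let ?U = "{u \<in> reps8 p. \<not> p dvd u}"
  have x: "coprime x p" using assms coprime_iff by blast
  have "bij_betw (\<lambda>u. rep8 p (x * u)) ?U ?U"
  proof (rule bij_betw_reps8)
    show "cong8 p (x * a) (x * b) \<longleftrightarrow> cong8 p a b" for a b by (rule cong8_mult_left_iff[OF x])
    show "\<exists>u. \<not> p dvd u \<and> cong8 p (x * u) y" if "\<not> p dvd y" for y
    proof (intro exI conjI)
      show "\<not> p dvd inv_mod p x * y" using that inv_mod_coprime[OF x] coprime_iff dvd_mult_iff by blast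
      have "cong8 p ((x * inv_mod p x) * y) (1 * y)" by (intro cong8_mult inv_mod x) auto
      then show "cong8 p (x * (inv_mod p x * y)) y" by (simp add: mult.assoc)
    qed
  qed (use assms dvd_mult_iff dvd_cong in simp_all)
  then have "(\<Prod>u\<in>?U. u) = (\<Prod>u\<in>?U. rep8 p (x * u))" by (rule prod.reindex_bij_betw[symmetric])
  then have "cong8 p (\<Prod>u\<in>?U. x * u) (\<Prod>u\<in>?U. u)" 
    using cong8_prod[of ?U p "\<lambda>u. x * u" "\<lambda>u. rep8 p (x * u)"] cong8_rep8 by simp
  moreover have "(\<Prod>u\<in>?U. x * u) = (\<Prod>u\<in>?U. u) * x ^ (absnorm8 p - 1)"
    by (simp add: prod.distrib card_units mult.commute)
  ultimately have "cong8 p ((\<Prod>u\<in>?U. u) * x ^ (absnorm8 p - 1)) ((\<Prod>u\<in>?U. u) * 1)" by simp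
  moreover have "coprime (\<Prod>u\<in>?U. u) p" by (rule prod_coprime_left) (auto simp: coprime_iff)
  ultimately show ?thesis by (rule cong8_cancel)
qed

text \<open>The differences of \<open>1\<close> and the other fourth roots of unity divide \<open>2\<close>.\<close>
lemma fourth_root_unique1:
  assumes "z ^ 4 = 1" "cong8 p z 1" shows "z = 1"
proof (rule ccontr)
  assume "z \<noteq> 1"
  then have "z = -1 \<or> z = i8 \<or> z = - i8" using fourth_root_cases assms(1) by blast
  moreover have "(i8 - 1) * (- i8 - 1) = 2" using i8_2 by algebra
  moreover have "(-1 - 1) * (-1) = (2::zeta8)" by simp
  ultimately have "z - 1 dvd 2" by (metis dvd_triv_left dvd_triv_right)
  then show False using assms(2) odd dvd_trans unfolding cong8_def by blast
qed

lemma fourth_root_unique: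
  assumes "z ^ 4 = 1" "z' ^ 4 = 1" "cong8 p z z'" shows "z = z'"
proof -
  have "cong8 p (z * z' ^ 3) (z' * z' ^ 3)" using assms by (intro cong8_mult) auto
  moreover have z'4: "z' * z' ^ 3 = 1" using assms(2) by (simp add: eval_nat_numeral)
  ultimately have c1: "cong8 p (z * z' ^ 3) 1" by simp
  have "(z * z' ^ 3) ^ 4 = z ^ 4 * (z' ^ 4) ^ 3" by algebra
  then have "(z * z' ^ 3) ^ 4 = 1" by (simp only: assms power_one mult_1)
  from fourth_root_unique1[OF this c1] have "z * z' ^ 3 = 1" .
  then have "z * (z' * z' ^ 3) = z'" by (simp add: algebra_simps)
  then show ?thesis using z'4 by simp
qed

text \<open>By Fermat the \<open>(N p - 1)\<close>-th power of \<open>i\<close> is congruent to \<open>1\<close>, hence equal to \<open>1\<close>; but \<open>i\<close> has order four.\<close>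
lemma four_dvd_absnorm: "4 dvd absnorm8 p - 1"
proof -
  have i4: "i8 ^ 4 = 1" using i8_2 by algebra
  have "\<not> p dvd i8"
  proof
    assume "p dvd i8"
    then have "p dvd i8 * i8 ^ 3" by simp
    then show False using i4 p_nonunit by (simp add: eval_nat_numeral)
  qed
  from fermat[OF this] have "i8 ^ (absnorm8 p - 1) = 1"
    by (rule fourth_root_unique1[rotated]) (metis i4 power_commutes power_mult mult.commute power_one)
  moreover have "i8 ^ (absnorm8 p - 1) = i8 ^ (4 * ((absnorm8 p - 1) div 4)) * i8 ^ ((absnorm8 p - 1) mod 4)"
    by (simp flip: power_add)
  moreover have "i8 ^ (4 * ((absnorm8 p - 1) div 4)) = 1" by (simp only: power_mult i4 power_one)
  ultimately have r: "i8 ^ ((absnorm8 p - 1) mod 4) = 1" by simp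
  have "i8 \<noteq> 1"
  proof
    assume "i8 = 1" then have "(1::zeta8) = -1" using i8_2 by simp
    then show False by simp
  qed
  moreover have "i8 ^ 2 \<noteq> 1" unfolding i8_2 by simp
  moreover have "i8 ^ 3 \<noteq> 1"
  proof
    assume "i8 ^ 3 = 1"
    then have "i8 ^ 4 = i8" by (simp add: eval_nat_numeral)
    then show False using i4 \<open>i8 \<noteq> 1\<close> by simp
  qed
  moreover have "(absnorm8 p - 1) mod 4 < 4" by simp
  then consider "(absnorm8 p - 1) mod 4 = 0" | "(absnorm8 p - 1) mod 4 = 1" | "(absnorm8 p - 1) mod 4 = 2" | "(absnorm8 p - 1) mod 4 = 3"
    by linarith
  then have "(absnorm8 p - 1) mod 4 = 0" using r calculation by cases simp_all
  then show ?thesis by auto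
qed

definition quartic_char :: "zeta8 \<Rightarrow> zeta8" where "quartic_char x = residue_symbol_prime 4 x p"

lemma quartic_char_0: "p dvd x \<Longrightarrow> quartic_char x = 0" by (simp add: quartic_char_def residue_symbol_prime_def)

lemma quartic_char_unique:
  assumes "\<not> p dvd x" "z ^ 4 = 1" "cong8 p z (x ^ ((absnorm8 p - 1) div 4))"
  shows "quartic_char x = z"
  using assms unfolding quartic_char_def residue_symbol_prime_def
  by (auto intro!: the_equality fourth_root_unique dest: cong8_sym cong8_trans)

lemma quartic_char_spec:
  assumes "\<not> p dvd x"
  shows "quartic_char x ^ 4 = 1 \<and> cong8 p (quartic_char x) (x ^ ((absnorm8 p - 1) div 4))"
proof -
  define y where "y = x ^ ((absnorm8 p - 1) div 4)"
  have "y ^ 4 = x ^ (absnorm8 p - 1)" unfolding y_def using four_dvd_absnorm by (simp flip: power_mult)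
  then have "p dvd y ^ 4 - 1" using fermat[OF assms] by (simp add: cong8_def)
  moreover have "y ^ 4 - 1 = (y - 1) * (y - (-1)) * ((y - i8) * (y - (- i8)))" using i8_2 by algebra
  ultimately have "p dvd y - 1 \<or> p dvd y - (-1) \<or> p dvd y - i8 \<or> p dvd y - (- i8)"
    by (simp only: dvd_mult_iff disj_assoc)
  moreover have "(1::zeta8) ^ 4 = 1" "(-1::zeta8) ^ 4 = 1" "i8 ^ 4 = 1" "(- i8) ^ 4 = 1" using i8_2 by (simp, simp, algebra+)
  ultimately obtain z where "z ^ 4 = 1" "p dvd y - z" by blast
  then show ?thesis using quartic_char_unique[OF assms] cong8_sym unfolding y_def cong8_def[symmetric] by metis
qed

lemma quartic_char_cong: assumes "cong8 p x y" shows "quartic_char x = quartic_char y"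
proof (cases "p dvd x")
  case True
  then have "p dvd y" using dvd_cong[OF assms] by blast
  with True show ?thesis by (simp add: quartic_char_0)
next
  case False
  then have y: "\<not> p dvd y" using dvd_cong[OF assms] by blast
  show ?thesis
    using quartic_char_unique[OF False] quartic_char_spec[OF y] cong8_trans[OF _ cong8_power[OF cong8_sym[OF assms]]] by blast
qed

lemma quartic_char_mult: "quartic_char (x * y) = quartic_char x * quartic_char y"
proof (cases "p dvd x \<or> p dvd y")
  case True then show ?thesis using quartic_char_0 by auto
next
  case False
  then have s: "quartic_char x ^ 4 = 1" "cong8 p (quartic_char x) (x ^ ((absnorm8 p - 1) div 4))"
    "quartic_char y ^ 4 = 1" "cong8 p (quartic_char y) (y ^ ((absnorm8 p - 1) div 4))" using quartic_char_spec by blast+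
  show ?thesis
  proof (rule quartic_char_unique)
    show "\<not> p dvd x * y" using False dvd_mult_iff by blast
    show "(quartic_char x * quartic_char y) ^ 4 = 1" using s by (simp add: power_mult_distrib)
    show "cong8 p (quartic_char x * quartic_char y) ((x * y) ^ ((absnorm8 p - 1) div 4))"
      unfolding power_mult_distrib using s by (intro cong8_mult)
  qed
qed

lemma quartic_char_fourth_power: assumes "\<not> p dvd y" shows "quartic_char (y ^ 4) = 1"
proof (rule quartic_char_unique)
  show "\<not> p dvd y ^ 4" using assms by (simp add: dvd_power_iff)
  have "(y ^ 4) ^ ((absnorm8 p - 1) div 4) = y ^ (absnorm8 p - 1)"
    using four_dvd_absnorm by (simp flip: power_mult)
  then show "cong8 p 1 ((y ^ 4) ^ ((absnorm8 p - 1) div 4))" using cong8_sym[OF fermat[OF assms]] by simp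
qed simp

lemma quartic_char_1: "quartic_char 1 = 1" using quartic_char_fourth_power[of 1] p_nonunit by simp

lemma not_dvd_w8: "\<not> p dvd w8"
proof
  assume "p dvd w8"
  then have "p dvd w8 * w8 ^ 3" by simp
  then have "p dvd w8 ^ 4" by (simp add: eval_nat_numeral)
  then show False using w8_4 p_nonunit by simp
qed

text \<open>\<open>-1\<close> is the fourth power of \<open>w8\<close>.\<close>
lemma quartic_char_minus_1: "quartic_char (-1) = 1" using quartic_char_fourth_power[OF not_dvd_w8] w8_4 by simp

lemma residue_symbol_prime_square: 
  assumes "\<not> p dvd s" shows "residue_symbol_prime 2 (s ^ 2) p = 1"
proof -
  have "2 dvd absnorm8 p - 1" using four_dvd_absnorm by (rule dvd_trans[rotated]) simp
  then have e: "(s ^ 2) ^ ((absnorm8 p - 1) div 2) = s ^ (absnorm8 p - 1)" by (simp flip: power_mult)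
  have "(THE z. z ^ 2 = 1 \<and> cong8 p z ((s ^ 2) ^ ((absnorm8 p - 1) div 2))) = 1"
  proof (rule the_equality)
    show "(1::zeta8) ^ 2 = 1 \<and> cong8 p 1 ((s ^ 2) ^ ((absnorm8 p - 1) div 2))"
      unfolding e using cong8_sym[OF fermat[OF assms]] by simp
    fix z assume z: "z ^ 2 = 1 \<and> cong8 p z ((s ^ 2) ^ ((absnorm8 p - 1) div 2))"
    have "z ^ 4 = (z ^ 2) ^ 2" by (simp flip: power_mult)
    then have "z ^ 4 = 1" using z by simp
    moreover have "cong8 p z 1" using z cong8_trans[OF _ fermat[OF assms]] unfolding e by blast
    ultimately show "z = 1" by (rule fourth_root_unique1)
  qed
  then show ?thesis using assms unfolding residue_symbol_prime_def by (simp add: dvd_power_iff)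
qed

end

lemma residue_symbol_prime_assoc:
  assumes "p dvd q" "q dvd p" shows "residue_symbol_prime k x p = residue_symbol_prime k x q"
proof -
  have "cong8 p = cong8 q" unfolding cong8_def fun_eq_iff using assms dvd_trans by blast
  moreover have "absnorm8 p = absnorm8 q" unfolding absnorm8_def residue_classes_def calculation ..
  moreover have "p dvd x \<longleftrightarrow> q dvd x" using assms dvd_trans by blast
  ultimately show ?thesis unfolding residue_symbol_prime_def by simp
qed

text \<open>Two factorisations into primes differ by associates of the factors, and the symbol at a prime does not see
associates; the canonical factorisation may therefore replace the chosen one.\<close>
lemma residue_symbol_eq:
  assumes "c \<noteq> 0" 
  shows "residue_symbol k x c = to_complex (\<Prod>p\<in>#prime_factorization c. residue_symbol_prime k x p)"
proof -
  define M where "M = prime_factors8 c"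
  have "\<exists>M. (\<forall>p\<in>#M. prime_elem p) \<and> (\<exists>u. is_unit u \<and> c = u * prod_mset M)"
  proof (rule exI[of _ "prime_factorization c"], rule conjI)
    show "\<forall>p\<in>#prime_factorization c. prime_elem p"
      by (meson in_prime_factors_imp_prime prime_imp_prime_elem)
    have "normalize c = normalize (prod_mset (prime_factorization c))"
      using prod_mset_prime_factorization_weak[OF assms] by simp
    then show "\<exists>u. is_unit u \<and> c = u * prod_mset (prime_factorization c)"
      by (rule associatedE1) blast
  qed
  then have M: "(\<forall>p\<in>#M. prime_elem p)" "\<exists>u. is_unit u \<and> c = u * prod_mset M"
    unfolding M_def prime_factors8_def by (rule someI2_ex; blast)+
  have "prime_factorization (prod_mset M) = image_mset normalize M"
    using M(1)
  proof (induction M)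
    case (add q M)
    then have "q \<noteq> 0" "prod_mset M \<noteq> 0" by (auto simp: prime_elem_def)
    moreover have "prime_factorization q = {#normalize q#}"
      using add.prems by (subst prime_factorization_normalize[symmetric], intro prime_factorization_prime) simp
    ultimately show ?case using add by (simp add: prime_factorization_mult)
  qed simp
  moreover have "prime_factorization c = prime_factorization (prod_mset M)"
    using M(2) by (intro prime_factorization_cong) auto
  ultimately have "(\<Prod>p\<in>#prime_factorization c. residue_symbol_prime k x p) = (\<Prod>p\<in>#M. residue_symbol_prime k x (normalize p))"
    by (simp add: image_mset.compositionality comp_def)
  also have "\<dots> = (\<Prod>p\<in>#M. residue_symbol_prime k x p)"
    by (intro arg_cong[of _ _ prod_mset] image_mset_cong residue_symbol_prime_assoc) auto
  finally show ?thesis unfolding residue_symbol_def M_def by simp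
qed

lemma residue_symbol_mult:
  assumes "n \<noteq> 0" "m \<noteq> 0" shows "residue_symbol k x (n * m) = residue_symbol k x n * residue_symbol k x m"
  using assms by (simp add: residue_symbol_eq prime_factorization_mult)

lemma residue_symbol_unit: "is_unit c \<Longrightarrow> residue_symbol k x c = 1"
  by (subst residue_symbol_eq) (auto simp: prime_factorization_unit)

lemma odd_prime_factor:
  assumes "coprime 2 c" "c \<noteq> 0" "q \<in># prime_factorization c" shows "odd_prime8 q"
proof
  show "prime_elem q" using assms(3) by (meson in_prime_factors_imp_prime prime_imp_prime_elem)
  have "q dvd c" using assms(3) by (rule in_prime_factors_imp_dvd)
  then show "\<not> q dvd 2" using assms \<open>prime_elem q\<close> coprime_common_divisor[of 2 c q] by (auto simp: prime_elem_def)
qed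

lemma residue_symbol_cong:
  assumes "coprime 2 c" "c \<noteq> 0" "cong8 c x y" shows "residue_symbol 4 x c = residue_symbol 4 y c"
proof -
  have "residue_symbol_prime 4 x q = residue_symbol_prime 4 y q" if q: "q \<in># prime_factorization c" for q
  proof -
    interpret odd_prime8 q using odd_prime_factor assms q by blast
    have "q dvd c" using q by (rule in_prime_factors_imp_dvd)
    then show ?thesis using quartic_char_cong[of x y] cong8_dvd_mod[OF assms(3)] unfolding quartic_char_def by blast
  qed
  then show ?thesis using assms(2) by (simp add: residue_symbol_eq cong: image_mset_cong)
qed

lemma residue_symbol_2_square:
  assumes "coprime 2 c" "c \<noteq> 0" "coprime s c" shows "residue_symbol 2 (s ^ 2) c = 1"
proof -
  have "residue_symbol_prime 2 (s ^ 2) q = 1" if q: "q \<in># prime_factorization c" for q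
  proof -
    interpret odd_prime8 q using odd_prime_factor assms q by blast
    have "q dvd c" using q by (rule in_prime_factors_imp_dvd)
    then have "\<not> q dvd s" using assms(3) p_nonunit coprime_common_divisor by blast
    then show ?thesis by (rule residue_symbol_prime_square)
  qed
  then show ?thesis using assms(2) by (simp add: residue_symbol_eq cong: image_mset_cong)
qed

section \<open>The identity modulo a prime\<close>
lemma sum_fibres:
  fixes G :: "zeta8 \<Rightarrow> complex"
  assumes "c \<noteq> 0" "finite A" "\<And>x y. cong8 c x y \<Longrightarrow> G x = G y"
  shows "(\<Sum>u\<in>A. G (g u)) = (\<Sum>y\<in>reps8 c. of_nat (card {u \<in> A. cong8 c (g u) y}) * G y)"
proof -
  have "(\<Sum>u\<in>A. G (g u)) = (\<Sum>y\<in>reps8 c. \<Sum>u | u \<in> A \<and> rep8 c (g u) = y. G (g u))"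
    by (rule sum.group[symmetric]) (use assms finite_reps8 rep8_in in auto)
  also have "\<dots> = (\<Sum>y\<in>reps8 c. of_nat (card {u \<in> A. cong8 c (g u) y}) * G y)"
  proof (rule sum.cong[OF refl])
    fix y assume y: "y \<in> reps8 c"
    have eq: "rep8 c (g u) = y \<longleftrightarrow> cong8 c (g u) y" for u
      using rep8_id[OF y] rep8_eq_iff[of c "g u" y] by simp
    have "(\<Sum>u | u \<in> A \<and> rep8 c (g u) = y. G (g u)) = (\<Sum>u | u \<in> A \<and> cong8 c (g u) y. G y)"
      unfolding eq using assms(3) by (intro sum.cong) auto
    then show "(\<Sum>u | u \<in> A \<and> rep8 c (g u) = y. G (g u)) = of_nat (card {u \<in> A. cong8 c (g u) y}) * G y"
      by simp
  qed
  finally show ?thesis .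
qed

context odd_prime8
begin

text \<open>The quadratic character, as a ring element so that it can be compared with powers modulo \<open>p\<close>.\<close>
definition qr :: "zeta8 \<Rightarrow> zeta8" where
  "qr x = (if p dvd x then 0 else if \<exists>s. cong8 p (s ^ 2) x then 1 else -1)"

lemma qr_cong: assumes "cong8 p x y" shows "qr x = qr y"
proof -
  have "cong8 p (s ^ 2) x \<longleftrightarrow> cong8 p (s ^ 2) y" for s using assms cong8_sym cong8_trans by blast
  then show ?thesis unfolding qr_def using dvd_cong[OF assms] by simp
qed

lemma sq_cong_iff: "cong8 p (z ^ 2) (s ^ 2) \<longleftrightarrow> cong8 p z s \<or> cong8 p z (- s)"
proof -
  have "z ^ 2 - s ^ 2 = (z - s) * (z - (- s))" by algebra
  then show ?thesis unfolding cong8_def by (simp only: dvd_mult_iff)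
qed

lemma card_square_roots_unit:
  assumes "\<not> p dvd s" shows "card {z \<in> reps8 p. cong8 p (z ^ 2) (s ^ 2)} = 2"
proof -
  have "{z \<in> reps8 p. cong8 p (z ^ 2) (s ^ 2)} = {rep8 p s, rep8 p (- s)}"
  proof (intro subset_antisym subsetI)
    fix z assume "z \<in> {z \<in> reps8 p. cong8 p (z ^ 2) (s ^ 2)}"
    then have "z \<in> reps8 p" "cong8 p s z \<or> cong8 p (- s) z" using sq_cong_iff cong8_sym by auto
    then have "rep8 p s = z \<or> rep8 p (- s) = z" by (simp add: rep8_eq_rep_iff)
    then show "z \<in> {rep8 p s, rep8 p (- s)}" by auto
  next
    fix z assume "z \<in> {rep8 p s, rep8 p (- s)}"
    then have "z \<in> reps8 p" "cong8 p z s \<or> cong8 p z (- s)"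
      using cong8_sym[OF cong8_rep8, of p s] cong8_sym[OF cong8_rep8, of p "- s"] rep8_in by blast+
    then show "z \<in> {z \<in> reps8 p. cong8 p (z ^ 2) (s ^ 2)}" by (simp add: sq_cong_iff)
  qed
  moreover have "rep8 p s \<noteq> rep8 p (- s)"
  proof
    assume "rep8 p s = rep8 p (- s)"
    then have "p dvd s - (- s)" unfolding rep8_eq_iff cong8_def .
    also have "s - (- s) = 2 * s" by algebra
    finally have "p dvd 2 * s" .
    then show False using dvd_mult_iff odd assms by blast
  qed
  ultimately show ?thesis by simp
qed

lemma card_square_roots: "of_nat (card {z \<in> reps8 p. cong8 p (z ^ 2) y}) = 1 + to_complex (qr y)"
proof -
  consider "p dvd y" | s where "\<not> p dvd y" "cong8 p (s ^ 2) y" | "\<not> p dvd y" "\<not> (\<exists>s. cong8 p (s ^ 2) y)" by blast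
  then show ?thesis
  proof cases
    case 1
    have "{z \<in> reps8 p. cong8 p (z ^ 2) y} = {rep8 p 0}"
    proof (intro subset_antisym subsetI)
      fix z assume "z \<in> {z \<in> reps8 p. cong8 p (z ^ 2) y}"
      then have z: "z \<in> reps8 p" "p dvd z" using dvd_cong 1 dvd_power_iff[of 2 z] by auto
      then have "cong8 p 0 z" by (simp add: cong8_def)
      then have "rep8 p 0 = z" by (simp add: rep8_eq_rep_iff z)
      then show "z \<in> {rep8 p 0}" by simp
    next
      fix z assume "z \<in> {rep8 p 0}"
      then have z: "z = rep8 p 0" by simp
      have "cong8 p (z ^ 2) (0 ^ 2)" unfolding z by (rule cong8_power[OF cong8_sym[OF cong8_rep8]])
      also have "cong8 p (0 ^ 2) y" using 1 by (simp add: cong8_def)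
      finally show "z \<in> {z \<in> reps8 p. cong8 p (z ^ 2) y}" using z rep8_in by simp
    qed
    then show ?thesis using 1 by (simp add: qr_def)
  next
    case 2
    then have s: "\<not> p dvd s" using dvd_cong[OF 2(2)] dvd_power_iff[of 2 s] by simp
    have "cong8 p (z ^ 2) y \<longleftrightarrow> cong8 p (z ^ 2) (s ^ 2)" for z using 2(2) cong8_sym cong8_trans by blast
    then have "card {z \<in> reps8 p. cong8 p (z ^ 2) y} = 2" using card_square_roots_unit[OF s] by simp
    moreover have "qr y = 1" using 2 unfolding qr_def by auto
    ultimately show ?thesis by simp
  next
    case 3
    then have e: "{z \<in> reps8 p. cong8 p (z ^ 2) y} = {}" and "qr y = -1" unfolding qr_def by auto
    then show ?thesis unfolding e by simp
  qed
qed

lemma two_dvd_absnorm: "2 * ((absnorm8 p - 1) div 2) = absnorm8 p - 1"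
proof -
  have "2 dvd absnorm8 p - 1" using four_dvd_absnorm by (rule dvd_trans[rotated]) simp
  then show ?thesis by simp
qed

lemma half_absnorm: "2 * ((absnorm8 p - 1) div 4) = (absnorm8 p - 1) div 2"
  using four_dvd_absnorm by auto

text \<open>Squaring is two-to-one on the units.\<close>
lemma card_squares: "card {y \<in> reps8 p. \<not> p dvd y \<and> (\<exists>s. cong8 p (s ^ 2) y)} = (absnorm8 p - 1) div 2"
proof -
  let ?U = "{u \<in> reps8 p. \<not> p dvd u}" and ?S = "{y \<in> reps8 p. \<not> p dvd y \<and> (\<exists>s. cong8 p (s ^ 2) y)}"
  have S: "y \<in> ?S \<Longrightarrow> card {u \<in> ?U. rep8 p (u ^ 2) = y} = 2" for y
  proof -
    assume "y \<in> ?S"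
    then obtain s where y: "y \<in> reps8 p" "\<not> p dvd y" "cong8 p (s ^ 2) y" by blast
    then have s: "\<not> p dvd s" using dvd_cong[OF y(3)] dvd_power_iff[of 2 s] by simp
    have "{u \<in> ?U. rep8 p (u ^ 2) = y} = {z \<in> reps8 p. cong8 p (z ^ 2) (s ^ 2)}"
    proof (intro subset_antisym subsetI)
      fix u assume "u \<in> {u \<in> ?U. rep8 p (u ^ 2) = y}"
      then have "u \<in> reps8 p" "cong8 p (u ^ 2) y" using cong8_rep8[of p "u^2"] by auto
      then show "u \<in> {z \<in> reps8 p. cong8 p (z ^ 2) (s ^ 2)}" using y(3) cong8_sym cong8_trans by blast
    next
      fix u assume "u \<in> {z \<in> reps8 p. cong8 p (z ^ 2) (s ^ 2)}"
      then have u: "u \<in> reps8 p" "cong8 p (u ^ 2) (s ^ 2)" by auto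
      then have uy: "cong8 p (u ^ 2) y" using y(3) cong8_trans by blast
      then have "\<not> p dvd u" using dvd_cong y(2) dvd_power_iff[of 2 u] by simp
      then show "u \<in> {u \<in> ?U. rep8 p (u ^ 2) = y}" using u uy rep8_eq_rep_iff[OF y(1)] by blast
    qed
    then show ?thesis using card_square_roots_unit[OF s] by simp
  qed
  have "absnorm8 p - 1 = (\<Sum>u\<in>?U. 1)" using card_units by simp
  also have "\<dots> = (\<Sum>y\<in>?S. \<Sum>u | u \<in> ?U \<and> rep8 p (u ^ 2) = y. 1)"
  proof (rule sum.group[symmetric])
    show "(\<lambda>u. rep8 p (u ^ 2)) ` ?U \<subseteq> ?S"
    proof
      fix y assume "y \<in> (\<lambda>u. rep8 p (u ^ 2)) ` ?U"
      then obtain u where u: "\<not> p dvd u" "y = rep8 p (u ^ 2)" by blast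
      then have "cong8 p (u ^ 2) y" "y \<in> reps8 p" using cong8_rep8 rep8_in by simp_all
      moreover have "\<not> p dvd y" using u dvd_cong[OF \<open>cong8 p (u ^ 2) y\<close>] dvd_power_iff[of 2 u] by simp
      ultimately show "y \<in> ?S" by blast
    qed
  qed auto
  also have "\<dots> = (\<Sum>y\<in>?S. 2)" using S by (intro sum.cong) auto
  finally show ?thesis by simp
qed

text \<open>The nonzero squares are roots of \<open>X\<^sup>h - 1\<close> with \<open>h = (N p - 1) / 2\<close>, and there are \<open>h\<close> of them; so they are
all its roots, and a nonsquare gives the other square root of \<open>1\<close>.\<close>
lemma euler_criterion:
  assumes "\<not> p dvd x" shows "cong8 p (qr x) (x ^ ((absnorm8 p - 1) div 2))"
proof -
  let ?h = "(absnorm8 p - 1) div 2"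
  let ?S = "{y \<in> reps8 p. \<not> p dvd y \<and> (\<exists>s. cong8 p (s ^ 2) y)}" and ?R = "{y \<in> reps8 p. p dvd y ^ ?h - 1}"
  have sq: "cong8 p (y ^ ?h) 1" if "\<not> p dvd y" "cong8 p (s ^ 2) y" for y s
  proof -
    have "\<not> p dvd s" using that dvd_cong[OF that(2)] dvd_power_iff[of 2 s] by simp
    then have "cong8 p ((s ^ 2) ^ ?h) 1" using fermat two_dvd_absnorm by (simp flip: power_mult)
    then show ?thesis using cong8_power[OF that(2), of ?h] cong8_sym cong8_trans by blast
  qed
  have "rep8 p 1 \<in> {u \<in> reps8 p. \<not> p dvd u}" using p_nonunit dvd_cong[OF cong8_rep8, of 1] rep8_in by auto
  then have "card {u \<in> reps8 p. \<not> p dvd u} > 0" by (auto simp: card_gt_0_iff)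
  then have h: "?h > 0" using card_units four_dvd_absnorm by auto
  have deg: "degree (monom 1 ?h + [:-1:] :: zeta8 poly) = ?h"
    using h by (subst degree_add_eq_left) (simp_all add: degree_monom_eq)
  moreover have "lead_coeff (monom 1 ?h + [:-1:] :: zeta8 poly) = 1" unfolding deg using h by (simp add: coeff_pCons split: nat.split)
  ultimately have "card {x \<in> reps8 p. p dvd poly (monom 1 ?h + [:-1:]) x} \<le> ?h"
    using card_poly_roots_mod_prime[OF prime, of "monom 1 ?h + [:-1:]"] p_nonunit by metis
  then have "card ?R \<le> card ?S" unfolding card_squares by (simp add: poly_monom)
  moreover have "?S \<subseteq> ?R" using sq by (auto simp: cong8_def)
  ultimately have SR: "?S = ?R" by (intro card_seteq) auto
  show ?thesis
  proof (cases "\<exists>s. cong8 p (s ^ 2) x")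
    case True
    then show ?thesis using assms sq cong8_sym unfolding qr_def by auto
  next
    case False
    have "x ^ (absnorm8 p - 1) = (x ^ ?h) ^ 2" using two_dvd_absnorm by (metis mult.commute power_mult)
    then have "p dvd (x ^ ?h) ^ 2 - 1" using fermat[OF assms] unfolding cong8_def by simp
    moreover have "(x ^ ?h) ^ 2 - 1 = (x ^ ?h - 1) * (x ^ ?h - (-1))" by algebra
    ultimately have "p dvd x ^ ?h - 1 \<or> p dvd x ^ ?h - (-1)" by (simp only: dvd_mult_iff)
    moreover have "\<not> p dvd x ^ ?h - 1"
    proof
      assume "p dvd x ^ ?h - 1"
      then have "cong8 p (x ^ ?h) 1" by (simp add: cong8_def)
      then have "cong8 p (rep8 p x ^ ?h) 1" using cong8_power[OF cong8_sym[OF cong8_rep8]] cong8_trans by blast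
      then have "rep8 p x \<in> ?S" unfolding SR using rep8_in by (simp add: cong8_def)
      then show False using False cong8_trans[OF _ cong8_sym[OF cong8_rep8]] by blast
    qed
    ultimately have "cong8 p (x ^ ?h) (-1)" by (simp add: cong8_def)
    moreover have "qr x = -1" using False assms by (simp add: qr_def)
    ultimately show ?thesis using cong8_sym by simp
  qed
qed

lemma qr_unit: "\<not> p dvd x \<Longrightarrow> qr x = 1 \<or> qr x = -1" by (simp add: qr_def)

lemma qr_mult: "qr (x * y) = qr x * qr y"
proof (cases "p dvd x \<or> p dvd y")
  case True then show ?thesis by (auto simp: qr_def)
next
  case False
  then have u: "\<not> p dvd x" "\<not> p dvd y" "\<not> p dvd x * y" using dvd_mult_iff by auto
  show ?thesis
  proof (rule fourth_root_unique)
    show "qr (x * y) ^ 4 = 1" "(qr x * qr y) ^ 4 = 1" using qr_unit u by (metis minus_one_power_iff even_numeral power_one mult_minus1 mult_minus1_right mult_1 minus_minus)+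
    show "cong8 p (qr (x * y)) (qr x * qr y)"
      using euler_criterion[OF u(3)] cong8_mult[OF euler_criterion[OF u(1)] euler_criterion[OF u(2)]]
      unfolding power_mult_distrib by (meson cong8_sym cong8_trans)
  qed
qed

lemma qr_square: "\<not> p dvd x \<Longrightarrow> qr x * qr x = 1"
  using qr_unit[of x] by auto

lemma qr_of_square: "\<not> p dvd s \<Longrightarrow> qr (s ^ 2) = 1"
  using qr_square qr_mult by (simp add: power2_eq_square)

lemma quartic_char_square: assumes "\<not> p dvd x" shows "quartic_char x ^ 2 = qr x"
proof (rule fourth_root_unique)
  note s = quartic_char_spec[OF assms]
  have "(quartic_char x ^ 2) ^ 4 = (quartic_char x ^ 4) ^ 2" by (simp flip: power_mult)
  then show "(quartic_char x ^ 2) ^ 4 = 1" using s by simp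
  show "qr x ^ 4 = 1" using qr_unit[OF assms] by auto
  have "cong8 p (quartic_char x ^ 2) ((x ^ ((absnorm8 p - 1) div 4)) ^ 2)" using s by (intro cong8_power) auto
  also have "(x ^ ((absnorm8 p - 1) div 4)) ^ 2 = x ^ ((absnorm8 p - 1) div 2)"
    using half_absnorm by (metis mult.commute power_mult)
  finally show "cong8 p (quartic_char x ^ 2) (qr x)" using cong8_trans cong8_sym euler_criterion[OF assms] by blast
qed

text \<open>Squares of squares and squares of nonsquares are told apart by the quartic symbol; this links it to the quadratic
character of the root.\<close>
lemma quartic_char_of_square: assumes "\<not> p dvd x" shows "quartic_char (x ^ 2) = qr x"
proof (rule quartic_char_unique)
  show "\<not> p dvd x ^ 2" using assms by (simp add: dvd_power_iff)
  show "qr x ^ 4 = 1" using qr_unit[OF assms] by auto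
  show "cong8 p (qr x) ((x ^ 2) ^ ((absnorm8 p - 1) div 4))"
    using euler_criterion[OF assms] half_absnorm by (metis power_mult)
qed

lemma sum_squares:
  assumes "\<And>x y. cong8 p x y \<Longrightarrow> G x = G y"
  shows "(\<Sum>z\<in>reps8 p. G (z ^ 2)) = (\<Sum>y\<in>reps8 p. (1 + to_complex (qr y)) * G y)"
  using sum_fibres[where G = G and g = "\<lambda>z. z ^ 2", OF p_nz finite_reps assms] by (simp add: card_square_roots)

text \<open>This is \<open>u + 1/u - 2\<close>, the argument of the Kloosterman sum after completing the square.\<close>
abbreviation trace_shift :: "zeta8 \<Rightarrow> zeta8" where "trace_shift u \<equiv> (u - 1) ^ 2 * inv_mod p u"

text \<open>The solutions of \<open>(u - 1)\<^sup>2 = y u\<close> correspond by \<open>t = 2u - (y + 2)\<close> to the square roots of the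
discriminant \<open>y\<^sup>2 + 4y\<close>; none of them is zero since the product of the two roots is \<open>1\<close>.\<close>
lemma card_trace_fibre:
  "card {u \<in> {u \<in> reps8 p. coprime u p}. cong8 p (trace_shift u) y} = card {t \<in> reps8 p. cong8 p (t ^ 2) (y ^ 2 + 4 * y)}"
proof -
  have two: "coprime 2 p" using odd coprime_iff by blast
  have four: "coprime 4 p" using coprime_mult_left_iff[of 2 2 p] two by simp
  have "{u \<in> {u \<in> reps8 p. coprime u p}. cong8 p (trace_shift u) y} = {u \<in> reps8 p. cong8 p ((u - 1) ^ 2) (y * u)}"
  proof -
    have "coprime u p \<and> cong8 p (trace_shift u) y \<longleftrightarrow> cong8 p ((u - 1) ^ 2) (y * u)" for u
    proof
      assume a: "coprime u p \<and> cong8 p (trace_shift u) y"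
      then have "cong8 p (trace_shift u * u) (y * u)" by (intro cong8_mult) auto
      moreover have "cong8 p ((u - 1) ^ 2 * (u * inv_mod p u)) ((u - 1) ^ 2 * 1)" using a by (intro cong8_mult inv_mod) auto
      ultimately show "cong8 p ((u - 1) ^ 2) (y * u)" by (metis cong8_sym cong8_trans mult.assoc mult.commute mult.right_neutral)
    next
      assume a: "cong8 p ((u - 1) ^ 2) (y * u)"
      have "\<not> p dvd u"
      proof
        assume "p dvd u"
        then have "p dvd (u - 1) ^ 2" using dvd_cong[OF a] by simp
        then have "p dvd u - 1" by (simp add: dvd_power_iff)
        with \<open>p dvd u\<close> have "p dvd u - (u - 1)" by (rule dvd_diff)
        moreover have "u - (u - 1) = 1" by simp
        ultimately show False using p_nonunit by metis
      qed
      then have u: "coprime u p" using coprime_iff by blast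
      have "cong8 p (trace_shift u) (y * u * inv_mod p u)" by (intro cong8_mult a) simp
      also have "y * u * inv_mod p u = y * (u * inv_mod p u)" by (simp add: mult.assoc)
      also have "cong8 p \<dots> (y * 1)" by (intro cong8_mult inv_mod u) simp
      finally show "coprime u p \<and> cong8 p (trace_shift u) y" using u by simp
    qed
    then show ?thesis by auto
  qed
  moreover have "bij_betw (\<lambda>u. rep8 p (2 * u - (y + 2))) {u \<in> reps8 p. cong8 p ((u - 1) ^ 2) (y * u)} {t \<in> reps8 p. cong8 p (t ^ 2) (y ^ 2 + 4 * y)}"
  proof (rule bij_betw_reps8)
    have key: "cong8 p ((u - 1) ^ 2) (y * u) \<longleftrightarrow> cong8 p ((2 * u - (y + 2)) ^ 2) (y ^ 2 + 4 * y)" for u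
    proof -
      have "(2 * u - (y + 2)) ^ 2 - (y ^ 2 + 4 * y) = 4 * ((u - 1) ^ 2 - y * u)" by algebra
      then show ?thesis using four coprime_iff dvd_mult_iff unfolding cong8_def by metis
    qed
    then show "cong8 p ((u - 1) ^ 2) (y * u) \<Longrightarrow> cong8 p ((2 * u - (y + 2)) ^ 2) (y ^ 2 + 4 * y)" for u by blast
    have gc: "cong8 p (2 * u - (y + 2)) (2 * v - (y + 2)) \<longleftrightarrow> cong8 p u v" for u v
      using cong8_mult_left_iff[OF two, of u v] by (simp add: cong8_def)
    then show "cong8 p (2 * u - (y + 2)) (2 * v - (y + 2)) \<longleftrightarrow> cong8 p u v" for u v .
    show Q: "cong8 p (s ^ 2) (y ^ 2 + 4 * y) \<Longrightarrow> cong8 p s t \<Longrightarrow> cong8 p (t ^ 2) (y ^ 2 + 4 * y)" for s t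
      using cong8_power[of p s t 2] cong8_sym cong8_trans by blast
    show "cong8 p ((u - 1) ^ 2) (y * u) \<Longrightarrow> cong8 p u v \<Longrightarrow> cong8 p ((v - 1) ^ 2) (y * v)" for u v
      unfolding key using Q gc by blast
    show "\<exists>u. cong8 p ((u - 1) ^ 2) (y * u) \<and> cong8 p (2 * u - (y + 2)) t" if t: "cong8 p (t ^ 2) (y ^ 2 + 4 * y)" for t
    proof -
      define u where "u = inv_mod p 2 * (t + (y + 2))"
      have "cong8 p (2 * inv_mod p 2 * (t + (y + 2)) - (y + 2)) (1 * (t + (y + 2)) - (y + 2))"
        by (intro cong8_diff cong8_mult inv_mod two) auto
      then have ut: "cong8 p (2 * u - (y + 2)) t" unfolding u_def by (simp add: mult.assoc)
      then show ?thesis using Q[OF t cong8_sym[OF ut]] key by blast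
    qed
  qed
  then have "card {u \<in> reps8 p. cong8 p ((u - 1) ^ 2) (y * u)} = card {t \<in> reps8 p. cong8 p (t ^ 2) (y ^ 2 + 4 * y)}"
    by (rule bij_betw_same_card)
  ultimately show ?thesis by (simp only:)
qed

lemma sum_trace:
  assumes "\<And>x y. cong8 p x y \<Longrightarrow> G x = G y"
  shows "(\<Sum>u | u \<in> reps8 p \<and> coprime u p. G (trace_shift u)) = (\<Sum>y\<in>reps8 p. (1 + to_complex (qr (y ^ 2 + 4 * y))) * G y)"
proof -
  have "finite {u \<in> reps8 p. coprime u p}" by simp
  from sum_fibres[where G = G and g = trace_shift, OF p_nz this assms] show ?thesis unfolding card_trace_fibre card_square_roots by simp
qed

lemma trace_shift_cong: "coprime u p \<Longrightarrow> cong8 p u v \<Longrightarrow> cong8 p (trace_shift u) (trace_shift v)"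
  by (intro cong8_mult cong8_power cong8_diff inv_mod_cong) auto

lemma trace_shift_inverse: assumes "coprime u p" shows "cong8 p (trace_shift (inv_mod p u)) (trace_shift u)"
proof -
  let ?v = "inv_mod p u"
  have ii: "cong8 p (inv_mod p ?v) u"
    using inv_mod_unique[of p ?v u] inv_mod[OF assms] by (simp add: mult.commute)
  have "cong8 p (trace_shift ?v) ((?v - 1) ^ 2 * u)" by (intro cong8_mult ii) simp
  also have "cong8 p ((?v - 1) ^ 2 * u) (trace_shift u)"
  proof -
    have "(?v - 1) ^ 2 * u - trace_shift u = (u * ?v - 1) * (?v - u)" by algebra
    then show ?thesis using inv_mod[OF assms] unfolding cong8_def by simp
  qed
  finally show ?thesis .
qed

lemma trace_shift_square: assumes "coprime u p" shows "cong8 p (trace_shift (u ^ 2)) (trace_shift u ^ 2 + 4 * trace_shift u)"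
proof -
  let ?v = "inv_mod p u"
  have "cong8 p ((u * ?v) ^ 2) (1 ^ 2)" by (intro cong8_power inv_mod assms)
  then have "cong8 p (u ^ 2 * ?v ^ 2) 1" by (simp add: power_mult_distrib)
  then have ii: "cong8 p (inv_mod p (u ^ 2)) (?v ^ 2)" by (rule inv_mod_unique)
  have "cong8 p (trace_shift (u ^ 2)) ((u ^ 2 - 1) ^ 2 * ?v ^ 2)" by (intro cong8_mult ii) simp
  also have "cong8 p ((u ^ 2 - 1) ^ 2 * ?v ^ 2) (trace_shift u ^ 2 + 4 * trace_shift u)"
  proof -
    have "(u ^ 2 - 1) ^ 2 * ?v ^ 2 - (trace_shift u ^ 2 + 4 * trace_shift u) = (u * ?v - 1) * (4 * (u - 1) ^ 2 * ?v)" by algebra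
    then show ?thesis using inv_mod[OF assms] unfolding cong8_def by simp
  qed
  finally show ?thesis .
qed

text \<open>Both sides reduce to \<open>K = \<Sum> \<psi>(y) F(y\<^sup>2 + 4y)\<close>: the quartic sum exceeds the quadratic one by \<open>K\<close>, and twice the
Kloosterman sum is \<open>2 K\<close>. Only the periodicity of \<open>F\<close> enters, so the identity is one between weighted numbers of
representations of each residue.\<close>
lemma prime_sum_identity:
  fixes F :: "zeta8 \<Rightarrow> complex"
  assumes F: "\<And>x y. cong8 p x y \<Longrightarrow> F x = F y"
  shows "(\<Sum>z\<in>reps8 p. F (z ^ 4 + 4 * z ^ 2)) = (\<Sum>z\<in>reps8 p. F (z ^ 2 - 4)) + 
    (\<Sum>x | x \<in> reps8 p \<and> coprime x p. to_complex (quartic_char x) * F (trace_shift x))"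
proof -
  define psi where "psi x = to_complex (qr x)" for x
  define chi where "chi x = to_complex (quartic_char x)" for x
  define K where "K = (\<Sum>y\<in>reps8 p. psi y * F (y ^ 2 + 4 * y))"
  define E where "E = (\<Sum>x | x \<in> reps8 p \<and> coprime x p. chi x * F (trace_shift x))"
  have psi_cong: "cong8 p x y \<Longrightarrow> psi x = psi y" and chi_cong: "cong8 p x y \<Longrightarrow> chi x = chi y" for x y
    unfolding psi_def chi_def using qr_cong quartic_char_cong by metis+
  have psi_mult: "psi (x * y) = psi x * psi y" for x y unfolding psi_def qr_mult by simp
  have psi_sq: "psi x * psi x = 1" if "\<not> p dvd x" for x
    using qr_square[OF that] unfolding psi_def by (metis to_complex_simps(2,6))
  have psi_0: "psi x = 0" if "p dvd x" for x using that by (simp add: psi_def qr_def)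
  have psi_1: "psi 1 = 1" using psi_sq[of 1] psi_mult[of 1 1] p_nonunit by simp
  have F2: "cong8 p x y \<Longrightarrow> F (x ^ 2 + 4 * x) = F (y ^ 2 + 4 * y)" for x y
    by (intro F cong8_add cong8_power cong8_mult) auto
  have L: "(\<Sum>z\<in>reps8 p. F (z ^ 4 + 4 * z ^ 2)) = (\<Sum>z\<in>reps8 p. F (z ^ 2 - 4)) + K"
  proof -
    have "(\<Sum>z\<in>reps8 p. F ((z ^ 2) ^ 2 + 4 * z ^ 2)) = (\<Sum>y\<in>reps8 p. (1 + psi y) * F (y ^ 2 + 4 * y))"
      unfolding psi_def by (rule sum_squares) (rule F2)
    also have "\<dots> = (\<Sum>y\<in>reps8 p. F (y ^ 2 + 4 * y)) + K"
      unfolding K_def by (simp add: distrib_right sum.distrib)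
    also have "(\<Sum>y\<in>reps8 p. F (y ^ 2 + 4 * y)) = (\<Sum>y\<in>reps8 p. F ((y + 2) ^ 2 - 4))"
      by (intro sum.cong arg_cong[of _ _ F] refl) algebra
    also have "\<dots> = (\<Sum>y\<in>reps8 p. F (y ^ 2 - 4))"
      by (rule sum_reps8_shift) (intro F cong8_diff cong8_power, auto)
    finally show ?thesis by (simp flip: power_mult)
  qed
  \<comment> \<open>The symbol at the inverse is the cube of the symbol at \<open>x\<close>, whose square is the quadratic character.\<close>
  have chi_inv: "chi (inv_mod p x) = chi x * psi x" if "coprime x p" for x
  proof -
    have x: "\<not> p dvd x" using that coprime_iff by blast
    have "chi (x * inv_mod p x) = chi 1" by (rule chi_cong[OF inv_mod[OF that]])
    then have 1: "chi x * chi (inv_mod p x) = 1" unfolding chi_def quartic_char_mult by (simp add: quartic_char_1)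
    have 2: "chi x ^ 2 = psi x" unfolding chi_def psi_def using quartic_char_square[OF x] by (metis to_complex_power)
    have "chi x * psi x * (chi x * chi (inv_mod p x)) = psi x * chi x ^ 2 * chi (inv_mod p x)"
      by (simp add: power2_eq_square mult_ac)
    then show ?thesis using 1 2 psi_sq[OF x] by simp
  qed
  have "E = (\<Sum>x | x \<in> reps8 p \<and> coprime x p. chi (inv_mod p x) * F (trace_shift (inv_mod p x)))"
    unfolding E_def
  proof (rule sum_reps8_inverse[symmetric])
    fix x y assume "coprime x p" "cong8 p x y"
    then show "chi x * F (trace_shift x) = chi y * F (trace_shift y)" using chi_cong F[OF trace_shift_cong] by metis
  qed
  also have "\<dots> = (\<Sum>x | x \<in> reps8 p \<and> coprime x p. chi x * psi x * F (trace_shift x))"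
    using chi_inv F[OF trace_shift_inverse] by (intro sum.cong) auto
  finally have "2 * E = (\<Sum>x | x \<in> reps8 p \<and> coprime x p. (1 + psi x) * (chi x * F (trace_shift x)))"
    unfolding E_def by (simp add: algebra_simps sum.distrib)
  \<comment> \<open>The factor \<open>1 + \<psi>(x)\<close> removes the nonsquares and counts each square once for each root \<open>u\<close>.\<close>
  also have "\<dots> = (\<Sum>x\<in>reps8 p. (1 + psi x) * (if coprime x p then chi x * F (trace_shift x) else 0))"
    by (subst sum.inter_filter) (auto intro!: sum.cong)
  also have "\<dots> = (\<Sum>u\<in>reps8 p. if coprime (u ^ 2) p then chi (u ^ 2) * F (trace_shift (u ^ 2)) else 0)"
    unfolding psi_def
  proof (rule sum_squares[symmetric])
    fix x y assume "cong8 p x y"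
    then show "(if coprime x p then chi x * F (trace_shift x) else 0) = (if coprime y p then chi y * F (trace_shift y) else 0)"
      using chi_cong F[OF trace_shift_cong] coprime_cong8_cong by metis
  qed
  also have "\<dots> = (\<Sum>u | u \<in> reps8 p \<and> coprime u p. chi (u ^ 2) * F (trace_shift (u ^ 2)))"
    by (subst sum.inter_filter) (auto intro!: sum.cong)
  \<comment> \<open>\<open>\<psi>(u)\<close> is a function of \<open>y = (u - 1)\<^sup>2 / u\<close>: it is \<open>\<psi>(y)\<close> unless \<open>u = 1\<close>, where \<open>y = 0\<close> and the value is \<open>1\<close>.\<close>
  also have "\<dots> = (\<Sum>u | u \<in> reps8 p \<and> coprime u p. (if p dvd trace_shift u then 1 else psi (trace_shift u)) * F (trace_shift u ^ 2 + 4 * trace_shift u))"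
  proof (intro sum.cong refl)
    fix u assume "u \<in> {u \<in> reps8 p. coprime u p}"
    then have u: "coprime u p" "\<not> p dvd u" using coprime_iff by auto
    then have v: "\<not> p dvd inv_mod p u" using inv_mod_coprime coprime_iff by blast
    have "psi (u * inv_mod p u) = psi 1" by (rule psi_cong[OF inv_mod[OF u(1)]])
    then have uv: "psi u * psi (inv_mod p u) = 1" by (simp add: psi_mult psi_1)
    have "psi u = (if p dvd trace_shift u then 1 else psi (trace_shift u))"
    proof (cases "p dvd trace_shift u")
      case True
      then have "p dvd u - 1" using v dvd_mult_iff dvd_power_iff[of 2 "u - 1"] by simp
      then show ?thesis using True psi_cong[of u 1] psi_1 by (simp add: cong8_def)
    next
      case False
      then have "\<not> p dvd u - 1" by (simp add: dvd_mult_iff dvd_power_iff)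
      then have "psi (trace_shift u) = psi (inv_mod p u)" by (simp add: psi_mult power2_eq_square psi_sq)
      also have "\<dots> = psi u" using psi_sq[OF v] uv psi_sq[OF u(2)] by (metis mult.assoc mult_1 mult.right_neutral)
      finally show ?thesis using False by simp
    qed
    moreover have "chi (u ^ 2) = psi u" unfolding chi_def psi_def quartic_char_of_square[OF u(2)] ..
    moreover have "F (trace_shift (u ^ 2)) = F (trace_shift u ^ 2 + 4 * trace_shift u)" by (rule F[OF trace_shift_square[OF u(1)]])
    ultimately show "chi (u ^ 2) * F (trace_shift (u ^ 2)) = (if p dvd trace_shift u then 1 else psi (trace_shift u)) * F (trace_shift u ^ 2 + 4 * trace_shift u)" by simp
  qed
  also have "\<dots> = (\<Sum>y\<in>reps8 p. (1 + to_complex (qr (y ^ 2 + 4 * y))) * ((if p dvd y then 1 else psi y) * F (y ^ 2 + 4 * y)))"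
  proof (rule sum_trace)
    fix x y assume "cong8 p x y"
    then show "(if p dvd x then 1 else psi x) * F (x ^ 2 + 4 * x) = (if p dvd y then 1 else psi y) * F (y ^ 2 + 4 * y)"
      using F2 psi_cong dvd_cong by simp
  qed
  \<comment> \<open>The exceptional value at \<open>y = 0\<close> supplies exactly the missing term \<open>\<psi>(4) F(0)\<close>.\<close>
  also have "\<dots> = (\<Sum>y\<in>reps8 p. (psi y + psi (y + 4)) * F (y ^ 2 + 4 * y))"
  proof (intro sum.cong refl)
    fix y :: zeta8
    have e: "y ^ 2 + 4 * y = y * (y + 4)" by algebra
    have "to_complex (qr (y ^ 2 + 4 * y)) = psi y * psi (y + 4)" unfolding e psi_def[symmetric] psi_mult ..
    moreover have "(1 + psi y * psi (y + 4)) * (if p dvd y then 1 else psi y) = psi y + psi (y + 4)"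
    proof (cases "p dvd y")
      case True
      then have "psi (y + 4) = psi (2 ^ 2)" by (intro psi_cong) (simp add: cong8_def)
      also have "\<dots> = 1" using qr_of_square[OF odd] unfolding psi_def by simp
      finally show ?thesis using True psi_0 by simp
    next
      case False
      have "(1 + psi y * psi (y + 4)) * psi y = psi y + psi y * psi y * psi (y + 4)" by (simp add: algebra_simps)
      then show ?thesis using False psi_sq by simp
    qed
    ultimately show "(1 + to_complex (qr (y ^ 2 + 4 * y))) * ((if p dvd y then 1 else psi y) * F (y ^ 2 + 4 * y)) =
        (psi y + psi (y + 4)) * F (y ^ 2 + 4 * y)" by (metis mult.assoc)
  qed
  also have "\<dots> = K + (\<Sum>y\<in>reps8 p. psi (y + 4) * F (y ^ 2 + 4 * y))"
    unfolding K_def by (simp add: distrib_right sum.distrib)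
  also have "(\<Sum>y\<in>reps8 p. psi (y + 4) * F (y ^ 2 + 4 * y)) = K"
  proof -
    \<comment> \<open>The reflection \<open>y \<mapsto> - 4 - y\<close> fixes \<open>y\<^sup>2 + 4y\<close>, and \<open>-1\<close> is a square.\<close>
    have i: "\<not> p dvd i8" using not_dvd_w8 unfolding i8_def by (simp add: dvd_power_iff)
    have "psi (y + 4) * F (y ^ 2 + 4 * y) = psi (-1 * y + (-4)) * F ((-1 * y + (-4)) ^ 2 + 4 * (-1 * y + (-4)))" for y
    proof -
      have "-1 * y + (-4) = i8 ^ 2 * (y + 4)" unfolding i8_2 by simp
      then have "psi (-1 * y + (-4)) = psi (i8 ^ 2) * psi (y + 4)" by (simp only: psi_mult)
      moreover have "psi (i8 ^ 2) = 1" unfolding psi_def qr_of_square[OF i] by simp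
      moreover have "(-1 * y + (-4)) ^ 2 + 4 * (-1 * y + (-4)) = y ^ 2 + 4 * y" by algebra
      ultimately show ?thesis by (simp only: mult_1)
    qed
    then have "(\<Sum>y\<in>reps8 p. psi (y + 4) * F (y ^ 2 + 4 * y)) = 
      (\<Sum>y\<in>reps8 p. psi (-1 * y + (-4)) * F ((-1 * y + (-4)) ^ 2 + 4 * (-1 * y + (-4))))" by simp
    also have "\<dots> = K" unfolding K_def
    proof (rule sum_reps8_affine)
      show "coprime (-1) p" by simp
      show "psi x * F (x ^ 2 + 4 * x) = psi y * F (y ^ 2 + 4 * y)" if "cong8 p x y" for x y
        using psi_cong[OF that] F2[OF that] by simp
    qed
    finally show ?thesis .
  qed
  finally have "E = K" by simp
  then show ?thesis unfolding L E_def chi_def by simp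
qed

end

section \<open>The identity modulo a prime power\<close>
lemma residue_symbol_prime_elem: "prime_elem p \<Longrightarrow> residue_symbol k x p = to_complex (residue_symbol_prime k x p)"
proof -
  assume p: "prime_elem p"
  then have "prime_factorization p = {#normalize p#}"
    by (subst prime_factorization_normalize[symmetric], intro prime_factorization_prime) simp
  moreover have "p \<noteq> 0" using p by auto
  moreover have "residue_symbol_prime k x (normalize p) = residue_symbol_prime k x p"
    by (rule residue_symbol_prime_assoc) auto
  ultimately show ?thesis by (simp add: residue_symbol_eq)
qed

lemma residue_symbol_power: "c \<noteq> 0 \<Longrightarrow> residue_symbol k x (c ^ n) = residue_symbol k x c ^ n"
  by (induction n) (simp_all add: residue_symbol_unit residue_symbol_mult)

context fraction_character
begin

definition quartic_sum :: "zeta8 \<Rightarrow> zeta8 \<Rightarrow> complex" where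
  "quartic_sum D c = (\<Sum>z\<in>reps8 c. ef (D * (z ^ 4 + 4 * z ^ 2)) c)"

definition quadratic_sum :: "zeta8 \<Rightarrow> zeta8 \<Rightarrow> complex" where
  "quadratic_sum D c = (\<Sum>z\<in>reps8 c. ef (D * (z ^ 2 - 4)) c)"

definition kloosterman_sum :: "zeta8 \<Rightarrow> zeta8 \<Rightarrow> complex" where
  "kloosterman_sum D c = (\<Sum>x | x \<in> reps8 c \<and> coprime x c. residue_symbol 4 x c * ef (D * ((x - 1) ^ 2 * inv_mod c x)) c)"

end

locale odd_prime_character = odd_prime8 + fraction_character
begin

lemma quartic_sum_prime: "quartic_sum D p = quadratic_sum D p + kloosterman_sum D p"
proof -
  have "ef (D * x) p = ef (D * y) p" if "cong8 p x y" for x y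
    using that by (intro ef_cong p_nz cong8_mult) auto
  from prime_sum_identity[of "\<lambda>v. ef (D * v) p", OF this]
  show ?thesis unfolding quartic_sum_def quadratic_sum_def kloosterman_sum_def residue_symbol_prime_elem[OF prime] quartic_char_def .
qed

text \<open>Averaging over the shifts of \<open>z\<close> by multiples of \<open>h\<close>, where \<open>p h\<close> is the modulus, annihilates every \<open>z\<close> at which
the derivative \<open>G\<close> of the phase does not vanish modulo \<open>p\<close>.\<close>
lemma stationary_phase:
  assumes "h \<noteq> 0" "p dvd h"
    and P: "\<And>z z'. P z \<Longrightarrow> cong8 p z z' \<Longrightarrow> P z'"
    and F: "\<And>z z'. P z \<Longrightarrow> cong8 (p * h) z z' \<Longrightarrow> F z = F z'"
    and shift: "\<And>z u. P z \<Longrightarrow> F (z + h * u) = F z * ef (G z * u) p"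
  shows "(\<Sum>z | z \<in> reps8 (p * h) \<and> P z. F z) = (\<Sum>z | z \<in> reps8 (p * h) \<and> P z \<and> p dvd G z. F z)"
proof -
  let ?A = "{z \<in> reps8 (p * h). P z}" and ?N = "of_nat (card (reps8 p)) :: complex"
  have fin: "finite ?A" using finite_reps8[of "p * h"] p_nz assms(1) by simp
  have sh: "(\<Sum>z\<in>?A. F (z + h * u)) = (\<Sum>z\<in>?A. F z)" for u
  proof (rule sum_reps8_reindex[symmetric])
    show "P z \<Longrightarrow> cong8 (p * h) z z' \<Longrightarrow> P z'" for z z' using P cong8_dvd_mod[of "p * h" z z' p] by auto
    then show "P z \<Longrightarrow> cong8 (p * h) z z' \<Longrightarrow> P z'" for z z' .
    show 1: "P z \<Longrightarrow> P (z + h * u)" for z using P[of z "z + h * u"] assms(2) by (simp add: cong8_def)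
    show "cong8 (p * h) (x + h * u) (y + h * u) \<longleftrightarrow> cong8 (p * h) x y" for x y by (simp add: cong8_def)
    show "\<exists>x. P x \<and> cong8 (p * h) (x + h * u) y" if "P y" for y
      using P[of y "y - h * u"] that assms(2) by (intro exI[of _ "y - h * u"]) (simp add: cong8_def)
  qed (rule F)
  have "?N * (\<Sum>z\<in>?A. F z) = (\<Sum>u\<in>reps8 p. \<Sum>z\<in>?A. F (z + h * u))"
    unfolding sh by simp
  also have "\<dots> = (\<Sum>u\<in>reps8 p. \<Sum>z\<in>?A. F z * ef (G z * u) p)"
    using shift by (intro sum.cong) auto
  also have "\<dots> = (\<Sum>z\<in>?A. F z * (\<Sum>u\<in>reps8 p. ef (G z * u) p))"
    by (subst sum.swap) (simp add: sum_distrib_left)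
  also have "\<dots> = (\<Sum>z\<in>?A. if p dvd G z then ?N * F z else 0)"
    unfolding ef_sum_prime[OF prime] by (intro sum.cong) auto
  also have "\<dots> = (\<Sum>z | z \<in> ?A \<and> p dvd G z. ?N * F z)"
    by (rule sum.inter_filter[symmetric, OF fin])
  also have "\<dots> = ?N * (\<Sum>z | z \<in> reps8 (p * h) \<and> P z \<and> p dvd G z. F z)"
    by (simp add: sum_distrib_left conj_assoc)
  finally show ?thesis using rep8_in[of p 0] by (auto simp: card_eq_0_iff)
qed

text \<open>A substitution between neighbourhoods of \<open>a\<close> and \<open>b\<close> modulo \<open>p\<close>. All neighbourhoods have the same number of classes modulo
\<open>q\<close>, so injectivity suffices and no lifting of roots is needed.\<close>
lemma sum_near_reindex:
  assumes q: "q \<noteq> 0" "p dvd q"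
    and g: "\<And>x. cong8 p x a \<Longrightarrow> cong8 p (g x) b"
    and g_cong: "\<And>x y. cong8 p x a \<Longrightarrow> cong8 p y a \<Longrightarrow> cong8 q (g x) (g y) \<longleftrightarrow> cong8 q x y"
    and f: "\<And>x y. cong8 p x b \<Longrightarrow> cong8 q x y \<Longrightarrow> f x = f y"
  shows "(\<Sum>y | y \<in> reps8 q \<and> cong8 p y b. f y) = (\<Sum>x | x \<in> reps8 q \<and> cong8 p x a. f (g x))"
proof -
  let ?A = "{x \<in> reps8 q. cong8 p x a}" and ?B = "{x \<in> reps8 q. cong8 p x b}" and ?T = "\<lambda>x. rep8 q (g x)"
  have per: "cong8 p x t \<Longrightarrow> cong8 q x y \<Longrightarrow> cong8 p y t" for x y t
    using cong8_dvd_mod[OF _ q(2)] cong8_sym cong8_trans by blast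
  have "bij_betw (\<lambda>x. rep8 q (x + (b - a))) ?A ?B"
  proof (rule bij_betw_reps8)
    show "\<exists>x. cong8 p x a \<and> cong8 q (x + (b - a)) y" if "cong8 p y b" for y
      using that by (intro exI[of _ "y - (b - a)"]) (simp add: cong8_def algebra_simps)
  qed (rule per, assumption+, rule per, assumption+, simp_all add: cong8_def algebra_simps)
  then have card: "card ?A = card ?B" by (rule bij_betw_same_card)
  have fin: "finite ?B" using finite_reps8[OF q(1)] by simp
  have inj: "inj_on ?T ?A"
    by (rule inj_onI) (auto simp: rep8_eq_iff g_cong intro: reps8_eqI)
  have "?T ` ?A \<subseteq> ?B" using rep8_in per[OF g cong8_rep8] by blast
  then have "?T ` ?A = ?B" using card_image[OF inj] card by (intro card_subset_eq fin) auto
  then have "(\<Sum>y\<in>?B. f y) = (\<Sum>x\<in>?A. f (?T x))" using sum.reindex[OF inj, of f] by simp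
  also have "\<dots> = (\<Sum>x\<in>?A. f (g x))" using f[OF g cong8_rep8] by (intro sum.cong) auto
  finally show ?thesis .
qed

text \<open>This is \<open>i sqrt 2\<close>.\<close>
definition sqrt_m2 :: zeta8 where "sqrt_m2 = w8 + w8 ^ 3"

lemma sqrt_m2_square: "sqrt_m2 ^ 2 = - 2" 
proof -
  have "sqrt_m2 ^ 2 = -2 + (w8 ^ 4 + 1) * (w8 ^ 2 + 2)" unfolding sqrt_m2_def by algebra
  then show ?thesis by (simp add: w8_4)
qed

lemma not_dvd_sqrt_m2: "\<not> p dvd sqrt_m2"
proof
  assume "p dvd sqrt_m2" then have "p dvd sqrt_m2 ^ 2" by (simp add: dvd_power_iff)
  then show False using odd unfolding sqrt_m2_square by simp
qed

lemma not_dvd_4: "\<not> p dvd 4" using dvd_power_iff[of 2 2] odd by simp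

lemma sum_filter_disj:
  assumes "finite A" "\<And>x. \<not> (P x \<and> Q x)"
  shows "(\<Sum>x | x \<in> A \<and> (P x \<or> Q x). f x) = (\<Sum>x | x \<in> A \<and> P x. f x) + (\<Sum>x | x \<in> A \<and> Q x. f x)"
proof -
  have "{x. x \<in> A \<and> (P x \<or> Q x)} = {x. x \<in> A \<and> P x} \<union> {x. x \<in> A \<and> Q x}" by auto
  then show ?thesis using assms by (auto intro: sum.union_disjoint)
qed

text \<open>For \<open>k > 1\<close> the three sums are localised at their critical points and the resulting pieces matched by the
substitutions \<open>w = z\<^sup>2 + 2\<close>, \<open>z = y - 1/y\<close> with \<open>x = y\<^sup>4\<close>, and \<open>w = i (y - 1/y)\<close> with \<open>x = - y\<^sup>2\<close>. The quartic
symbol takes the value \<open>1\<close> at every point involved, so its multiplicity \<open>k\<close> does not influence the result.\<close>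
lemma quartic_sum_prime_power:
  assumes D: "\<not> p dvd D" and k: "k > 0" shows "quartic_sum D (p ^ k) = quadratic_sum D (p ^ k) + kloosterman_sum D (p ^ k)"
proof (cases "k = 1")
  case True
  then show ?thesis using quartic_sum_prime by simp
next
  case False
  define h where "h = p ^ (k - 1)"
  define q where "q = p * h"
  have pk: "p ^ k = q" unfolding q_def h_def using k by (cases k) auto
  have h: "h \<noteq> 0" "p dvd h" unfolding h_def using p_nz k False by (auto intro!: dvd_power)
  have q: "q \<noteq> 0" "p dvd q" unfolding q_def using h p_nz by auto
  have hh: "q dvd h * h * X" for X unfolding q_def using h by (intro dvd_mult2 mult_dvd_mono) auto
  have cop: "coprime x q \<longleftrightarrow> \<not> p dvd x" for x
    unfolding pk[symmetric] using coprime_iff k by (simp add: coprime_power_right_iff)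
  have modp: "cong8 q x y \<Longrightarrow> cong8 p x y" for x y using cong8_dvd_mod q by blast
  have fin: "finite (reps8 q)" by (rule finite_reps8[OF q(1)])
  define chi where "chi x = to_complex (quartic_char x) ^ k" for x
  have chi: "residue_symbol 4 x q = chi x" for x
    unfolding pk[symmetric] residue_symbol_power[OF p_nz] residue_symbol_prime_elem[OF prime] chi_def quartic_char_def ..
  have chi_cong: "cong8 p x y \<Longrightarrow> chi x = chi y" for x y unfolding chi_def using quartic_char_cong by metis
  define FL where "FL z = ef (D * (z ^ 4 + 4 * z ^ 2)) q" for z
  define FQ where "FQ z = ef (D * (z ^ 2 - 4)) q" for z
  define FE where "FE x = chi x * ef (D * ((x - 1) ^ 2 * inv_mod q x)) q" for x
  \<comment> \<open>The part of a sum modulo \<open>q\<close> near the residue \<open>a\<close> modulo \<open>p\<close>.\<close>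
  define S where "S a f = (\<Sum>z | z \<in> reps8 q \<and> cong8 p z a. f z :: complex)" for a f
  have FL_cong: "cong8 q x y \<Longrightarrow> FL x = FL y" for x y
    unfolding FL_def by (intro ef_cong q cong8_mult cong8_add cong8_power) auto
  have FQ_cong: "cong8 q x y \<Longrightarrow> FQ x = FQ y" for x y
    unfolding FQ_def by (intro ef_cong q cong8_mult cong8_diff cong8_power) auto
  have FE_cong: "coprime x q \<Longrightarrow> cong8 q x y \<Longrightarrow> FE x = FE y" for x y
    unfolding FE_def using chi_cong[OF modp]
    by (intro arg_cong2[of _ _ _ _ "(*)"] ef_cong q cong8_mult cong8_diff cong8_power inv_mod_cong) auto
  have efh: "ef (h * a) q = ef a p" for a
    using ef_cancel[OF h(1), of a p] unfolding q_def by (simp add: mult.commute)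

  have "quartic_sum D q = (\<Sum>z | z \<in> reps8 q \<and> True. FL z)" unfolding quartic_sum_def FL_def by simp
  also have "\<dots> = (\<Sum>z | z \<in> reps8 q \<and> True \<and> p dvd D * (4 * z ^ 3 + 8 * z). FL z)"
    unfolding q_def
  proof (rule stationary_phase[OF h])
    fix z u :: zeta8
    have "D * ((z + h * u) ^ 4 + 4 * (z + h * u) ^ 2) - (D * (z ^ 4 + 4 * z ^ 2) + h * (D * (4 * z ^ 3 + 8 * z) * u))
       = h * h * (D * (6 * z^2 * u^2 + 4 * u^2 + 4 * z * h * u^3 + h^2 * u^4))" by algebra
    then have "cong8 q (D * ((z + h * u) ^ 4 + 4 * (z + h * u) ^ 2)) (D * (z ^ 4 + 4 * z ^ 2) + h * (D * (4 * z ^ 3 + 8 * z) * u))"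
      by (rule cong8I) (rule hh)
    then show "FL (z + h * u) = FL z * ef (D * (4 * z ^ 3 + 8 * z) * u) p"
      unfolding FL_def using ef_cong[OF q(1)] by (simp only: ef_add efh)
  qed (auto intro: FL_cong simp: q_def)
  also have "\<dots> = (\<Sum>z | z \<in> reps8 q \<and> (cong8 p z 0 \<or> (cong8 p z sqrt_m2 \<or> cong8 p z (- sqrt_m2))). FL z)"
  proof -
    have "p dvd D * (4 * z ^ 3 + 8 * z) \<longleftrightarrow> cong8 p z 0 \<or> (cong8 p z sqrt_m2 \<or> cong8 p z (- sqrt_m2))" for z
    proof -
      have "4 * z ^ 3 + 8 * z = 4 * (z * ((z - sqrt_m2) * (z - (- sqrt_m2))))" using sqrt_m2_square by algebra
      then show ?thesis using D not_dvd_4 unfolding cong8_def by (simp add: dvd_mult_iff)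
    qed
    then show ?thesis by simp
  qed
  also have "\<dots> = S 0 FL + (S sqrt_m2 FL + S (- sqrt_m2) FL)"
  proof -
    have 2: "\<not> (cong8 p z sqrt_m2 \<and> cong8 p z (- sqrt_m2))" for z
    proof
      assume "cong8 p z sqrt_m2 \<and> cong8 p z (- sqrt_m2)"
      then have "cong8 p sqrt_m2 (- sqrt_m2)" using cong8_sym cong8_trans by blast
      moreover have "sqrt_m2 - (- sqrt_m2) = 2 * sqrt_m2" by algebra
      ultimately show False using odd not_dvd_sqrt_m2 dvd_mult_iff unfolding cong8_def by metis
    qed
    have 1: "\<not> (cong8 p z 0 \<and> (cong8 p z sqrt_m2 \<or> cong8 p z (- sqrt_m2)))" for z
    proof
      assume "cong8 p z 0 \<and> (cong8 p z sqrt_m2 \<or> cong8 p z (- sqrt_m2))"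
      then have "cong8 p sqrt_m2 0 \<or> cong8 p (- sqrt_m2) 0" using cong8_sym cong8_trans by blast
      then show False using not_dvd_sqrt_m2 by (simp add: cong8_def)
    qed
    show ?thesis unfolding S_def by (subst sum_filter_disj[OF fin 1], subst sum_filter_disj[OF fin 2]) (rule refl)
  qed
  finally have L: "quartic_sum D q = S 0 FL + (S sqrt_m2 FL + S (- sqrt_m2) FL)" .

  have "quadratic_sum D q = (\<Sum>z | z \<in> reps8 q \<and> True. FQ z)" unfolding quadratic_sum_def FQ_def by simp
  also have "\<dots> = (\<Sum>z | z \<in> reps8 q \<and> True \<and> p dvd D * (2 * z). FQ z)"
    unfolding q_def
  proof (rule stationary_phase[OF h])
    fix z u :: zeta8
    have "D * ((z + h * u) ^ 2 - 4) - (D * (z ^ 2 - 4) + h * (D * (2 * z) * u)) = h * h * (D * u^2)" by algebra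
    then have "cong8 q (D * ((z + h * u) ^ 2 - 4)) (D * (z ^ 2 - 4) + h * (D * (2 * z) * u))"
      by (rule cong8I) (rule hh)
    then show "FQ (z + h * u) = FQ z * ef (D * (2 * z) * u) p"
      unfolding FQ_def using ef_cong[OF q(1)] by (simp only: ef_add efh)
  qed (auto intro: FQ_cong simp: q_def)
  also have "\<dots> = S 0 FQ"
    unfolding S_def using D odd by (simp add: dvd_mult_iff cong8_def)
  finally have Q: "quadratic_sum D q = S 0 FQ" .

  have "kloosterman_sum D q = (\<Sum>x | x \<in> reps8 q \<and> \<not> p dvd x. FE x)" unfolding kloosterman_sum_def FE_def chi cop ..
  also have "\<dots> = (\<Sum>x | x \<in> reps8 q \<and> \<not> p dvd x \<and> p dvd D * (1 - (inv_mod q x) ^ 2). FE x)"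
    unfolding q_def
  proof (rule stationary_phase[OF h])
    fix x u :: zeta8 assume x: "\<not> p dvd x"
    then have cx: "coprime x q" using cop by blast
    let ?v = "inv_mod q x" and ?y = "x + h * u"
    have t: "q dvd (x * ?v - 1) * X" for X using inv_mod[OF cx] unfolding cong8_def by simp
    \<comment> \<open>As \<open>q\<close> divides \<open>h\<^sup>2\<close>, the inverse of \<open>x + h u\<close> is \<open>v - h u v\<^sup>2\<close>.\<close>
    have "?y * (?v - h * u * ?v ^ 2) - 1 = (x * ?v - 1) * (1 - h * u * ?v) + h * h * (- (u ^ 2) * ?v ^ 2)" by algebra
    then have "cong8 q (?y * (?v - h * u * ?v ^ 2)) 1" by (rule cong8I) (intro dvd_add t hh)
    then have i: "cong8 q (inv_mod q ?y) (?v - h * u * ?v ^ 2)" by (rule inv_mod_unique)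
    have "cong8 q (D * ((?y - 1) ^ 2 * inv_mod q ?y)) (D * ((?y - 1) ^ 2 * (?v - h * u * ?v ^ 2)))"
      by (intro cong8_mult i) auto
    also have "cong8 q \<dots> (D * ((x - 1) ^ 2 * ?v) + h * (D * (1 - ?v ^ 2) * u))"
    proof -
      have "D * ((?y - 1) ^ 2 * (?v - h * u * ?v ^ 2)) - (D * ((x - 1) ^ 2 * ?v) + h * (D * (1 - ?v ^ 2) * u)) 
        = (x * ?v - 1) * (D * h * u * (2 - x * ?v + 2 * ?v - 1))
          + h * h * (D * (u^2 * ?v - 2 * (x - 1) * u^2 * ?v^2 - h * u^3 * ?v^2))" by algebra
      then show ?thesis by (rule cong8I) (intro dvd_add t hh)
    qed
    finally have "ef (D * ((?y - 1) ^ 2 * inv_mod q ?y)) q = ef (D * ((x - 1) ^ 2 * ?v)) q * ef (D * (1 - ?v ^ 2) * u) p"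
      using ef_cong[OF q(1)] by (simp only: ef_add efh)
    moreover have "chi ?y = chi x" using h by (intro chi_cong) (simp add: cong8_def)
    ultimately show "FE ?y = FE x * ef (D * (1 - (inv_mod (p * h) x) ^ 2) * u) p"
      unfolding FE_def q_def by simp
  next
    show "\<not> p dvd z \<Longrightarrow> cong8 p z z' \<Longrightarrow> \<not> p dvd z'" for z z' using dvd_cong by blast
    show "\<not> p dvd z \<Longrightarrow> cong8 (p * h) z z' \<Longrightarrow> FE z = FE z'" for z z'
      using FE_cong[of z z'] cop unfolding q_def by blast
  qed
  also have "\<dots> = (\<Sum>x | x \<in> reps8 q \<and> (cong8 p x 1 \<or> cong8 p x (-1)). FE x)"
  proof -
    have "\<not> p dvd x \<and> p dvd D * (1 - (inv_mod q x) ^ 2) \<longleftrightarrow> cong8 p x 1 \<or> cong8 p x (-1)" for x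
    proof (cases "p dvd x")
      case True
      have "\<not> cong8 p x 1" "\<not> cong8 p x (-1)"
        using dvd_cong[of x 1] dvd_cong[of x "-1"] True p_nonunit by auto
      then show ?thesis using True by blast
    next
      case False
      then have cx: "coprime x q" using cop by blast
      let ?v = "inv_mod q x"
      have e: "p dvd (x * ?v - 1) * (x * ?v + 1)" using inv_mod[OF cx] q unfolding cong8_def by (meson dvd_mult2 dvd_trans)
      have "x ^ 2 * (1 - ?v ^ 2) + (x * ?v - 1) * (x * ?v + 1) = (x - 1) * (x - (-1))" by algebra
      then have "p dvd (x - 1) * (x - (-1)) \<longleftrightarrow> p dvd x ^ 2 * (1 - ?v ^ 2)" using e dvd_add_left_iff by metis
      then show ?thesis using False D unfolding cong8_def by (simp only: dvd_mult_iff dvd_power_iff zero_less_numeral) blast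
    qed
    then show ?thesis by simp
  qed
  also have "\<dots> = S 1 FE + S (-1) FE"
  proof -
    have "\<not> (cong8 p z 1 \<and> cong8 p z (-1))" for z
    proof
      assume "cong8 p z 1 \<and> cong8 p z (-1)"
      then have "cong8 p 1 (-1)" using cong8_sym cong8_trans by blast
      then show False using odd by (simp add: cong8_def)
    qed
    then show ?thesis unfolding S_def by (rule sum_filter_disj[OF fin])
  qed
  finally have E: "kloosterman_sum D q = S 1 FE + S (-1) FE" .

  have sq_near: "cong8 q (x ^ 2) (y ^ 2) \<longleftrightarrow> cong8 q x y" if "cong8 p x a" "cong8 p y a" "\<not> p dvd a" for x y a
  proof -
    have "cong8 p (x + y) (2 * a)" unfolding mult_2 by (intro cong8_add that)
    then have "p dvd x + y \<longleftrightarrow> p dvd 2 * a" by (rule dvd_cong)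
    then have "coprime (x + y) q" using cop that(3) odd dvd_mult_iff by blast
    then have "cong8 q ((x + y) * x) ((x + y) * y) \<longleftrightarrow> cong8 q x y" by (rule cong8_mult_left_iff)
    moreover have "(x + y) * x - (x + y) * y = x ^ 2 - y ^ 2" by algebra
    ultimately show ?thesis by (simp add: cong8_def)
  qed
  have Lr: "S a FL = S 0 FQ" if a: "a ^ 2 = - 2" for a
  proof -
    have na: "\<not> p dvd a"
    proof
      assume "p dvd a" then have "p dvd a ^ 2" by (simp add: dvd_power_iff)
      then show False using odd unfolding a by simp
    qed
    have "S 0 FQ = (\<Sum>z | z \<in> reps8 q \<and> cong8 p z a. FQ (z ^ 2 + 2))"
      unfolding S_def
    proof (rule sum_near_reindex[OF q])
      show "cong8 p (z ^ 2 + 2) 0" if "cong8 p z a" for z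
        using cong8_add[OF cong8_power[OF that, of 2] cong8_refl[of p 2]] a by simp
      show "cong8 q (x ^ 2 + 2) (y ^ 2 + 2) \<longleftrightarrow> cong8 q x y" if "cong8 p x a" "cong8 p y a" for x y
        using sq_near[OF that na] by (simp add: cong8_def)
    qed (rule FQ_cong)
    moreover have "FQ (z ^ 2 + 2) = FL z" for z
    proof -
      have "D * ((z ^ 2 + 2) ^ 2 - 4) = D * (z ^ 4 + 4 * z ^ 2)" by algebra
      then show ?thesis unfolding FQ_def FL_def by (simp only:)
    qed
    ultimately show ?thesis unfolding S_def by simp
  qed
  have near1: "coprime y q" if "cong8 p y 1" for y
    using dvd_cong[OF that] p_nonunit cop by simp
  define dl where "dl y = y - inv_mod q y" for y
  have inv_p: "cong8 p (inv_mod q y) 1" if "cong8 p y 1" for y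
  proof -
    have "cong8 p (y * inv_mod q y) (1 * inv_mod q y)" by (intro cong8_mult that) simp
    moreover have "cong8 p (y * inv_mod q y) 1" by (rule modp[OF inv_mod[OF near1[OF that]]])
    ultimately show ?thesis using cong8_sym cong8_trans by (metis mult_1)
  qed
  have dl_0: "cong8 p (dl y) 0" if "cong8 p y 1" for y
    unfolding dl_def using cong8_diff[OF that inv_p[OF that]] by simp
  \<comment> \<open>\<open>(y - 1/y) - (z - 1/z) = (y - z) (1 + 1/(y z))\<close>, and the second factor is \<open>2\<close> modulo \<open>p\<close>.\<close>
  have dl_cong: "cong8 q (dl y) (dl z) \<longleftrightarrow> cong8 q y z" if y: "cong8 p y 1" and z: "cong8 p z 1" for y z
  proof -
    have c1: "coprime (y * z) q" using near1 y z by simp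
    have "cong8 p (y * z + 1) (1 * 1 + 1)" by (intro cong8_add cong8_mult y z) simp
    then have c2: "coprime (y * z + 1) q" using dvd_cong[of "y * z + 1" 2] odd cop by simp
    have i: "q dvd (z * inv_mod q z - 1) * y - (y * inv_mod q y - 1) * z"
      using inv_mod[OF near1[OF y]] inv_mod[OF near1[OF z]] unfolding cong8_def
      by (rule dvd_diff[OF dvd_mult2 dvd_mult2, rotated])
    have "(y * z) * (dl y - dl z) = (y * z + 1) * (y - z) + ((z * inv_mod q z - 1) * y - (y * inv_mod q y - 1) * z)"
      unfolding dl_def by algebra
    then have "q dvd (y * z) * (dl y - dl z) \<longleftrightarrow> q dvd (y * z + 1) * (y - z)" using i dvd_add_left_iff by metis
    then show ?thesis unfolding cong8_def
      using c1 c2 by (metis coprime_commute coprime_dvd_mult_right_iff)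
  qed
  have inv_dvd: "q dvd (y * inv_mod q y - 1) * X" if "cong8 p y 1" for y X
    using inv_mod[OF near1[OF that]] unfolding cong8_def by simp

  have "S 0 FL = (\<Sum>y | y \<in> reps8 q \<and> cong8 p y 1. FL (dl y))"
    unfolding S_def by (rule sum_near_reindex[OF q]) (auto intro: dl_0 FL_cong simp: dl_cong)
  also have "\<dots> = (\<Sum>y | y \<in> reps8 q \<and> cong8 p y 1. FE (y ^ 4))"
  proof (intro sum.cong refl)
    fix y assume "y \<in> {y \<in> reps8 q. cong8 p y 1}"
    then have y: "cong8 p y 1" by simp
    let ?v = "inv_mod q y"
    have "cong8 q ((y * ?v) ^ 4) (1 ^ 4)" by (intro cong8_power inv_mod near1 y)
    then have i: "cong8 q (inv_mod q (y ^ 4)) (?v ^ 4)" by (intro inv_mod_unique) (simp add: power_mult_distrib)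
    have "cong8 q (D * ((y ^ 4 - 1) ^ 2 * inv_mod q (y ^ 4))) (D * ((y ^ 4 - 1) ^ 2 * ?v ^ 4))"
      by (intro cong8_mult i) auto
    also have "cong8 q \<dots> (D * (dl y ^ 4 + 4 * dl y ^ 2))"
    proof -
      have "D * ((y ^ 4 - 1) ^ 2 * ?v ^ 4) - D * (dl y ^ 4 + 4 * dl y ^ 2) = (y * ?v - 1) * (D * (y ^ 4 * (y * ?v + 1) * ((y * ?v) ^ 2 + 1) 
         + 4 * y ^ 2 + 4 * ?v ^ 2 - 2 * (y * ?v) * ((y * ?v) ^ 2 + y * ?v + 4)))"
        unfolding dl_def by algebra
      then show ?thesis by (rule cong8I) (rule inv_dvd[OF y])
    qed
    finally have "ef (D * ((y ^ 4 - 1) ^ 2 * inv_mod q (y ^ 4))) q = FL (dl y)" unfolding FL_def by (rule ef_cong[OF q(1)])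
    moreover have "chi (y ^ 4) = chi 1" using cong8_power[OF y, of 4] by (intro chi_cong) simp
    then have "chi (y ^ 4) = 1" by (simp add: chi_def quartic_char_1)
    ultimately show "FL (dl y) = FE (y ^ 4)" unfolding FE_def by simp
  qed
  also have "\<dots> = S 1 FE"
    unfolding S_def
  proof (rule sum_near_reindex[OF q, symmetric])
    show g: "cong8 p (y ^ 4) 1" if "cong8 p y 1" for y using cong8_power[OF that, of 4] by simp
    show "cong8 q (x ^ 4) (y ^ 4) \<longleftrightarrow> cong8 q x y" if "cong8 p x 1" "cong8 p y 1" for x y
    proof -
      have n1: "\<not> p dvd 1" using p_nonunit by simp
      have "cong8 p (x ^ 2) 1" "cong8 p (y ^ 2) 1" using that cong8_power[of p _ 1 2] by auto
      from sq_near[OF this n1] sq_near[OF that n1] show ?thesis by (simp flip: power_mult)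
    qed
    show "FE x = FE y" if "cong8 p x 1" "cong8 q x y" for x y by (rule FE_cong[OF near1[OF that(1)] that(2)])
  qed
  finally have L0: "S 0 FL = S 1 FE" .

  have ci: "coprime i8 q" using not_dvd_w8 cop unfolding i8_def by (simp add: dvd_power_iff)
  have "S 0 FQ = (\<Sum>y | y \<in> reps8 q \<and> cong8 p y 1. FQ (i8 * dl y))"
    unfolding S_def
  proof (rule sum_near_reindex[OF q])
    show "cong8 p (i8 * dl y) 0" if "cong8 p y 1" for y using cong8_mult[OF cong8_refl[of p i8] dl_0[OF that]] by simp
    show "cong8 q (i8 * dl x) (i8 * dl y) \<longleftrightarrow> cong8 q x y" if "cong8 p x 1" "cong8 p y 1" for x y
      using cong8_mult_left_iff[OF ci] dl_cong[OF that] by simp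
  qed (rule FQ_cong)
  also have "\<dots> = (\<Sum>y | y \<in> reps8 q \<and> cong8 p y 1. FE (- (y ^ 2)))"
  proof (intro sum.cong refl)
    fix y assume "y \<in> {y \<in> reps8 q. cong8 p y 1}"
    then have y: "cong8 p y 1" by simp
    let ?v = "inv_mod q y"
    have "cong8 q ((y * ?v) ^ 2) (1 ^ 2)" by (intro cong8_power inv_mod near1 y)
    then have i: "cong8 q (inv_mod q (- (y ^ 2))) (- (?v ^ 2))" by (intro inv_mod_unique) (simp add: power_mult_distrib)
    have "cong8 q (D * ((- (y ^ 2) - 1) ^ 2 * inv_mod q (- (y ^ 2)))) (D * ((- (y ^ 2) - 1) ^ 2 * (- (?v ^ 2))))"
      by (intro cong8_mult i) auto
    also have "cong8 q \<dots> (D * ((i8 * dl y) ^ 2 - 4))"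
    proof -
      have i2: "(i8 * dl y) ^ 2 = - (dl y ^ 2)" by (simp add: power_mult_distrib i8_2)
      have "D * ((- (y ^ 2) - 1) ^ 2 * (- (?v ^ 2))) - D * (- (dl y ^ 2) - 4) = (y * ?v - 1) * (- D * (y ^ 2 * (1 + y * ?v) + 2 * (y * ?v) + 4))"
        unfolding dl_def by algebra
      then show ?thesis unfolding i2 by (rule cong8I) (rule inv_dvd[OF y])
    qed
    finally have "ef (D * ((- (y ^ 2) - 1) ^ 2 * inv_mod q (- (y ^ 2)))) q = FQ (i8 * dl y)"
      unfolding FQ_def by (rule ef_cong[OF q(1)])
    moreover have "chi (- (y ^ 2)) = chi (- 1)" using cong8_minus[OF cong8_power[OF y, of 2]] by (intro chi_cong) simp
    then have "chi (- (y ^ 2)) = 1" by (simp add: chi_def quartic_char_minus_1)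
    ultimately show "FQ (i8 * dl y) = FE (- (y ^ 2))" unfolding FE_def by simp
  qed
  also have "\<dots> = S (-1) FE"
    unfolding S_def
  proof (rule sum_near_reindex[OF q, symmetric])
    show g: "cong8 p (- (y ^ 2)) (-1)" if "cong8 p y 1" for y using cong8_minus[OF cong8_power[OF that, of 2]] by simp
    show "cong8 q (- (x ^ 2)) (- (y ^ 2)) \<longleftrightarrow> cong8 q x y" if "cong8 p x 1" "cong8 p y 1" for x y
    proof -
      have n1: "\<not> p dvd 1" using p_nonunit by simp
      have "cong8 q (- (x ^ 2)) (- (y ^ 2)) \<longleftrightarrow> cong8 q (x ^ 2) (y ^ 2)"
        using cong8_minus[of q "x ^ 2" "y ^ 2"] cong8_minus[of q "- (x ^ 2)" "- (y ^ 2)"] by auto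
      then show ?thesis using sq_near[OF that n1] by simp
    qed
    show "FE x = FE y" if "cong8 p x (-1)" "cong8 q x y" for x y
    proof (rule FE_cong[OF _ that(2)])
      show "coprime x q" using dvd_cong[OF that(1)] p_nonunit cop by simp
    qed
  qed
  finally have E1: "S 0 FQ = S (-1) FE" .
  have "(- sqrt_m2) ^ 2 = - 2" using sqrt_m2_square by simp
  then show ?thesis unfolding pk L Q E L0 E1[symmetric] using Lr[OF sqrt_m2_square] Lr[of "- sqrt_m2"] by simp
qed

end

section \<open>Twisted multiplicativity\<close>
lemma inv_mod_mult:
  assumes "q dvd n" "coprime a q" "coprime b n"
  shows "cong8 q (inv_mod q a * inv_mod n b) (inv_mod q (a * b))"
proof (rule cong8_sym[OF inv_mod_unique])
  have "cong8 q ((a * inv_mod q a) * (b * inv_mod n b)) (1 * 1)"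
    by (intro cong8_mult inv_mod assms cong8_dvd_mod[OF inv_mod assms(1)])
  then show "cong8 q (a * b * (inv_mod q a * inv_mod n b)) 1" by (simp add: mult_ac)
qed

text \<open>The common behaviour of the three sums in the modulus. Taking \<open>n\<close> a unit in \<open>twist\<close> shows that a modulus may be changed by
a unit if the parameter is changed accordingly.\<close>
locale twisted_multiplicative =
  fixes M :: "zeta8 \<Rightarrow> zeta8 \<Rightarrow> complex"
  assumes twist: "coprime n m \<Longrightarrow> coprime 2 (n * m) \<Longrightarrow> n * m \<noteq> 0 \<Longrightarrow>
      M D (n * m) = M (inv_mod n m * D) n * M (inv_mod m n * D) m"
    and at_unit: "is_unit e \<Longrightarrow> M D e = 1"
    and param_cong: "c \<noteq> 0 \<Longrightarrow> cong8 c D D' \<Longrightarrow> M D c = M D' c"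
begin

lemma at_prod:
  assumes "finite P" "is_unit e" "\<And>q. q \<in> P \<Longrightarrow> q \<noteq> 0 \<and> coprime 2 q"
    "\<And>q q'. q \<in> P \<Longrightarrow> q' \<in> P \<Longrightarrow> q \<noteq> q' \<Longrightarrow> coprime q q'"
  shows "M D (e * \<Prod>P) = (\<Prod>q\<in>P. M (inv_mod q (e * \<Prod>(P - {q})) * D) q)"
  using assms
proof (induction P arbitrary: D rule: finite_induct)
  case empty
  then show ?case by (simp add: at_unit)
next
  case (insert q0 P)
  let ?m = "e * \<Prod>P"
  have ue: "coprime e q" "coprime q e" for q
    using insert.prems(1) by (rule is_unit_left_imp_coprime, rule is_unit_right_imp_coprime)
  have cop: "coprime q0 ?m" using insert.prems insert.hyps ue by (auto intro!: prod_coprime_right)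
  have two: "coprime 2 (q0 * ?m)" using insert.prems ue by (auto intro!: prod_coprime_right)
  have nz: "q0 * ?m \<noteq> 0" using insert.prems insert.hyps by auto
  have "e * \<Prod>(insert q0 P) = q0 * ?m" using insert.hyps by (simp add: mult_ac)
  then have "M D (e * \<Prod>(insert q0 P)) = M (inv_mod q0 ?m * D) q0 * M (inv_mod ?m q0 * D) ?m"
    using twist[OF cop two nz] by (simp only:)
  also have "M (inv_mod ?m q0 * D) ?m = (\<Prod>q\<in>P. M (inv_mod q (e * \<Prod>(P - {q})) * (inv_mod ?m q0 * D)) q)"
    using insert.prems by (intro insert.IH) auto
  also have "\<dots> = (\<Prod>q\<in>P. M (inv_mod q (e * \<Prod>(insert q0 P - {q})) * D) q)"
  proof (rule prod.cong[OF refl])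
    fix q assume q: "q \<in> P"
    have "q \<noteq> q0" using q insert.hyps by blast
    then have "insert q0 P - {q} = insert q0 (P - {q})" by blast
    then have e: "e * \<Prod>(insert q0 P - {q}) = (e * \<Prod>(P - {q})) * q0" using insert.hyps by (simp add: mult_ac)
    have "\<Prod>P = q * \<Prod>(P - {q})" using q insert.hyps by (simp add: prod.remove)
    then have "q dvd ?m" by simp
    moreover have "coprime (e * \<Prod>(P - {q})) q" using insert.prems q ue by (auto intro!: prod_coprime_left)
    ultimately have "cong8 q (inv_mod q (e * \<Prod>(P - {q})) * inv_mod ?m q0) (inv_mod q (e * \<Prod>(insert q0 P - {q})))"
      unfolding e by (rule inv_mod_mult[OF _ _ cop])
    then have "cong8 q (inv_mod q (e * \<Prod>(P - {q})) * inv_mod ?m q0 * D) (inv_mod q (e * \<Prod>(insert q0 P - {q})) * D)"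
      by (intro cong8_mult) auto
    then show "M (inv_mod q (e * \<Prod>(P - {q})) * (inv_mod ?m q0 * D)) q = M (inv_mod q (e * \<Prod>(insert q0 P - {q})) * D) q"
      using param_cong insert.prems q by (simp add: mult.assoc)
  qed
  finally show ?case using insert.hyps by simp
qed

text \<open>The local parameters are formed with the cofactor of \<open>q\<close> in the whole product; they do not depend on \<open>S\<close>, because
the twist by \<open>m\<close> supplies the factors outside \<open>S\<close>.\<close>
lemma at_subproduct:
  assumes P: "finite P" "is_unit e" "\<And>q. q \<in> P \<Longrightarrow> q \<noteq> 0 \<and> coprime 2 q"
    "\<And>q q'. q \<in> P \<Longrightarrow> q' \<in> P \<Longrightarrow> q \<noteq> q' \<Longrightarrow> coprime q q'"
    and S: "S \<subseteq> P" "n = u * \<Prod>S" "is_unit u" "n * m = e * \<Prod>P" "coprime n m"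
  shows "M (inv_mod n m * D) n = (\<Prod>q\<in>S. M (inv_mod q (e * \<Prod>(P - {q})) * D) q)"
proof -
  have finS: "finite S" using P(1) S(1) finite_subset by blast
  have "M (inv_mod n m * D) n = (\<Prod>q\<in>S. M (inv_mod q (u * \<Prod>(S - {q})) * (inv_mod n m * D)) q)"
    unfolding S(2)
  proof (rule at_prod[OF finS S(3)])
    show "q \<noteq> 0 \<and> coprime 2 q" if "q \<in> S" for q using P(3) S(1) that by blast
    show "coprime q q'" if "q \<in> S" "q' \<in> S" "q \<noteq> q'" for q q' using P(4) S(1) that by blast
  qed
  also have "\<dots> = (\<Prod>q\<in>S. M (inv_mod q (e * \<Prod>(P - {q})) * D) q)"
  proof (rule prod.cong[OF refl])
    fix q assume q: "q \<in> S"
    then have qP: "q \<in> P" using S by blast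
    have ns: "n = q * (u * \<Prod>(S - {q}))" unfolding S(2) using q finS by (simp add: prod.remove mult_ac)
    have "q * (u * \<Prod>(S - {q}) * m) = n * m" unfolding ns by (simp add: mult_ac)
    also have "\<dots> = q * (e * \<Prod>(P - {q}))" unfolding S(4) using qP P(1) by (simp add: prod.remove mult_ac)
    finally have e: "u * \<Prod>(S - {q}) * m = e * \<Prod>(P - {q})" using P(3)[OF qP] by simp
    have "q dvd n" unfolding ns by simp
    moreover have "coprime (\<Prod>(S - {q})) q"
      using P(4) S(1) q by (intro prod_coprime_left) blast
    then have "coprime (u * \<Prod>(S - {q})) q" using is_unit_left_imp_coprime[OF S(3)] by simp
    moreover have "coprime m n" using S(5) by (simp add: coprime_commute)
    ultimately have "cong8 q (inv_mod q (u * \<Prod>(S - {q})) * inv_mod n m) (inv_mod q (e * \<Prod>(P - {q})))"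
      unfolding e[symmetric] by (rule inv_mod_mult)
    then have "cong8 q (inv_mod q (u * \<Prod>(S - {q})) * inv_mod n m * D) (inv_mod q (e * \<Prod>(P - {q})) * D)"
      by (intro cong8_mult) auto
    then show "M (inv_mod q (u * \<Prod>(S - {q})) * (inv_mod n m * D)) q = M (inv_mod q (e * \<Prod>(P - {q})) * D) q"
      using param_cong P(3)[OF qP] by (simp add: mult.assoc)
  qed
  finally show ?thesis .
qed

end

lemma reps8_unit: assumes "is_unit e" shows "reps8 e = {rep8 e 0}"
proof -
  have "rep8 e x = rep8 e 0" for x unfolding rep8_eq_iff cong8_def by (rule unit_imp_dvd[OF assms])
  then show ?thesis unfolding reps8_def by auto
qed

context fraction_character
begin

lemma ef_unit: "is_unit e \<Longrightarrow> ef a e = 1"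
  by (rule ef_integral) (auto intro: unit_imp_dvd)

text \<open>Partial fractions: \<open>1/(nm) = (1/m)/n + (1/n)/m\<close> up to an integral element.\<close>
lemma ef_split:
  assumes "coprime n m" "n * m \<noteq> 0"
  shows "ef a (n * m) = ef (inv_mod n m * a) n * ef (inv_mod m n * a) m"
proof -
  let ?s = "m * inv_mod n m + n * inv_mod m n"
  have "cong8 n ?s (1 + 0)" using assms by (intro cong8_add inv_mod) (auto simp: cong8_def coprime_commute)
  moreover have "cong8 m ?s (0 + 1)" using assms by (intro cong8_add inv_mod) (auto simp: cong8_def)
  ultimately have "cong8 (n * m) ?s 1" using divides_mult[of n "?s - 1" m] assms(1) by (simp add: cong8_def)
  then have "cong8 (n * m) (?s * a) (1 * a)" by (intro cong8_mult) auto
  then have "ef a (n * m) = ef (?s * a) (n * m)" using ef_cong[OF assms(2)] by simp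
  also have "?s * a = (inv_mod n m * a) * m + (inv_mod m n * a) * n" by algebra
  also have "ef \<dots> (n * m) = ef ((inv_mod n m * a) * m) (n * m) * ef ((inv_mod m n * a) * n) (m * n)"
    by (simp add: ef_add mult.commute)
  finally show ?thesis using assms(2) by (simp add: ef_cancel)
qed

text \<open>The weight \<open>g\<close> and the phase \<open>f\<close> may depend on the modulus, and \<open>f\<close> has to be compatible with the splitting only where
the weight is nonzero; in the Kloosterman sum \<open>f\<close> contains an inverse, which is meaningless off the units.\<close>
lemma twisted_sum:
  assumes nm: "coprime n m" "n * m \<noteq> 0"
    and g_mult: "\<And>x. g (n * m) x = g n x * g m x"
    and gn: "\<And>x y. cong8 n x y \<Longrightarrow> g n x = g n y" and gm: "\<And>x y. cong8 m x y \<Longrightarrow> g m x = g m y"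
    and fn: "\<And>x y. g n x \<noteq> 0 \<Longrightarrow> cong8 n x y \<Longrightarrow> cong8 n (f n x) (f n y)"
    and fm: "\<And>x y. g m x \<noteq> 0 \<Longrightarrow> cong8 m x y \<Longrightarrow> cong8 m (f m x) (f m y)"
    and f1: "\<And>x. g (n * m) x \<noteq> 0 \<Longrightarrow> cong8 n (f (n * m) x) (f n x)"
    and f2: "\<And>x. g (n * m) x \<noteq> 0 \<Longrightarrow> cong8 m (f (n * m) x) (f m x)"
  shows "(\<Sum>x\<in>reps8 (n * m). g (n * m) x * ef (D * f (n * m) x) (n * m)) =
    (\<Sum>x\<in>reps8 n. g n x * ef (inv_mod n m * D * f n x) n) * (\<Sum>x\<in>reps8 m. g m x * ef (inv_mod m n * D * f m x) m)"
proof -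
  have nz: "n \<noteq> 0" "m \<noteq> 0" using nm by auto
  have "(\<Sum>x\<in>reps8 (n * m). g (n * m) x * ef (D * f (n * m) x) (n * m)) =
    (\<Sum>x\<in>reps8 (n * m). (g n x * ef (inv_mod n m * D * f n x) n) * (g m x * ef (inv_mod m n * D * f m x) m))"
  proof (rule sum.cong[OF refl])
    fix x
    show "g (n * m) x * ef (D * f (n * m) x) (n * m) = (g n x * ef (inv_mod n m * D * f n x) n) * (g m x * ef (inv_mod m n * D * f m x) m)"
    proof (cases "g (n * m) x = 0")
      case True then show ?thesis using g_mult[of x] by auto
    next
      case False
      have "ef (inv_mod n m * (D * f (n * m) x)) n = ef (inv_mod n m * (D * f n x)) n"
        by (intro ef_cong nz cong8_mult f1 False) auto
      moreover have "ef (inv_mod m n * (D * f (n * m) x)) m = ef (inv_mod m n * (D * f m x)) m"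
        by (intro ef_cong nz cong8_mult f2 False) auto
      ultimately show ?thesis unfolding ef_split[OF nm] g_mult by (simp add: mult_ac)
    qed
  qed
  also have "\<dots> = (\<Sum>x\<in>reps8 n. g n x * ef (inv_mod n m * D * f n x) n) * (\<Sum>x\<in>reps8 m. g m x * ef (inv_mod m n * D * f m x) m)"
  proof (rule sum_reps8_mult[OF nm(1)])
    show "g n x * ef (inv_mod n m * D * f n x) n = g n y * ef (inv_mod n m * D * f n y) n" if "cong8 n x y" for x y
    proof (cases "g n x = 0")
      case False
      then have "ef (inv_mod n m * D * f n x) n = ef (inv_mod n m * D * f n y) n"
        by (intro ef_cong nz cong8_mult fn that) auto
      then show ?thesis using gn[OF that] by simp
    qed (simp flip: gn[OF that])
    show "g m x * ef (inv_mod m n * D * f m x) m = g m y * ef (inv_mod m n * D * f m y) m" if "cong8 m x y" for x y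
    proof (cases "g m x = 0")
      case False
      then have "ef (inv_mod m n * D * f m x) m = ef (inv_mod m n * D * f m y) m"
        by (intro ef_cong nz cong8_mult fm that) auto
      then show ?thesis using gm[OF that] by simp
    qed (simp flip: gm[OF that])
  qed
  finally show ?thesis .
qed

lemma kloosterman_sum_alt: 
  assumes "c \<noteq> 0"
  shows "kloosterman_sum D c = (\<Sum>x\<in>reps8 c. (if coprime x c then residue_symbol 4 x c else 0) * ef (D * ((x - 1) ^ 2 * inv_mod c x)) c)"
  unfolding kloosterman_sum_def sum.inter_filter[OF finite_reps8[OF assms]] by (intro sum.cong) auto

lemma twisted_quartic_sum: "twisted_multiplicative quartic_sum"
proof
  fix n m D :: zeta8 assume "coprime n m" "n * m \<noteq> 0"
  from twisted_sum[where g = "\<lambda>_ _. 1" and f = "\<lambda>_ z. z ^ 4 + 4 * z ^ 2" and D = D, OF this]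
  show "quartic_sum D (n * m) = quartic_sum (inv_mod n m * D) n * quartic_sum (inv_mod m n * D) m"
    unfolding quartic_sum_def by (simp add: cong8_add cong8_mult cong8_power)
next
  show "is_unit e \<Longrightarrow> quartic_sum D e = 1" for D e unfolding quartic_sum_def by (simp add: reps8_unit ef_unit)
  show "c \<noteq> 0 \<Longrightarrow> cong8 c D D' \<Longrightarrow> quartic_sum D c = quartic_sum D' c" for c D D'
    unfolding quartic_sum_def by (intro sum.cong ef_cong cong8_mult) auto
qed

lemma twisted_quadratic_sum: "twisted_multiplicative quadratic_sum"
proof
  fix n m D :: zeta8 assume "coprime n m" "n * m \<noteq> 0"
  from twisted_sum[where g = "\<lambda>_ _. 1" and f = "\<lambda>_ z. z ^ 2 - 4" and D = D, OF this]
  show "quadratic_sum D (n * m) = quadratic_sum (inv_mod n m * D) n * quadratic_sum (inv_mod m n * D) m"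
    unfolding quadratic_sum_def by (simp add: cong8_diff cong8_power)
next
  show "is_unit e \<Longrightarrow> quadratic_sum D e = 1" for D e unfolding quadratic_sum_def by (simp add: reps8_unit ef_unit)
  show "c \<noteq> 0 \<Longrightarrow> cong8 c D D' \<Longrightarrow> quadratic_sum D c = quadratic_sum D' c" for c D D'
    unfolding quadratic_sum_def by (intro sum.cong ef_cong cong8_mult) auto
qed

lemma twisted_kloosterman_sum: "twisted_multiplicative kloosterman_sum"
proof
  fix n m D :: zeta8 assume nm: "coprime n m" "n * m \<noteq> 0" and two: "coprime 2 (n * m)"
  have nz: "n \<noteq> 0" "m \<noteq> 0" and two': "coprime 2 n" "coprime 2 m" using nm two by auto
  have inv: "cong8 d (inv_mod (n * m) x) (inv_mod d x)" if "coprime x (n * m)" "d dvd n * m" for x d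
    using inv_mod_unique[OF cong8_dvd_mod[OF inv_mod that(2)], OF that(1)] cong8_sym by blast
  show "kloosterman_sum D (n * m) = kloosterman_sum (inv_mod n m * D) n * kloosterman_sum (inv_mod m n * D) m"
    unfolding kloosterman_sum_alt[OF nm(2)] kloosterman_sum_alt[OF nz(1)] kloosterman_sum_alt[OF nz(2)]
  proof (rule twisted_sum[where g = "\<lambda>c x. if coprime x c then residue_symbol 4 x c else 0"
        and f = "\<lambda>c x. (x - 1) ^ 2 * inv_mod c x" and D = D, OF nm])
    show "(if coprime x (n * m) then residue_symbol 4 x (n * m) else 0) =
         (if coprime x n then residue_symbol 4 x n else 0) * (if coprime x m then residue_symbol 4 x m else 0)" for x
      using residue_symbol_mult[OF nz] by simp
    show "(if coprime x n then residue_symbol 4 x n else 0) = (if coprime y n then residue_symbol 4 y n else 0)" if "cong8 n x y" for x y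
      using that residue_symbol_cong[OF two'(1) nz(1)] coprime_cong8_cong by metis
    show "(if coprime x m then residue_symbol 4 x m else 0) = (if coprime y m then residue_symbol 4 y m else 0)" if "cong8 m x y" for x y
      using that residue_symbol_cong[OF two'(2) nz(2)] coprime_cong8_cong by metis
  qed (auto intro!: cong8_mult cong8_power cong8_diff inv_mod_cong inv split: if_splits)
next
  show "kloosterman_sum D e = 1" if "is_unit e" for D e
  proof -
    have "{x. x \<in> reps8 e \<and> coprime x e} = {rep8 e 0}"
      using is_unit_right_imp_coprime[OF that] by (auto simp: reps8_unit[OF that])
    then show ?thesis unfolding kloosterman_sum_def using that by (simp add: residue_symbol_unit ef_unit)
  qed
  show "c \<noteq> 0 \<Longrightarrow> cong8 c D D' \<Longrightarrow> kloosterman_sum D c = kloosterman_sum D' c" for c D D'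
    unfolding kloosterman_sum_def by (intro sum.cong arg_cong2[of _ _ _ _ "(*)"] ef_cong cong8_mult) auto
qed

end

section \<open>Decompositions and sets of prime powers\<close>
lemma coprime_prime_power_factorization:
  assumes "(c::zeta8) \<noteq> 0"
  obtains P e where "finite P" "is_unit e" "c = e * \<Prod>P" "\<And>q. q \<in> P \<Longrightarrow> \<exists>p k. prime_elem p \<and> k > 0 \<and> q = p ^ k"
    "\<And>q q'. q \<in> P \<Longrightarrow> q' \<in> P \<Longrightarrow> q \<noteq> q' \<Longrightarrow> coprime q q'"
proof -
  define F where "F = prime_factorization c"
  define f where "f p = p ^ count F p" for p
  have pr: "prime p \<and> count F p > 0" if "p \<in># F" for p using that unfolding F_def by (auto dest: in_prime_factors_imp_prime)
  have cop: "coprime (f p) (f p')" if "p \<in># F" "p' \<in># F" "p \<noteq> p'" for p p'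
    using that pr primes_coprime[of p p'] unfolding f_def by simp
  have inj: "inj_on f (set_mset F)"
  proof (rule inj_onI, rule ccontr)
    fix p p' assume "p \<in># F" "p' \<in># F" "f p = f p'" "p \<noteq> p'"
    then have "is_unit (f p)" using cop by fastforce
    then show False using pr[OF \<open>p \<in># F\<close>] unfolding f_def by (auto simp: is_unit_power_iff)
  qed
  have "normalize (prod_mset F) = normalize c" unfolding F_def by (rule prod_mset_prime_factorization_weak[OF assms])
  then have "normalize c = normalize (prod_mset F)" by simp
  then obtain e where e: "is_unit e" "c = e * prod_mset F" by (rule associatedE1)
  have "prod_mset F = \<Prod>(f ` set_mset F)"
    unfolding prod.reindex[OF inj] comp_def f_def by (simp add: prod_mset_multiplicity)
  then have "c = e * \<Prod>(f ` set_mset F)" using e by simp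
  moreover have "\<exists>p k. prime_elem p \<and> k > 0 \<and> q = p ^ k" if "q \<in> f ` set_mset F" for q
    using that pr unfolding f_def by blast
  moreover have "coprime q q'" if "q \<in> f ` set_mset F" "q' \<in> f ` set_mset F" "q \<noteq> q'" for q q'
    using that cop by auto
  ultimately show thesis using that[of "f ` set_mset F" e] e(1) by blast
qed

lemma prod_dvd_of_coprime:
  fixes n :: zeta8
  assumes "finite P" "\<And>q. q \<in> P \<Longrightarrow> q dvd n" "\<And>q q'. q \<in> P \<Longrightarrow> q' \<in> P \<Longrightarrow> q \<noteq> q' \<Longrightarrow> coprime q q'"
  shows "\<Prod>P dvd n"
  using assms
proof (induction P rule: finite_induct)
  case (insert q P)
  then have "coprime q (\<Prod>P)" by (auto intro!: prod_coprime_right)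
  then show ?case using insert by (auto intro!: divides_mult)
qed simp

lemma unit_equiv_equiv: "equiv UNIV unit_equiv"
proof (rule equivI)
  show "unit_equiv \<subseteq> UNIV \<times> UNIV" by simp
  show "refl unit_equiv" unfolding refl_on_def unit_equiv_def by (auto intro: exI[of _ 1])
  show "Relation.sym unit_equiv"
  proof (rule symI)
    fix x y assume "(x, y) \<in> unit_equiv"
    moreover obtain n m n' m' where "x = (n, m)" "y = (n', m')" by (metis surj_pair)
    ultimately obtain u v where xy: "x = (n, m)" "y = (n', m')" "u * v = 1" "n' = u * n" "m' = v * m"
      unfolding unit_equiv_def by auto
    have "v * u = 1" "n = v * n'" "m = u * m'" unfolding xy using xy(3) by algebra+
    then show "(y, x) \<in> unit_equiv" unfolding unit_equiv_def xy(1,2) by blast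
  qed
  show "trans unit_equiv"
  proof (rule transI)
    fix x y z assume "(x, y) \<in> unit_equiv" "(y, z) \<in> unit_equiv"
    moreover obtain n m n' m' n'' m'' where "x = (n, m)" "y = (n', m')" "z = (n'', m'')" by (metis surj_pair)
    ultimately obtain u v u' v' where xy: "x = (n, m)" "y = (n', m')" "z = (n'', m'')" "u * v = 1" "n' = u * n" "m' = v * m"
      "u' * v' = 1" "n'' = u' * n'" "m'' = v' * m'"
      unfolding unit_equiv_def by auto
    have "(u' * u) * (v' * v) = 1" "n'' = (u' * u) * n" "m'' = (v' * v) * m" using xy(4-9) by algebra+
    then show "(x, z) \<in> unit_equiv" unfolding unit_equiv_def xy(1-3) by blast
  qed
qed

text \<open>A prime power dividing a product of coprime factors divides one of them; the set of those dividing \<open>n\<close> determines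
\<open>n\<close> and \<open>m\<close> up to units. The decompositions with a factor associated to \<open>c\<close> correspond to the
empty set and the whole set.\<close>
lemma decompositions_bij:
  assumes P: "finite P" "is_unit e" "c = e * \<Prod>P" "c \<noteq> 0"
    and pp: "\<And>q. q \<in> P \<Longrightarrow> \<exists>p k. prime_elem p \<and> k > 0 \<and> q = p ^ k"
    and cop: "\<And>q q'. q \<in> P \<Longrightarrow> q' \<in> P \<Longrightarrow> q \<noteq> q' \<Longrightarrow> coprime q q'"
  shows "bij_betw (\<lambda>S. unit_equiv `` {(\<Prod>S, e * \<Prod>(P - S))}) (Pow P - {{}, P}) (decompositions c // unit_equiv)"
proof (rule bij_betw_imageI)
  have nonunit: "\<not> is_unit q" if "q \<in> P" for q using pp[OF that] by (auto simp: is_unit_power_iff)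
  have split: "\<Prod>P = \<Prod>S * \<Prod>(P - S)" if "S \<subseteq> P" for S
    using prod.subset_diff[OF that P(1), of "\<lambda>x. x"] by (simp add: mult.commute)
  have nz: "\<Prod>S \<noteq> 0" if "S \<subseteq> P" for S using P(3,4) split[OF that] by auto
  have memb: "q dvd \<Prod>S \<longleftrightarrow> q \<in> S" if "q \<in> P" "S \<subseteq> P" for q S
  proof
    assume "q dvd \<Prod>S"
    show "q \<in> S"
    proof (rule ccontr)
      assume "q \<notin> S"
      then have "coprime q (\<Prod>S)" using that cop by (intro prod_coprime_right) auto
      then show False using \<open>q dvd \<Prod>S\<close> nonunit[OF that(1)] by (simp add: coprime_absorb_left)
    qed
  next
    assume "q \<in> S" then show "q dvd \<Prod>S" using that P(1) finite_subset by (intro dvd_prodI[where f = "\<lambda>x. x"]) auto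
  qed
  have nonunit_prod: "\<not> is_unit (\<Prod>S)" if "S \<subseteq> P" "S \<noteq> {}" for S
    using memb that nonunit by (metis dvd_unit_imp_unit equals0I subsetD)
  show "inj_on (\<lambda>S. unit_equiv `` {(\<Prod>S, e * \<Prod>(P - S))}) (Pow P - {{}, P})"
  proof (rule inj_onI)
    fix S T assume ST: "S \<in> Pow P - {{}, P}" "T \<in> Pow P - {{}, P}"
      "unit_equiv `` {(\<Prod>S, e * \<Prod>(P - S))} = unit_equiv `` {(\<Prod>T, e * \<Prod>(P - T))}"
    then have "((\<Prod>S, e * \<Prod>(P - S)), (\<Prod>T, e * \<Prod>(P - T))) \<in> unit_equiv"
      using eq_equiv_class[OF ST(3) unit_equiv_equiv] by blast
    then obtain u v where uv: "u * v = 1" "\<Prod>T = u * \<Prod>S" unfolding unit_equiv_def by auto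
    have "is_unit u" using uv(1) by (metis dvd_triv_left)
    then have "q dvd \<Prod>T \<longleftrightarrow> q dvd \<Prod>S" for q
      unfolding uv(2) by (rule dvd_mult_unit_iff')
    moreover have sub: "S \<subseteq> P" "T \<subseteq> P" using ST by auto
    ultimately have "q \<in> T \<longleftrightarrow> q \<in> S" if "q \<in> P" for q
      using memb[OF that sub(1)] memb[OF that sub(2)] by simp
    then show "S = T" using sub by blast
  qed
  show "(\<lambda>S. unit_equiv `` {(\<Prod>S, e * \<Prod>(P - S))}) ` (Pow P - {{}, P}) = decompositions c // unit_equiv"
  proof (intro subset_antisym subsetI)
    fix X assume "X \<in> (\<lambda>S. unit_equiv `` {(\<Prod>S, e * \<Prod>(P - S))}) ` (Pow P - {{}, P})"
    then obtain S where S: "S \<subseteq> P" "S \<noteq> {}" "P - S \<noteq> {}" and X: "X = unit_equiv `` {(\<Prod>S, e * \<Prod>(P - S))}" by auto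
    have 1: "c = \<Prod>S * (e * \<Prod>(P - S))" unfolding P(3) split[OF S(1)] by (simp add: mult_ac)
    have 2: "coprime (\<Prod>S) (e * \<Prod>(P - S))"
    proof -
      have "coprime (\<Prod>S) (\<Prod>(P - S))" using S(1) cop by (intro prod_coprime_left prod_coprime_right) blast
      then show ?thesis by (simp add: is_unit_right_imp_coprime[OF P(2)])
    qed
    have 3: "\<not> (\<exists>\<epsilon>. is_unit \<epsilon> \<and> \<Prod>S = \<epsilon> * c)"
    proof
      assume "\<exists>\<epsilon>. is_unit \<epsilon> \<and> \<Prod>S = \<epsilon> * c"
      then obtain \<epsilon> where "\<Prod>S * 1 = \<Prod>S * (\<epsilon> * e * \<Prod>(P - S))" using 1 by (auto simp: mult_ac)
      then have "1 = \<epsilon> * e * \<Prod>(P - S)" using nz[OF S(1)] by (simp only: mult_cancel_left) simp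
      then have "is_unit (\<Prod>(P - S))" by (metis dvd_triv_right)
      then show False using nonunit_prod[of "P - S"] S(3) by blast
    qed
    have 4: "\<not> (\<exists>\<epsilon>. is_unit \<epsilon> \<and> e * \<Prod>(P - S) = \<epsilon> * c)"
    proof
      assume "\<exists>\<epsilon>. is_unit \<epsilon> \<and> e * \<Prod>(P - S) = \<epsilon> * c"
      then obtain \<epsilon> where "(e * \<Prod>(P - S)) * 1 = (e * \<Prod>(P - S)) * (\<epsilon> * \<Prod>S)" using 1 by (auto simp: mult_ac)
      moreover have "e * \<Prod>(P - S) \<noteq> 0" using 1 P(4) by auto
      ultimately have "1 = \<epsilon> * \<Prod>S" by (simp only: mult_cancel_left) simp
      then have "is_unit (\<Prod>S)" by (metis dvd_triv_right)
      then show False using nonunit_prod S(1,2) by blast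
    qed
    have "(\<Prod>S, e * \<Prod>(P - S)) \<in> decompositions c" unfolding decompositions_def using 1 2 3 4 by blast
    then show "X \<in> decompositions c // unit_equiv" unfolding X by (rule quotientI)
  next
    fix X assume "X \<in> decompositions c // unit_equiv"
    then obtain n m where nm: "(n, m) \<in> decompositions c" and X: "X = unit_equiv `` {(n, m)}" by (auto elim!: quotientE)
    then have c: "c = n * m" and nmc: "coprime n m" and n: "\<not> (\<exists>\<epsilon>. is_unit \<epsilon> \<and> n = \<epsilon> * c)" and m: "\<not> (\<exists>\<epsilon>. is_unit \<epsilon> \<and> m = \<epsilon> * c)"
      unfolding decompositions_def by auto
    define S where "S = {q \<in> P. q dvd n}"
    have SP: "S \<subseteq> P" unfolding S_def by blast
    have dm: "q dvd m" if qPS: "q \<in> P - S" for q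
    proof -
      obtain p k where pk: "prime_elem p" "k > 0" "q = p ^ k" using pp[of q] qPS by blast
      have "q dvd c" unfolding P(3) using qPS P(1) by (intro dvd_mult dvd_prodI[where f = "\<lambda>x. x"]) auto
      then have q: "q dvd n * m" using c by simp
      have "\<not> p dvd m \<or> \<not> p dvd n"
        using nmc pk(1) coprime_common_divisor[of n m p] by (auto simp: prime_elem_def)
      then show "q dvd m"
      proof
        assume "\<not> p dvd m"
        then have "coprime q m" unfolding pk(3) using pk(1) prime_elem_imp_coprime by auto
        then have "q dvd n" using q coprime_dvd_mult_left_iff by blast
        then show ?thesis using qPS unfolding S_def by blast
      next
        assume "\<not> p dvd n"
        then have "coprime q n" unfolding pk(3) using pk(1) prime_elem_imp_coprime by auto
        then show ?thesis using q coprime_dvd_mult_right_iff by blast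
      qed
    qed
    have "\<Prod>S dvd n" using P(1) cop by (intro prod_dvd_of_coprime) (auto simp: S_def)
    then obtain a where a: "n = \<Prod>S * a" by (elim dvdE)
    have "\<Prod>(P - S) dvd m" using P(1) cop dm by (intro prod_dvd_of_coprime) auto
    then obtain b where b: "m = \<Prod>(P - S) * b" by (elim dvdE)
    have "(\<Prod>S * \<Prod>(P - S)) * (a * b) = (\<Prod>S * \<Prod>(P - S)) * e"
      using P(3) unfolding split[OF SP] c a b by (simp add: mult_ac)
    moreover have "\<Prod>S * \<Prod>(P - S) \<noteq> 0" using nz[of P] split[OF SP] by simp
    ultimately have ab: "a * b = e" by (simp only: mult_cancel_left) simp
    then have "is_unit a" using P(2) by (auto simp: is_unit_mult_iff)
    then obtain a' where a': "a * a' = 1" by (metis dvdE)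
    have "m = a' * (e * \<Prod>(P - S))" unfolding b ab[symmetric] using a' by algebra
    moreover have "n = a * \<Prod>S" unfolding a by (rule mult.commute)
    ultimately have "((\<Prod>S, e * \<Prod>(P - S)), (n, m)) \<in> unit_equiv" unfolding unit_equiv_def using a' by blast
    then have "unit_equiv `` {(\<Prod>S, e * \<Prod>(P - S))} = X" unfolding X by (rule equiv_class_eq[OF unit_equiv_equiv])
    moreover have "S \<noteq> {}"
    proof
      assume "S = {}"
      then have "n = a" using a by simp
      then have "a' * c = (a * a') * m" unfolding c by (simp add: mult_ac)
      then have "m = a' * c" using a' by simp
      moreover have "is_unit a'" using a' by (metis dvd_triv_right)
      ultimately show False using m by blast
    qed
    moreover have "S \<noteq> P"
    proof
      assume "S = P"
      then have mb: "m = b" using b by simp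
      have "is_unit b" using ab P(2) by (auto simp: is_unit_mult_iff)
      then obtain b' where b': "b * b' = 1" by (metis dvdE)
      have "b' * c = (b * b') * n" unfolding c mb by (simp add: mult_ac)
      then have "n = b' * c" using b' by simp
      moreover have "is_unit b'" using b' by (metis dvd_triv_right)
      ultimately show False using n by blast
    qed
    ultimately show "X \<in> (\<lambda>S. unit_equiv `` {(\<Prod>S, e * \<Prod>(P - S))}) ` (Pow P - {{}, P})" using SP by blast
  qed
qed

context fraction_character
begin

text \<open>The expansion of the product of the local identities over subsets of the prime powers dividing \<open>c\<close>. The
summand \<open>X\<close> is only assumed to have the right value on genuine coprime factorisations, which is all that the
representative picked from a class of decompositions is known to be.\<close>
lemma quartic_sum_decomposition:
  assumes c: "c \<noteq> 0" "coprime 2 c" "\<not> is_unit c" and D: "coprime D c"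
    and X: "\<And>n m. n * m = c \<Longrightarrow> coprime n m \<Longrightarrow> X n m = quadratic_sum (inv_mod n m * D) n * kloosterman_sum (inv_mod m n * D) m"
  shows "quartic_sum D c = kloosterman_sum D c + quadratic_sum D c + (\<Sum>\<Delta>\<in>decompositions c // unit_equiv. case SOME d. d \<in> \<Delta> of (n, m) \<Rightarrow> X n m)"
proof -
  obtain P e where P: "finite P" "is_unit e" "c = e * \<Prod>P" 
    and pp: "\<And>q. q \<in> P \<Longrightarrow> \<exists>p k. prime_elem p \<and> k > 0 \<and> q = p ^ k"
    and cop: "\<And>q q'. q \<in> P \<Longrightarrow> q' \<in> P \<Longrightarrow> q \<noteq> q' \<Longrightarrow> coprime q q'"
    using coprime_prime_power_factorization[OF c(1)] by blast
  interpret L: twisted_multiplicative quartic_sum by (rule twisted_quartic_sum)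
  interpret Q: twisted_multiplicative quadratic_sum by (rule twisted_quadratic_sum)
  interpret E: twisted_multiplicative kloosterman_sum by (rule twisted_kloosterman_sum)
  define \<iota> where "\<iota> q = inv_mod q (e * \<Prod>(P - {q})) * D" for q
  have qc: "q dvd c" if "q \<in> P" for q
    unfolding P(3) using that P(1) by (intro dvd_mult dvd_prodI[where f = "\<lambda>x. x"]) auto
  have q2: "q \<noteq> 0 \<and> coprime 2 q" if "q \<in> P" for q
    using qc[OF that] c coprime_divisors[of 2 2 q c] by auto
  have loc: "quartic_sum (\<iota> q) q = quadratic_sum (\<iota> q) q + kloosterman_sum (\<iota> q) q" if q: "q \<in> P" for q
  proof -
    obtain p k where pk: "prime_elem p" "k > 0" "q = p ^ k" using pp q by blast
    have pq: "p dvd q" unfolding pk(3) using pk(2) by simp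
    have np: "\<not> is_unit p" using pk(1) by (auto simp: prime_elem_def)
    have "\<not> p dvd 2" using q2[OF q] pq np coprime_common_divisor[of 2 q p] by blast
    then interpret odd_prime_character p ef by unfold_locales (rule pk(1))
    have "coprime (\<Prod>(P - {q})) q" using q cop by (intro prod_coprime_left) blast
    then have "coprime (e * \<Prod>(P - {q})) q" using is_unit_left_imp_coprime[OF P(2)] by simp
    then have "coprime (\<iota> q) q" unfolding \<iota>_def
      using inv_mod_coprime D coprime_divisors[of D D q c] qc[OF q] by simp
    then have "\<not> p dvd \<iota> q" using pq np coprime_common_divisor by blast
    then show ?thesis unfolding pk(3) by (rule quartic_sum_prime_power[OF _ pk(2)])
  qed
  define t where "t S = (\<Prod>q\<in>S. quadratic_sum (\<iota> q) q) * (\<Prod>q\<in>P - S. kloosterman_sum (\<iota> q) q)" for S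
  have "quartic_sum D c = (\<Prod>q\<in>P. quartic_sum (\<iota> q) q)" unfolding P(3) \<iota>_def by (rule L.at_prod[OF P(1,2) q2 cop])
  also have "\<dots> = (\<Prod>q\<in>P. quadratic_sum (\<iota> q) q + kloosterman_sum (\<iota> q) q)" using loc by simp
  also have "\<dots> = (\<Sum>S\<in>Pow P. t S)" unfolding t_def by (rule prod_add[OF P(1)])
  also have "\<dots> = t P + t {} + (\<Sum>S\<in>Pow P - {{}, P}. t S)"
  proof -
    have "P \<noteq> {}" using P c(3) by auto
    moreover have "Pow P = insert P (insert {} (Pow P - {{}, P}))" by blast
    ultimately show ?thesis using P(1) by (metis (no_types, lifting) Diff_iff add.assoc empty_iff finite.insertI finite_Diff finite_Pow_iff insertE insertI1 insert_iff sum.insert)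
  qed
  also have "t P = quadratic_sum D c" unfolding t_def P(3) \<iota>_def using Q.at_prod[OF P(1,2) q2 cop] by simp
  also have "t {} = kloosterman_sum D c" unfolding t_def P(3) \<iota>_def using E.at_prod[OF P(1,2) q2 cop] by simp
  also have "(\<Sum>S\<in>Pow P - {{}, P}. t S) = (\<Sum>S\<in>Pow P - {{}, P}. case SOME d. d \<in> unit_equiv `` {(\<Prod>S, e * \<Prod>(P - S))} of (n, m) \<Rightarrow> X n m)"
  proof (rule sum.cong[OF refl])
    fix S assume "S \<in> Pow P - {{}, P}"
    then have SP: "S \<subseteq> P" by blast
    let ?C = "unit_equiv `` {(\<Prod>S, e * \<Prod>(P - S))}"
    obtain n m where nm: "(SOME d. d \<in> ?C) = (n, m)" by (cases "SOME d. d \<in> ?C")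
    have "(\<Prod>S, e * \<Prod>(P - S)) \<in> ?C" by (rule equiv_class_self[OF unit_equiv_equiv]) simp
    then have "(SOME d. d \<in> ?C) \<in> ?C" by (rule someI)
    then have "(n, m) \<in> ?C" by (simp only: nm)
    then obtain u v where uv: "u * v = 1" "n = u * \<Prod>S" "m = v * (e * \<Prod>(P - S))"
      unfolding unit_equiv_def by auto
    have unit: "is_unit u" "is_unit v" using uv(1) by (metis dvd_triv_left, metis dvd_triv_right)
    have m: "m = (v * e) * \<Prod>(P - S)" using uv(3) by (simp add: mult.assoc)
    have "\<Prod>P = \<Prod>S * \<Prod>(P - S)"
      using prod.subset_diff[OF SP P(1), of "\<lambda>x. x"] by (simp add: mult.commute)
    then have prod: "n * m = e * \<Prod>P" unfolding uv using uv(1) by algebra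
    then have prod': "m * n = e * \<Prod>P" by (simp add: mult.commute)
    have "coprime (\<Prod>S) (\<Prod>(P - S))" using SP cop by (intro prod_coprime_left prod_coprime_right) auto
    then have nmc: "coprime n m" unfolding uv
      by (simp add: is_unit_left_imp_coprime[OF unit(1)] is_unit_right_imp_coprime[OF unit(2)]
          is_unit_right_imp_coprime[OF P(2)])
    then have mnc: "coprime m n" by (simp add: coprime_commute)
    have "X n m = quadratic_sum (inv_mod n m * D) n * kloosterman_sum (inv_mod m n * D) m"
      using X prod nmc P(3) by simp
    also have "quadratic_sum (inv_mod n m * D) n = (\<Prod>q\<in>S. quadratic_sum (\<iota> q) q)"
      unfolding \<iota>_def by (rule Q.at_subproduct[OF P(1,2) q2 cop SP uv(2) unit(1) prod nmc])
    also have "kloosterman_sum (inv_mod m n * D) m = (\<Prod>q\<in>P - S. kloosterman_sum (\<iota> q) q)"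
      unfolding \<iota>_def using unit P(2) by (intro E.at_subproduct[OF P(1,2) q2 cop _ m _ prod' mnc]) auto
    finally show "t S = (case SOME d. d \<in> ?C of (n, m) \<Rightarrow> X n m)" unfolding nm t_def by simp
  qed
  also have "\<dots> = (\<Sum>\<Delta>\<in>decompositions c // unit_equiv. case SOME d. d \<in> \<Delta> of (n, m) \<Rightarrow> X n m)"
    by (rule sum.reindex_bij_betw[OF decompositions_bij[OF P c(1) pp cop]])
  finally show ?thesis by simp
qed

section \<open>Reduction to one parameter and conclusion\<close>

text \<open>Completing the square: \<open>z = 2 + 4Ax/B\<close>. The factor \<open>t\<close> is the inverse of the other modulus in a cross term.\<close>
lemma quadratic_substitution:
  assumes n: "n \<noteq> 0" "coprime 2 n" "coprime A n" "coprime B n"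
    and D: "cong8 n (16 * A * D) (t * B ^ 2)"
  shows "(\<Sum>x\<in>reps8 n. ef (t * (A * x ^ 2 + B * x)) n) = quadratic_sum D n"
proof -
  let ?b = "inv_mod n B" and ?k = "4 * A * inv_mod n B"
  have i: "cong8 n (B * ?b) 1" by (rule inv_mod[OF n(4)])
  have "coprime 4 n" using n(2) coprime_mult_left_iff[of 2 2 n] by simp
  then have k: "coprime ?k n" using n inv_mod_coprime by simp
  have per: "ef (D * (x ^ 2 - 4)) n = ef (D * (y ^ 2 - 4)) n" if "cong8 n x y" for x y
    by (intro ef_cong n cong8_mult cong8_diff cong8_power that) auto
  have "ef (D * ((?k * x + 2) ^ 2 - 4)) n = ef (t * (A * x ^ 2 + B * x)) n" for x
  proof (rule ef_cong[OF n(1)])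
    have "D * ((?k * x + 2) ^ 2 - 4) = (16 * A * D) * (A * (?b * x) ^ 2 + ?b * x)" by algebra
    also have "cong8 n \<dots> ((t * B ^ 2) * (A * (?b * x) ^ 2 + ?b * x))" by (intro cong8_mult D) simp
    also have "(t * B ^ 2) * (A * (?b * x) ^ 2 + ?b * x) = t * (A * (B * ?b) ^ 2 * x ^ 2 + B * ?b * (B * x))" by algebra
    also have "cong8 n \<dots> (t * (A * 1 ^ 2 * x ^ 2 + 1 * (B * x)))" by (intro cong8_mult cong8_add cong8_power i) auto
    finally show "cong8 n (D * ((?k * x + 2) ^ 2 - 4)) (t * (A * x ^ 2 + B * x))" by simp
  qed
  then show ?thesis unfolding quadratic_sum_def using sum_reps8_affine[where f = "\<lambda>x. ef (D * (x ^ 2 - 4)) n" and t = 2, OF k per] by simp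
qed

text \<open>Here \<open>z = 2sx/B\<close>, so that \<open>z\<^sup>2 = 4Ax\<^sup>2/B\<close>; this uses the square root \<open>s\<close> of \<open>AB\<close>.\<close>
lemma quartic_substitution:
  assumes n: "n \<noteq> 0" "coprime 2 n" "coprime A n" "coprime B n" "A * B = s ^ 2"
    and D: "cong8 n (16 * A * D) (B ^ 2)"
  shows "(\<Sum>x\<in>reps8 n. ef (A * x ^ 4 + B * x ^ 2) n) = quartic_sum D n"
proof -
  let ?b = "inv_mod n B" and ?k = "2 * s * inv_mod n B"
  have i: "cong8 n (B * ?b) 1" by (rule inv_mod[OF n(4)])
  have "coprime (s ^ 2) n" using n(3,4) unfolding n(5)[symmetric] by simp
  then have k: "coprime ?k n" using n inv_mod_coprime by simp
  have per: "ef (D * (x ^ 4 + 4 * x ^ 2)) n = ef (D * (y ^ 4 + 4 * y ^ 2)) n" if "cong8 n x y" for x y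
    by (intro ef_cong n cong8_mult cong8_add cong8_power that) auto
  have "ef (D * ((?k * x + 0) ^ 4 + 4 * (?k * x + 0) ^ 2)) n = ef (A * x ^ 4 + B * x ^ 2) n" for x
  proof (rule ef_cong[OF n(1)])
    have "D * ((?k * x + 0) ^ 4 + 4 * (?k * x + 0) ^ 2) = (16 * A * D) * (A * (B * ?b) ^ 2 * (?b * x ^ 2) ^ 2 + (B * ?b) * (?b * x ^ 2))"
      using n(5) by algebra
    also have "cong8 n \<dots> ((B ^ 2) * (A * 1 ^ 2 * (?b * x ^ 2) ^ 2 + 1 * (?b * x ^ 2)))" by (intro cong8_mult cong8_add cong8_power D i) auto
    also have "(B ^ 2) * (A * 1 ^ 2 * (?b * x ^ 2) ^ 2 + 1 * (?b * x ^ 2)) = A * (B * ?b) ^ 2 * x ^ 4 + (B * ?b) * (B * x ^ 2)"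
      unfolding power_one mult_1 mult_1_right by algebra
    also have "cong8 n \<dots> (A * 1 ^ 2 * x ^ 4 + 1 * (B * x ^ 2))" by (intro cong8_mult cong8_add cong8_power i) auto
    finally show "cong8 n (D * ((?k * x + 0) ^ 4 + 4 * (?k * x + 0) ^ 2)) (A * x ^ 4 + B * x ^ 2)" by simp
  qed
  then show ?thesis unfolding quartic_sum_def using sum_reps8_affine[where f = "\<lambda>x. ef (D * (x ^ 4 + 4 * x ^ 2)) n" and t = 0, OF k per] by (simp only:)
qed

text \<open>The exponential factor \<open>e(-2D/m)\<close> completes \<open>x + 1/x\<close> to \<open>(x - 1)\<^sup>2 / x\<close>.\<close>
lemma kloosterman_substitution:
  assumes "m \<noteq> 0" "cong8 m u (- 2 * D)"
  shows "ef u m * (\<Sum>x | x \<in> reps8 m \<and> coprime x m. residue_symbol 4 x m * ef (D * x + D * inv_mod m x) m) = kloosterman_sum D m"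
  unfolding kloosterman_sum_def sum_distrib_left
proof (rule sum.cong[OF refl])
  fix x assume "x \<in> {x \<in> reps8 m. coprime x m}"
  then have x: "coprime x m" by simp
  let ?v = "inv_mod m x"
  have "cong8 m (u + (D * x + D * ?v)) (-2 * D * 1 + (D * x + D * ?v))" using assms(2) by (intro cong8_add) simp_all
  also have "cong8 m \<dots> (D * ((x - 1) ^ 2 * ?v))"
  proof (rule cong8I)
    show "(-2 * D * 1 + (D * x + D * ?v)) - (D * ((x - 1) ^ 2 * ?v)) = (x * ?v - 1) * (D * (2 - x))" by algebra
    show "m dvd (x * ?v - 1) * (D * (2 - x))" using inv_mod[OF x] unfolding cong8_def by simp
  qed
  finally have "ef u m * ef (D * x + D * ?v) m = ef (D * ((x - 1) ^ 2 * ?v)) m"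
    unfolding ef_add[symmetric] by (rule ef_cong[OF assms(1)])
  then show "ef u m * (residue_symbol 4 x m * ef (D * x + D * ?v) m) = residue_symbol 4 x m * ef (D * ((x - 1) ^ 2 * ?v)) m"
    by (simp add: mult_ac)
qed

end

theorem proposition8p6:
  fixes \<delta> :: complex and A B c :: zeta8
  assumes "generates_different \<delta>"
    and "cong8 4 c 1"
    and "\<not> is_unit c"
    and "coprime (A * B) c"
    and "\<exists>a. A = a ^ 2"
    and "\<exists>b. B = b ^ 2"
  shows "sum_mod c (\<lambda>x. efrac \<delta> (A * x ^ 4 + B * x ^ 2) c) =
      residue_symbol 2 (A * B) c *
      efrac \<delta> (- (B ^ 2) * inv_mod c (8 * A)) c *
      S4 \<delta> (inv_mod c (4 ^ 2 * A) * B ^ 2) (inv_mod c (4 ^ 2 * A) * B ^ 2) c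
    + sum_mod c (\<lambda>x. efrac \<delta> (A * x ^ 2 + B * x) c)
    + cross_terms \<delta> A B c"
proof -
  interpret fraction_character "efrac \<delta>" by (rule fraction_character_efrac[OF assms(1)])
  obtain a b where ab: "A = a ^ 2" "B = b ^ 2" using assms(5,6) by blast
  have s: "A * B = (a * b) ^ 2" unfolding ab by (simp add: power_mult_distrib)
  obtain k where k: "c - 1 = 4 * k" using assms(2) unfolding cong8_def by (auto elim: dvdE)
  have "2 * (- (2 * k)) + c * 1 = 1" using k by algebra
  then have two: "coprime 2 c" unfolding bezout8 by blast
  have "nrm8 2 = 2 ^ 4" using nrm8_of_int[of 2] by simp
  then have "\<not> is_unit (2 :: zeta8)" unfolding is_unit_iff_nrm8 by simp
  then have c0: "c \<noteq> 0" using two by auto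
  have cA: "coprime A c" and cB: "coprime B c" using assms(4) by auto
  have c16: "coprime 16 c"
  proof -
    have "coprime (2 ^ 4) c" using two by (simp only: coprime_power_left_iff simp_thms)
    then show ?thesis by simp
  qed
  have c8: "coprime 8 c"
  proof -
    have "coprime (2 ^ 3) c" using two by (simp only: coprime_power_left_iff simp_thms)
    then show ?thesis by simp
  qed
  define D where "D = B ^ 2 * inv_mod c (16 * A)"
  have D16: "cong8 c (16 * A * D) (B ^ 2)"
  proof -
    have "cong8 c (16 * A * inv_mod c (16 * A) * B ^ 2) (1 * B ^ 2)"
      using c16 cA by (intro cong8_mult inv_mod) simp_all
    then show ?thesis unfolding D_def by (simp add: mult_ac)
  qed
  have cD: "coprime D c" unfolding D_def using cB c16 cA inv_mod_coprime by simp
  \<comment> \<open>The parameters of the Kloosterman term agree with \<open>D/n\<close> modulo \<open>m\<close>; for \<open>n = 1\<close> this is the main term.\<close>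
  have E: "residue_symbol 2 (A * B) m * efrac \<delta> (- (B ^ 2) * inv_mod m (8 * A * n)) m *
      S4 \<delta> (B ^ 2 * inv_mod m (n * 4 ^ 2 * A)) (B ^ 2 * inv_mod m (n * 4 ^ 2 * A)) m = kloosterman_sum (inv_mod m n * D) m"
    if nm: "n * m = c" "coprime n m" for n m
  proof -
    have mc: "m dvd c" using nm by auto
    have m0: "m \<noteq> 0" using c0 nm by auto
    have cm: "coprime x m" if "coprime x c" for x using that mc coprime_divisors[of x x m c] by simp
    have "coprime (a * b) c" using assms(4) unfolding s by simp
    then have 1: "residue_symbol 2 (A * B) m = 1" unfolding s by (intro residue_symbol_2_square cm two m0)
    let ?D = "B ^ 2 * inv_mod m (n * 4 ^ 2 * A)"
    have co: "coprime (n * 4 ^ 2 * A) m" "coprime (8 * A * n) m" using cm[OF c16] cm[OF c8] cm[OF cA] nm(2) by simp_all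
    have "cong8 m (8 * A * n * (2 * inv_mod m (n * 4 ^ 2 * A))) 1"
      using inv_mod[OF co(1)] by (simp add: mult_ac)
    then have "cong8 m (inv_mod m (8 * A * n)) (2 * inv_mod m (n * 4 ^ 2 * A))" by (rule inv_mod_unique)
    then have "cong8 m (- (B ^ 2) * inv_mod m (8 * A * n)) (- (B ^ 2) * (2 * inv_mod m (n * 4 ^ 2 * A)))"
      by (intro cong8_mult) simp_all
    then have 2: "cong8 m (- (B ^ 2) * inv_mod m (8 * A * n)) (- 2 * ?D)" by (simp add: mult_ac)
    have "cong8 m (inv_mod m n * inv_mod c (16 * A)) (inv_mod m (n * (16 * A)))"
      using nm(2) c16 cA by (intro inv_mod_mult mc) simp_all
    then have "cong8 m (B ^ 2 * (inv_mod m n * inv_mod c (16 * A))) (B ^ 2 * inv_mod m (n * (16 * A)))"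
      by (intro cong8_mult) simp_all
    then have "cong8 m (inv_mod m n * D) ?D" unfolding D_def by (simp add: mult_ac)
    then have 3: "kloosterman_sum (inv_mod m n * D) m = kloosterman_sum ?D m"
      by (rule twisted_multiplicative.param_cong[OF twisted_kloosterman_sum m0])
    show ?thesis unfolding 1 3 S4_def sum_mod_inv_eq mult_1 by (rule kloosterman_substitution[OF m0 2])
  qed
  have X: "cross_term \<delta> A B n m = quadratic_sum (inv_mod n m * D) n * kloosterman_sum (inv_mod m n * D) m"
    if nm: "n * m = c" "coprime n m" for n m
  proof -
    have nc: "n dvd c" using nm by auto
    have n0: "n \<noteq> 0" using c0 nm by auto
    have cn: "coprime x n" if "coprime x c" for x using that nc coprime_divisors[of x x n c] by simp
    have "cong8 n (inv_mod n m * (16 * A * D)) (inv_mod n m * B ^ 2)"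
      by (intro cong8_mult cong8_dvd_mod[OF D16 nc]) simp
    then have "cong8 n (16 * A * (inv_mod n m * D)) (inv_mod n m * B ^ 2)" by (simp add: mult_ac)
    from quadratic_substitution[OF n0 cn[OF two] cn[OF cA] cn[OF cB] this]
    show ?thesis unfolding cross_term_def sum_mod_eq E[OF nm] by (simp only:)
  qed
  have "sum_mod c (\<lambda>x. efrac \<delta> (A * x ^ 4 + B * x ^ 2) c) = quartic_sum D c"
    unfolding sum_mod_eq by (rule quartic_substitution[OF c0 two cA cB s D16])
  also have "\<dots> = kloosterman_sum D c + quadratic_sum D c + cross_terms \<delta> A B c"
    unfolding cross_terms_def using X by (rule quartic_sum_decomposition[OF c0 two assms(3) cD])
  also have "quadratic_sum D c = sum_mod c (\<lambda>x. efrac \<delta> (A * x ^ 2 + B * x) c)"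
    unfolding sum_mod_eq using quadratic_substitution[OF c0 two cA cB, of D 1] D16 by simp
  also have "kloosterman_sum D c = residue_symbol 2 (A * B) c * efrac \<delta> (- (B ^ 2) * inv_mod c (8 * A)) c *
      S4 \<delta> (inv_mod c (4 ^ 2 * A) * B ^ 2) (inv_mod c (4 ^ 2 * A) * B ^ 2) c"
  proof -
    have "cong8 c (inv_mod c 1) 1" by (rule inv_mod_unique) simp
    then have "cong8 c (inv_mod c 1 * D) (1 * D)" by (intro cong8_mult) simp_all
    then have "kloosterman_sum (inv_mod c 1 * D) c = kloosterman_sum D c"
      using twisted_multiplicative.param_cong[OF twisted_kloosterman_sum c0] by simp
    then show ?thesis using E[of 1 c] by (simp add: mult_ac)
  qed
  finally show ?thesis .
qed

end
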